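(* Let $M$ be a finite CW complex, and let $\mathbb{K}_M$ be its associated Lefschetz complex. If $f$ is a discrete Morse-Bott function on $M$, then $f$ is also a discrete Morse-Bott function on $\mathbb{K}_M$, and $$R_t(M,f)=R_t(\mathbb{K}_M,f).$$ In particular, $R_t(M,f)$ has nonnegative integer coefficients.
   Context: A Lefschetz complex is a triple $\mathbb{K}=(X,\dim,w)$, where $X$ is a set (of cells), $\dim\colon X\to\mathbb{Z}_{\ge0}$ and $w\colon X\times X\to\mathbb{R}$ are functions, $\dim^{-1}(k)$ is finite for every $k$, and: (L1) $w(\tau,\sigma)\neq0$ implies $\dim\tau-\dim\sigma=1$; (L2) $\sum_{\sigma\in X}w(\tau,\sigma)w(\sigma,\nu)=0$ for all $\tau,\nu\in X$. For a CW complex $M$ with finitely many cells in each dimension (with characteristic maps, hence orientations of cells, fixed), the associated Lefschetz complex $\mathbb{K}_M=(X,\dim,w)$ has as $X$ the set of cells of $M$, $\dim$ the cellular dimension, and $w(\tau,\sigma)$ the coefficient of $\sigma$ in the cellular boundary $\partial\tau$. $C_k(\mathbb{K})$ is the real vector space with basis the $k$-cells, $C_{-1}(\mathbb{K})=\{0\}$, $\partial_k(\tau)=\sum_\sigma w(\tau,\sigma)\sigma$ for a $k$-cell $\tau$, $B_k(\mathbb{K})=\operatorname{im}\partial_{k+1}$, $H_k(\mathbb{K})=\ker\partial_k/B_k(\mathbb{K})$, and $P_t(\mathbb{K})=\sum_{k\ge0}\operatorname{rank}H_k(\mathbb{K})\,t^k$. For $f\colon\mathbb{K}\to\mathbb{R}$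 put $U^{\mathrm{snc}}(\sigma)=\#\{\tau\mid w(\tau,\sigma)\ne0,\ f(\sigma)>f(\tau)\}$, $D^{\mathrm{snc}}(\sigma)=\#\{\nu\mid w(\sigma,\nu)\ne0,\ f(\sigma)<f(\nu)\}$. $f$ is discrete Morse-Bott on $\mathbb{K}$ if $U^{\mathrm{snc}}(\sigma)\le1$ and $D^{\mathrm{snc}}(\sigma)\le1$ for all $\sigma$. A cell $\sigma$ is weakly critical if $U^{\mathrm{snc}}(\sigma)+D^{\mathrm{snc}}(\sigma)=0$. $\mathbb{W}(\mathbb{K},f)$ is the Lefschetz complex whose cells are the weakly critical cells, with restricted dimension function and incidence function $w(\tau,\sigma)$ if $f(\tau)=f(\sigma)$ and $0$ otherwise. With $d_k^{\mathrm{snc}}(\mathbb{K},f)=\#\{k\text{-cells }\sigma\mid D^{\mathrm{snc}}(\sigma)=1\}$, $$R_t(\mathbb{K},f)=\sum_{k=1}^\infty\bigl(\operatorname{rank}B_{k-1}(\mathbb{K})-d_k^{\mathrm{snc}}(\mathbb{K},f)-\operatorname{rank}B_{k-1}(\mathbb{W}(\mathbb{K},f))\bigr)t^{k-1}.$$ For the finite CW complex $M$ and a real-valued function $f$ on its cells, the numbers $U^{\mathrm{snc}}(\sigma)$, $D^{\mathrm{snc}}(\sigma)$ in $M$ are defined by the same formulas using the cellular incidence numbers of $M$, and $f$ is a discrete Morse-Bott function on $M$ if both are at most $1$ for every cell. The weakly critical sets are the nonempty sets of the form $C=\{\sigma\mid f(\sigma)=r,\ U^{\mathrm{snc}}(\sigma)+D^{\mathrm{snc}}(\sigma)=0\}$,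 $r\in\mathbb{R}$, and $\mathcal{C}_f$ is their collection. $P_t(M)$ is the Poincaré polynomial of $M$ (Betti numbers of the homology of the space $M$), $P_t(C)$ is the Poincaré polynomial of the chain complex spanned by the cells of $C$ with the cellular incidence numbers of $M$ restricted to $C$, and $R_t(M,f)$ is the remainder determined by $$\sum_{C\in\mathcal{C}_f}P_t(C)=P_t(M)+(1+t)R_t(M,f).$$ *)

theory Defs
  imports
    "HOL-Homology.Homology"
    "HOL-Analysis.Finite_Function_Topology"
    "HOL-Computational_Algebra.Formal_Power_Series"
begin

section \<open>Lefschetz complexes\<close>

record 'c lefschetz =
  cells :: "'c set"
  cell_dim :: "'c \<Rightarrow> nat"
  incidence :: "'c \<Rightarrow> 'c \<Rightarrow> real"

definition k_cells :: "'c lefschetz \<Rightarrow> nat \<Rightarrow> 'c set" where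
  "k_cells K k = {\<sigma> \<in> cells K. cell_dim K \<sigma> = k}"

text \<open>
  The set of cells may be infinite, so the sum in the last condition runs over the
  cells \<open>\<sigma>\<close> with \<open>w \<tau> \<sigma> \<noteq> 0\<close>; these are finitely many by the first two conditions
  (a sum over an infinite set would be 0 by convention).
\<close>
definition lefschetz_complex :: "'c lefschetz \<Rightarrow> bool" where
  "lefschetz_complex K \<longleftrightarrow>
     (\<forall>k. finite (k_cells K k)) \<and>
     (\<forall>\<tau>\<in>cells K. \<forall>\<sigma>\<in>cells K.
        incidence K \<tau> \<sigma> \<noteq> 0 \<longrightarrow> int (cell_dim K \<tau>) - int (cell_dim K \<sigma>) = 1) \<and>
     (\<forall>\<tau>\<in>cells K. \<forall>\<nu>\<in>cells K.
        (\<Sum>\<sigma> | \<sigma> \<in> cells K \<and> incidence K \<tau> \<sigma> \<noteq> 0. incidence K \<tau> \<sigma> * incidence K \<sigma> \<nu>) = 0)"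

text \<open>
  Chains are finitely supported functions on cells; the basis vector of a cell \<open>\<sigma>\<close> is
  \<open>Poly_Mapping.single \<sigma> 1\<close>.
\<close>
definition chains :: "'c lefschetz \<Rightarrow> nat \<Rightarrow> ('c \<Rightarrow>\<^sub>0 real) set" where
  "chains K k = {c. Poly_Mapping.keys c \<subseteq> k_cells K k}"

definition bdry_cell :: "'c lefschetz \<Rightarrow> 'c \<Rightarrow> ('c \<Rightarrow>\<^sub>0 real)" where
  "bdry_cell K \<tau> =
     (\<Sum>\<sigma> | \<sigma> \<in> cells K \<and> incidence K \<tau> \<sigma> \<noteq> 0. incidence K \<tau> \<sigma> *\<^sub>R Poly_Mapping.single \<sigma> 1)"

definition bdry :: "'c lefschetz \<Rightarrow> ('c \<Rightarrow>\<^sub>0 real) \<Rightarrow> ('c \<Rightarrow>\<^sub>0 real)" where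
  "bdry K c = (\<Sum>\<tau>\<in>Poly_Mapping.keys c. Poly_Mapping.lookup c \<tau> *\<^sub>R bdry_cell K \<tau>)"

text \<open>For \<open>k = 0\<close> all chains are cycles, as \<open>w \<tau> \<sigma> = 0\<close> for every 0-cell \<open>\<tau>\<close>.\<close>
definition cycles :: "'c lefschetz \<Rightarrow> nat \<Rightarrow> ('c \<Rightarrow>\<^sub>0 real) set" where
  "cycles K k = {c \<in> chains K k. bdry K c = 0}"

definition boundaries :: "'c lefschetz \<Rightarrow> nat \<Rightarrow> ('c \<Rightarrow>\<^sub>0 real) set" where
  "boundaries K k = bdry K ` chains K (Suc k)"

text \<open>
  Dimension of the quotient vector space \<open>V / W\<close> (for finite-dimensional \<open>V\<close>): the largest
  number of vectors in \<open>V\<close> whose classes are linearly independent in \<open>V / W\<close>.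
\<close>
definition quotient_dim :: "'v::real_vector set \<Rightarrow> 'v set \<Rightarrow> nat" where
  "quotient_dim V W =
     Sup {card S |S. finite S \<and> S \<subseteq> V \<and>
       (\<forall>c :: 'v \<Rightarrow> real. (\<Sum>s\<in>S. c s *\<^sub>R s) \<in> W \<longrightarrow> (\<forall>s\<in>S. c s = 0))}"

definition rank_H :: "'c lefschetz \<Rightarrow> nat \<Rightarrow> nat" where
  "rank_H K k = quotient_dim (cycles K k) (boundaries K k)"

definition rank_B :: "'c lefschetz \<Rightarrow> nat \<Rightarrow> nat" where
  "rank_B K k = dim (boundaries K k)"

definition poincare :: "'c lefschetz \<Rightarrow> real fps" where
  "poincare K = Abs_fps (\<lambda>k. real (rank_H K k))"

definition U_snc :: "'c lefschetz \<Rightarrow> ('c \<Rightarrow> real) \<Rightarrow> 'c \<Rightarrow> nat" where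
  "U_snc K f \<sigma> = card {\<tau> \<in> cells K. incidence K \<tau> \<sigma> \<noteq> 0 \<and> f \<sigma> > f \<tau>}"

definition D_snc :: "'c lefschetz \<Rightarrow> ('c \<Rightarrow> real) \<Rightarrow> 'c \<Rightarrow> nat" where
  "D_snc K f \<sigma> = card {\<nu> \<in> cells K. incidence K \<sigma> \<nu> \<noteq> 0 \<and> f \<sigma> < f \<nu>}"

definition discrete_morse_bott :: "'c lefschetz \<Rightarrow> ('c \<Rightarrow> real) \<Rightarrow> bool" where
  "discrete_morse_bott K f \<longleftrightarrow> (\<forall>\<sigma>\<in>cells K. U_snc K f \<sigma> \<le> 1 \<and> D_snc K f \<sigma> \<le> 1)"

definition weakly_critical_complex :: "'c lefschetz \<Rightarrow> ('c \<Rightarrow> real) \<Rightarrow> 'c lefschetz" where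
  "weakly_critical_complex K f =
     \<lparr>cells = {\<sigma> \<in> cells K. U_snc K f \<sigma> + D_snc K f \<sigma> = 0},
      cell_dim = cell_dim K,
      incidence = (\<lambda>\<tau> \<sigma>. if f \<tau> = f \<sigma> then incidence K \<tau> \<sigma> else 0)\<rparr>"

definition d_snc :: "'c lefschetz \<Rightarrow> ('c \<Rightarrow> real) \<Rightarrow> nat \<Rightarrow> nat" where
  "d_snc K f k = card {\<sigma> \<in> k_cells K k. D_snc K f \<sigma> = 1}"

text \<open>The coefficient of \<open>t ^ (k - 1)\<close> for \<open>k \<ge> 1\<close>, written with \<open>k = Suc i\<close>.\<close>
definition remainder_lefschetz :: "'c lefschetz \<Rightarrow> ('c \<Rightarrow> real) \<Rightarrow> real fps" where
  "remainder_lefschetz K f =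
     Abs_fps (\<lambda>i. real (rank_B K i) - real (d_snc K f (Suc i))
                   - real (rank_B (weakly_critical_complex K f) i))"

section \<open>Finite CW complexes\<close>

definition disc :: "nat \<Rightarrow> (nat \<Rightarrow> real) topology" where
  "disc n = subtopology (Euclidean_space n) {x. (\<Sum>i<n. x i ^ 2) \<le> 1}"

text \<open>\<open>S\<^sup>n\<^sup>-\<^sup>1\<close> inside \<open>D\<^sup>n\<close>; empty for \<open>n = 0\<close>.\<close>
definition disc_sphere :: "nat \<Rightarrow> (nat \<Rightarrow> real) set" where
  "disc_sphere n = {x \<in> topspace (disc n). (\<Sum>i<n. x i ^ 2) = 1}"

definition disc_interior :: "nat \<Rightarrow> (nat \<Rightarrow> real) set" where
  "disc_interior n = {x \<in> topspace (disc n). (\<Sum>i<n. x i ^ 2) < 1}"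

text \<open>
  Cells are indexed by elements of \<open>'c\<close>. The last component is an orientation of the model
  discs: for each \<open>n\<close> a generator of the relative homology group of \<open>D\<^sup>n\<close> modulo \<open>S\<^sup>n\<^sup>-\<^sup>1\<close>.
  Together with the characteristic maps it orients the cells.
\<close>
record ('a, 'c) cw =
  cw_space :: "'a topology"
  cw_cells :: "'c set"
  cw_dim :: "'c \<Rightarrow> nat"
  cw_char :: "'c \<Rightarrow> (nat \<Rightarrow> real) \<Rightarrow> 'a"
  cw_orient :: "nat \<Rightarrow> (nat \<Rightarrow> real) chain set"

definition open_cell :: "('a, 'c) cw \<Rightarrow> 'c \<Rightarrow> 'a set" where
  "open_cell M \<sigma> = cw_char M \<sigma> ` disc_interior (cw_dim M \<sigma>)"

text \<open>
  The union of all cells of dimension less than \<open>n\<close>, that is, the \<open>(n - 1)\<close>-skeleton;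
  \<open>n = 0\<close> gives the empty \<open>(-1)\<close>-skeleton.
\<close>
definition skeleton_below :: "('a, 'c) cw \<Rightarrow> nat \<Rightarrow> 'a set" where
  "skeleton_below M n = (\<Union>\<sigma>\<in>{\<sigma> \<in> cw_cells M. cw_dim M \<sigma> < n}. open_cell M \<sigma>)"

text \<open>
  With finitely many cells the weak topology axiom holds automatically, since closed cells
  are compact, hence closed, and finitely many of them cover the space.
\<close>
definition finite_cw_complex :: "('a, 'c) cw \<Rightarrow> bool" where
  "finite_cw_complex M \<longleftrightarrow>
     Hausdorff_space (cw_space M) \<and>
     finite (cw_cells M) \<and>
     (\<Union>\<sigma>\<in>cw_cells M. open_cell M \<sigma>) = topspace (cw_space M) \<and>
     (\<forall>\<sigma>\<in>cw_cells M. \<forall>\<tau>\<in>cw_cells M. \<sigma> \<noteq> \<tau> \<longrightarrow> open_cell M \<sigma> \<inter> open_cell M \<tau> = {}) \<and>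
     (\<forall>\<sigma>\<in>cw_cells M.
        continuous_map (disc (cw_dim M \<sigma>)) (cw_space M) (cw_char M \<sigma>) \<and>
        homeomorphic_map
          (subtopology (disc (cw_dim M \<sigma>)) (disc_interior (cw_dim M \<sigma>)))
          (subtopology (cw_space M) (open_cell M \<sigma>)) (cw_char M \<sigma>) \<and>
        cw_char M \<sigma> ` disc_sphere (cw_dim M \<sigma>) \<subseteq> skeleton_below M (cw_dim M \<sigma>)) \<and>
     (\<forall>n. cw_orient M n \<in> carrier (relative_homology_group (int n) (disc n) (disc_sphere n)) \<and>
          generate (relative_homology_group (int n) (disc n) (disc_sphere n)) {cw_orient M n}
            = carrier (relative_homology_group (int n) (disc n) (disc_sphere n)))"

text \<open>The \<open>n\<close>-th cellular chain group, the homology of \<open>M\<^sup>n\<close> relative to \<open>M\<^sup>n\<^sup>-\<^sup>1\<close> in degree \<open>n\<close>.\<close>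
definition cellular_chain_group :: "('a, 'c) cw \<Rightarrow> nat \<Rightarrow> 'a chain set monoid" where
  "cellular_chain_group M n =
     relative_homology_group (int n)
       (subtopology (cw_space M) (skeleton_below M (Suc n))) (skeleton_below M n)"

definition cell_class :: "('a, 'c) cw \<Rightarrow> 'c \<Rightarrow> 'a chain set" where
  "cell_class M \<sigma> =
     (let n = cw_dim M \<sigma> in
        hom_induced (int n) (disc n) (disc_sphere n)
          (subtopology (cw_space M) (skeleton_below M (Suc n))) (skeleton_below M n)
          (cw_char M \<sigma>) (cw_orient M n))"

text \<open>
  Cellular boundary from degree \<open>Suc n\<close> to degree \<open>n\<close>, the connecting homomorphism of the
  triple \<open>(M\<^sup>n\<^sup>+\<^sup>1, M\<^sup>n, M\<^sup>n\<^sup>-\<^sup>1)\<close>.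
\<close>
definition cellular_boundary :: "('a, 'c) cw \<Rightarrow> nat \<Rightarrow> 'a chain set \<Rightarrow> 'a chain set" where
  "cellular_boundary M n =
     hom_relboundary (int (Suc n))
       (subtopology (cw_space M) (skeleton_below M (Suc (Suc n))))
       (skeleton_below M (Suc n)) (skeleton_below M n)"

text \<open>
  The coefficient of \<open>\<sigma>\<close> in the cellular boundary of \<open>\<tau>\<close>. The cell classes of the \<open>n\<close>-cells form
  a \<open>\<int>\<close>-basis of the cellular chain group (written multiplicatively), so the coefficient
  function \<open>c\<close> is uniquely determined on \<open>n\<close>-cells.
\<close>
definition cw_incidence :: "('a, 'c) cw \<Rightarrow> 'c \<Rightarrow> 'c \<Rightarrow> int" where
  "cw_incidence M \<tau> \<sigma> =
     (let n = cw_dim M \<sigma>; G = cellular_chain_group M n in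
      if cw_dim M \<tau> = Suc n
      then (SOME c :: 'c \<Rightarrow> int.
              cellular_boundary M n (cell_class M \<tau>) =
                finprod G (\<lambda>\<rho>. cell_class M \<rho> [^]\<^bsub>G\<^esub> c \<rho>) {\<rho> \<in> cw_cells M. cw_dim M \<rho> = n}) \<sigma>
      else 0)"

definition lefschetz_of_cw :: "('a, 'c) cw \<Rightarrow> 'c lefschetz" where
  "lefschetz_of_cw M =
     \<lparr>cells = cw_cells M, cell_dim = cw_dim M,
      incidence = (\<lambda>\<tau> \<sigma>. real_of_int (cw_incidence M \<tau> \<sigma>))\<rparr>"

definition cw_U_snc :: "('a, 'c) cw \<Rightarrow> ('c \<Rightarrow> real) \<Rightarrow> 'c \<Rightarrow> nat" where
  "cw_U_snc M f \<sigma> = card {\<tau> \<in> cw_cells M. cw_incidence M \<tau> \<sigma> \<noteq> 0 \<and> f \<sigma> > f \<tau>}"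

definition cw_D_snc :: "('a, 'c) cw \<Rightarrow> ('c \<Rightarrow> real) \<Rightarrow> 'c \<Rightarrow> nat" where
  "cw_D_snc M f \<sigma> = card {\<nu> \<in> cw_cells M. cw_incidence M \<sigma> \<nu> \<noteq> 0 \<and> f \<sigma> < f \<nu>}"

definition cw_discrete_morse_bott :: "('a, 'c) cw \<Rightarrow> ('c \<Rightarrow> real) \<Rightarrow> bool" where
  "cw_discrete_morse_bott M f \<longleftrightarrow> (\<forall>\<sigma>\<in>cw_cells M. cw_U_snc M f \<sigma> \<le> 1 \<and> cw_D_snc M f \<sigma> \<le> 1)"

definition weakly_critical_sets :: "('a, 'c) cw \<Rightarrow> ('c \<Rightarrow> real) \<Rightarrow> 'c set set" where
  "weakly_critical_sets M f =
     {C. C \<noteq> {} \<and>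
         (\<exists>r. C = {\<sigma> \<in> cw_cells M. f \<sigma> = r \<and> cw_U_snc M f \<sigma> + cw_D_snc M f \<sigma> = 0})}"

text \<open>
  Rank of an abelian group \<open>G\<close> (when finite): the largest number of \<open>\<int>\<close>-linearly independent
  elements, with \<open>G\<close> written multiplicatively.
\<close>
definition abelian_rank :: "('g, 'm) monoid_scheme \<Rightarrow> nat" where
  "abelian_rank G =
     Sup {card S |S. finite S \<and> S \<subseteq> carrier G \<and>
       (\<forall>c :: 'g \<Rightarrow> int. finprod G (\<lambda>x. x [^]\<^bsub>G\<^esub> c x) S = \<one>\<^bsub>G\<^esub> \<longrightarrow> (\<forall>x\<in>S. c x = 0))}"

definition betti :: "'a topology \<Rightarrow> nat \<Rightarrow> nat" where
  "betti X k = abelian_rank (homology_group (int k) X)"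

definition poincare_space :: "'a topology \<Rightarrow> real fps" where
  "poincare_space X = Abs_fps (\<lambda>k. real (betti X k))"

definition poincare_cells :: "('a, 'c) cw \<Rightarrow> 'c set \<Rightarrow> real fps" where
  "poincare_cells M C =
     poincare \<lparr>cells = C, cell_dim = cw_dim M,
               incidence = (\<lambda>\<tau> \<sigma>. real_of_int (cw_incidence M \<tau> \<sigma>))\<rparr>"

text \<open>
  The defining equation always has exactly one solution among formal power series, because
  \<open>1 + t\<close> is invertible there; no existence claim is hidden in the description operator.
\<close>
definition remainder_cw :: "('a, 'c) cw \<Rightarrow> ('c \<Rightarrow> real) \<Rightarrow> real fps" where
  "remainder_cw M f =
     (THE R. (\<Sum>C\<in>weakly_critical_sets M f. poincare_cells M C)
               = poincare_space (cw_space M) + (1 + fps_X) * R)"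

end

theory Submission
  imports Defs
begin

text \<open>
  Write \<open>n\<^sub>k\<close> for the number of \<open>k\<close>-cells of \<open>K = K\<^sub>M\<close>, \<open>b\<^sub>k\<close> for the rank of \<open>B\<^sub>k(K)\<close>, and \<open>m\<^sub>k\<close>,
  \<open>b'\<^sub>k\<close> for the same numbers of the weakly critical complex \<open>W\<close>. By \<open>\<partial>\<partial> = 0\<close>, a cell cannot have both
  \<open>U = 1\<close> and \<open>D = 1\<close>, and the cells with \<open>U = 1\<close> are matched with those with \<open>D = 1\<close> one dimension
  higher; hence \<open>n\<^sub>k = m\<^sub>k + d\<^sub>k + d\<^sub>k\<^sub>+\<^sub>1\<close>. Similarly \<open>W\<close> is a Lefschetz complex, and it is the direct
  sum of the complexes of the weakly critical sets. Since Betti numbers are \<open>n\<^sub>k - b\<^sub>k - b\<^sub>k\<^sub>-\<^sub>1\<close>, comparing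
  coefficients gives \<open>\<Sum> P(C) = P(W) = P(K) + (1 + t) R(K, f)\<close>. The coefficients of \<open>R\<close> are
  nonnegative because the boundaries of the cells with \<open>D = 1\<close>, together with those of weakly
  critical cells that yield a basis of \<open>B(W)\<close>, are independent in \<open>K\<close>.

  It remains to identify \<open>P(K)\<close> with the Poincare polynomial of the space \<open>M\<close>. The characteristic map
  of a cell induces an isomorphism in relative homology, so the cell classes form a basis of the
  homology of a skeleton relative to the previous one, and \<open>H\<^sub>k(M)\<close> is the group of integral cellular
  cycles modulo boundaries. Its rank is the dimension of the corresponding real quotient, because a
  real solution of an integral linear system is a real combination of integral solutions.
\<close>

section \<open>Discs\<close>

text \<open>\<open>cw_incidence\<close> takes its coefficients from a choice operator, so nothing is
  known about the incidence numbers, not even (L2), until the cell classes are shown to be an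
  integral basis of the cellular chain groups. This is why the combinatorics of \<open>f\<close> has
  to wait for the topology. Excision does not apply to a skeleton directly: it is closed, and its
  closure need not lie in its own interior. The base is therefore thickened by the part of the new
  cell outside radius 1/2, which can be pushed back along the radii. Two notions of rank must be
  reconciled: \<open>betti\<close> counts integrally independent homology classes, while
  \<open>rank_H\<close> is the dimension of a real quotient. No tensor product is formed; linear
  relations are carried over between integral and real coefficients, and only two maximal
  cardinalities are compared. Likewise no chain map between \<open>K\<close> and \<open>W\<close> is
  constructed. All identities of polynomials are identities between cell counts and ranks of
  boundaries, and the property of \<open>f\<close> enters through one principle: a nonzero term in a
  vanishing sum of (L2) has a second nonzero term beside it.\<close>

lemma topspace_disc: "topspace (disc n) = {x. (\<forall>i\<ge>n. x i = 0) \<and> (\<Sum>i<n. (x i)\<^sup>2) \<le> 1}"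
  by (auto simp: disc_def topspace_Euclidean_space)

text \<open>Passing to the full product topology makes continuity into the disc a componentwise
  matter and allows compactness to come from Tychonoff.\<close>

lemma disc_eq_subtopology:
  "disc n = subtopology (powertop_real UNIV) {x. (\<forall>i\<ge>n. x i = 0) \<and> (\<Sum>i<n. (x i)\<^sup>2) \<le> 1}"
  by (simp add: disc_def Euclidean_space_def subtopology_subtopology Collect_conj_eq)

lemma disc_interior_subset: "disc_interior n \<subseteq> topspace (disc n)"
  and disc_sphere_Un_interior: "disc_sphere n \<union> disc_interior n = topspace (disc n)"
  and disc_sphere_Int_interior: "disc_sphere n \<inter> disc_interior n = {}"
  by (auto simp: disc_sphere_def disc_interior_def topspace_disc)

lemma continuous_map_disc_iff:
  "continuous_map Z (disc n) g \<longleftrightarrow>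
     (\<forall>i. continuous_map Z euclideanreal (\<lambda>z. g z i)) \<and> g \<in> topspace Z \<rightarrow> topspace (disc n)"
proof -
  have "(g \<in> topspace Z \<rightarrow> topspace (disc n)) \<longleftrightarrow>
     g \<in> topspace Z \<rightarrow> {x. (\<forall>i\<ge>n. x i = 0) \<and> (\<Sum>i<n. (x i)\<^sup>2) \<le> 1}"
    by (simp add: topspace_disc)
  then show ?thesis
    unfolding disc_eq_subtopology
    by (simp add: continuous_map_in_subtopology continuous_map_componentwise_UNIV)
qed

lemma continuous_map_disc_projection: "continuous_map (disc n) euclideanreal (\<lambda>x. x i)"
  using continuous_map_disc_iff [of "disc n" n id] by auto

lemma continuous_map_disc_square_sum:
  "continuous_map (disc n) euclideanreal (\<lambda>x. \<Sum>i<n. (x i)\<^sup>2)"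
  by (intro continuous_map_sum continuous_map_real_pow continuous_map_disc_projection) auto

lemma Hausdorff_space_disc: "Hausdorff_space (disc n)"
  by (simp add: disc_def Hausdorff_space_subtopology Hausdorff_Euclidean_space)

text \<open>The disc is a closed subset of the cube with all coordinates in [-1,1], which is compact
  by Tychonoff.\<close>

lemma compact_space_disc: "compact_space (disc n)"
proof -
  let ?B = "\<Pi>\<^sub>E i\<in>(UNIV::nat set). {-1..1::real}"
  let ?D = "{x. (\<forall>i\<ge>n. x i = 0) \<and> (\<Sum>i<n. (x i)\<^sup>2) \<le> 1} :: (nat \<Rightarrow> real) set"
  have "compactin (powertop_real UNIV) ?B"
    by (simp add: compactin_PiE)
  moreover have "closedin (powertop_real UNIV) ?D"
  proof -
    have eq: "?D = (\<Inter>i\<in>{n..}. {x \<in> topspace (powertop_real UNIV). x i \<in> {0}}) \<inter>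
          {x \<in> topspace (powertop_real UNIV). (\<Sum>i<n. (x i)\<^sup>2) \<in> {..1}}"
      by auto
    have pr: "continuous_map (powertop_real UNIV) euclideanreal (\<lambda>x. x i)" for i :: nat
      by (rule continuous_map_product_projection) auto
    show ?thesis unfolding eq
    proof (intro closedin_Int closedin_Inter)
      show "closedin (powertop_real UNIV) {x \<in> topspace (powertop_real UNIV). (\<Sum>i<n. (x i)\<^sup>2) \<in> {..1}}"
        by (rule closedin_continuous_map_preimage [where Y = euclideanreal])
          (auto intro!: continuous_map_sum continuous_map_real_pow pr)
    next
      fix S assume "S \<in> (\<lambda>i. {x \<in> topspace (powertop_real UNIV). x i \<in> {0}}) ` {n..}"
      then obtain i where S: "S = {x \<in> topspace (powertop_real UNIV). x i \<in> {0}}" by blast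
      show "closedin (powertop_real UNIV) S"
        unfolding S by (rule closedin_continuous_map_preimage [OF pr]) auto
    qed auto
  qed
  moreover have "?D \<subseteq> ?B"
  proof clarify
    fix x :: "nat \<Rightarrow> real" assume x: "\<forall>i\<ge>n. x i = 0" "(\<Sum>i<n. (x i)\<^sup>2) \<le> 1"
    have "\<bar>x i\<bar> \<le> 1" for i
    proof (cases "i < n")
      case True
      then have "(x i)\<^sup>2 \<le> (\<Sum>i<n. (x i)\<^sup>2)"
        by (intro member_le_sum) auto
      then have "(x i)\<^sup>2 \<le> 1" using x by linarith
      then show ?thesis by (simp add: abs_square_le_1)
    qed (use x in auto)
    then show "x \<in> ?B" by (auto simp: abs_le_iff)
  qed
  ultimately have "compactin (powertop_real UNIV) ?D"
    by (meson closed_compactin)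
  then show ?thesis
    unfolding disc_eq_subtopology by (simp add: compact_space_subtopology)
qed

lemma contractible_space_disc: "contractible_space (disc n)"
proof -
  have "homotopic_with (\<lambda>_. True) (disc n) (disc n) id (\<lambda>x i. 0)"
    unfolding homotopic_with_def
  proof (intro exI conjI allI ballI)
    let ?h = "\<lambda>(t, x) i. (1 - t) * x i :: real"
    have "(\<Sum>i<n. ((1 - t) * x i)\<^sup>2) \<le> 1"
      if "0 \<le> t" "t \<le> 1" "(\<Sum>i<n. (x i)\<^sup>2) \<le> 1" for t :: real and x :: "nat \<Rightarrow> real"
    proof -
      have "(\<Sum>i<n. ((1 - t) * x i)\<^sup>2) = (1 - t)\<^sup>2 * (\<Sum>i<n. (x i)\<^sup>2)"
        by (simp add: power_mult_distrib sum_distrib_left)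
      also have "\<dots> \<le> 1"
        using that by (intro mult_le_one) (auto simp: power_le_one sum_nonneg)
      finally show ?thesis .
    qed
    then show "continuous_map (prod_topology (top_of_set {0..1}) (disc n)) (disc n) ?h"
      unfolding continuous_map_disc_iff case_prod_unfold
      by (auto simp: topspace_disc intro!: continuous_map_real_mult continuous_map_diff
          continuous_map_compose [OF continuous_map_snd continuous_map_disc_projection, unfolded o_def]
          continuous_map_into_fulltopology [OF continuous_map_fst])
  qed auto
  then show ?thesis
    unfolding contractible_space_def by blast
qed

text \<open>
  At time 1 the radial homotopy \<open>disc_push\<close> sends \<open>x\<close> to \<open>x / max (1/2) |x|\<close>, so that every point of
  norm at least \<open>1/2\<close> lands on the sphere.
\<close>
definition disc_push :: "nat \<Rightarrow> real \<times> (nat \<Rightarrow> real) \<Rightarrow> nat \<Rightarrow> real" where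
  "disc_push n = (\<lambda>(t, x) i. x i * ((1 - t) + t / max (1/2) (sqrt (\<Sum>i<n. (x i)\<^sup>2))))"

lemma square_sum_disc_push:
  "(\<Sum>i<n. (disc_push n (t, x) i)\<^sup>2) =
     (sqrt (\<Sum>i<n. (x i)\<^sup>2) * ((1 - t) + t / max (1/2) (sqrt (\<Sum>i<n. (x i)\<^sup>2))))\<^sup>2"
  by (simp add: disc_push_def power_mult_distrib sum_nonneg flip: sum_distrib_right)

text \<open>The radial factor is at least 1 because \<open>max (1/2) r\<close> is at most 1, so
  norms never decrease; this keeps the complement of a centred ball invariant. The new norm is a
  convex combination of \<open>r\<close> and \<open>r / m\<close>, both at most 1.\<close>

lemma square_sum_disc_push_bounds:
  assumes t: "0 \<le> t" "t \<le> 1" and x: "(\<Sum>i<n. (x i)\<^sup>2) \<le> 1"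
  shows "(\<Sum>i<n. (x i)\<^sup>2) \<le> (\<Sum>i<n. (disc_push n (t, x) i)\<^sup>2)"
    and "(\<Sum>i<n. (disc_push n (t, x) i)\<^sup>2) \<le> 1"
proof -
  define r where "r = sqrt (\<Sum>i<n. (x i)\<^sup>2)"
  define m where "m = max (1/2) r"
  have r: "0 \<le> r" "r \<le> 1" using x by (auto simp: r_def sum_nonneg)
  have m: "0 < m" "m \<le> 1" "r \<le> m" using r by (auto simp: m_def)
  have "t \<le> t / m" using t m by (simp add: pos_le_divide_eq mult_left_le)
  then have s: "1 \<le> (1 - t) + t / m" by simp
  then have "r * 1 \<le> r * ((1 - t) + t / m)" using r by (intro mult_left_mono) auto
  then have "r\<^sup>2 \<le> (r * ((1 - t) + t / m))\<^sup>2" using r by (intro power_mono) auto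
  then show "(\<Sum>i<n. (x i)\<^sup>2) \<le> (\<Sum>i<n. (disc_push n (t, x) i)\<^sup>2)"
    unfolding square_sum_disc_push by (simp add: r_def m_def sum_nonneg)
  have "r * ((1 - t) + t / m) = (1 - t) * r + t * (r / m)" by (simp add: algebra_simps)
  also have "\<dots> \<le> (1 - t) * 1 + t * 1"
    using t r m by (intro add_mono mult_left_mono) auto
  finally have "r * ((1 - t) + t / m) \<le> 1" by simp
  moreover have "0 \<le> r * ((1 - t) + t / m)" using r s by auto
  ultimately have "(r * ((1 - t) + t / m))\<^sup>2 \<le> 1" by (simp add: power_le_one)
  then show "(\<Sum>i<n. (disc_push n (t, x) i)\<^sup>2) \<le> 1"
    unfolding square_sum_disc_push by (simp add: r_def m_def)
qed

lemma disc_push_0: "disc_push n (0, x) = x"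
  by (simp add: disc_push_def)

lemma disc_push_sphere: "x \<in> disc_sphere n \<Longrightarrow> disc_push n (t, x) = x"
  by (auto simp: disc_push_def disc_sphere_def)

lemma disc_push_1_sphere:
  assumes "x \<in> topspace (disc n)" "(\<Sum>i<n. (x i)\<^sup>2) > 1/4"
  shows "disc_push n (1, x) \<in> disc_sphere n"
proof -
  have "sqrt (1/4) < sqrt (\<Sum>i<n. (x i)\<^sup>2)" using assms(2) by simp
  moreover have "sqrt (1/4) = 1/2" by (simp add: real_sqrt_divide)
  ultimately have "max (1/2) (sqrt (\<Sum>i<n. (x i)\<^sup>2)) = sqrt (\<Sum>i<n. (x i)\<^sup>2)"
    "sqrt (\<Sum>i<n. (x i)\<^sup>2) \<noteq> 0" by auto
  then have "(\<Sum>i<n. (disc_push n (1, x) i)\<^sup>2) = 1"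
    unfolding square_sum_disc_push by simp
  then show ?thesis
    using assms by (auto simp: disc_sphere_def topspace_disc disc_push_def)
qed

lemma disc_push_in_disc:
  assumes "0 \<le> t" "t \<le> 1" "x \<in> topspace (disc n)"
  shows "disc_push n (t, x) \<in> topspace (disc n)"
proof -
  have "disc_push n (t, x) i = 0" if "i \<ge> n" for i
    using assms that by (simp add: topspace_disc disc_push_def)
  then show ?thesis
    using assms square_sum_disc_push_bounds(2) [of t x n] by (auto simp: topspace_disc)
qed

text \<open>The 1/2 inside the maximum bounds the denominator away from zero, so the formula is
  continuous at the centre as well.\<close>

lemma continuous_map_disc_push:
  "continuous_map (prod_topology (top_of_set {0..1}) (disc n)) (disc n) (disc_push n)"
proof -
  have pr: "continuous_map (prod_topology (top_of_set {0..1}) (disc n)) euclideanreal (\<lambda>z. snd z i)" for i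
    by (rule continuous_map_compose [OF continuous_map_snd continuous_map_disc_projection, unfolded o_def])
  have "continuous_map (prod_topology (top_of_set {0..1}) (disc n)) euclideanreal
     (\<lambda>z. disc_push n z i)" for i
    unfolding disc_push_def case_prod_unfold
    by (intro continuous_intros pr continuous_map_into_fulltopology [OF continuous_map_fst]) auto
  then show ?thesis
    unfolding continuous_map_disc_iff
    by (auto intro: disc_push_in_disc)
qed

section \<open>Attaching a cell\<close>

text \<open>With the next lemma, two-out-of-three for isomorphisms: it determines the remaining side
  of a commutative square of homology groups.\<close>

lemma iso_cancel_right:
  assumes f: "f \<in> iso G H" and g: "g \<in> hom H K" and gf: "g \<circ> f \<in> iso G K"
  shows "g \<in> iso H K"
proof -
  have "f ` carrier G = carrier H" "inj_on f (carrier G)"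
    using f by (auto simp: iso_def bij_betw_def)
  moreover have "(g \<circ> f) ` carrier G = carrier K" "inj_on (g \<circ> f) (carrier G)"
    using gf by (auto simp: iso_def bij_betw_def)
  ultimately have "bij_betw g (carrier H) (carrier K)"
    by (metis bij_betw_def image_comp inj_on_imageI)
  then show ?thesis using g by (simp add: iso_def)
qed

lemma iso_cancel_left:
  assumes f: "f \<in> hom G H" and g: "g \<in> iso H K" and gf: "g \<circ> f \<in> iso G K"
  shows "f \<in> iso G H"
proof -
  have g': "inj_on g (carrier H)" "g ` carrier H = carrier K"
    using g by (auto simp: iso_def bij_betw_def)
  have f': "f ` carrier G \<subseteq> carrier H"
    using f by (auto simp: hom_def)
  have gf': "(g \<circ> f) ` carrier G = carrier K" "inj_on (g \<circ> f) (carrier G)"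
    using gf by (auto simp: iso_def bij_betw_def)
  then have "f ` carrier G = carrier H"
    using g' f' by (metis image_comp inj_on_image_eq_iff subset_refl)
  with gf' have "bij_betw f (carrier G) (carrier H)"
    by (auto simp: bij_betw_def intro: inj_on_imageI2)
  then show ?thesis using f by (simp add: iso_def)
qed

text \<open>The bound 1/4 is the square of the radius 1/2 in \<open>disc_push\<close>, so every
  point of the disc outside this set is swept to the sphere at time 1.\<close>

definition disc_core :: "nat \<Rightarrow> (nat \<Rightarrow> real) set" where
  "disc_core n = {x \<in> topspace (disc n). (\<Sum>i<n. (x i)\<^sup>2) \<le> 1/4}"

lemma disc_core_subset_interior: "disc_core n \<subseteq> disc_interior n"
  by (auto simp: disc_core_def disc_interior_def)

lemma compactin_disc_core: "compactin (disc n) (disc_core n)"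
proof -
  have "closedin (disc n) {x \<in> topspace (disc n). (\<Sum>i<n. (x i)\<^sup>2) \<in> {..1/4}}"
    by (rule closedin_continuous_map_preimage [OF continuous_map_disc_square_sum]) auto
  then have "closedin (disc n) (disc_core n)" by (simp add: disc_core_def)
  then show ?thesis by (simp add: closedin_compact_space compact_space_disc)
qed

text \<open>The base \<open>A\<close> is any closed set that receives the sphere, not necessarily a
  skeleton. Hence cells of equal dimension can be attached one at a time, and the disc over its own
  sphere is an instance.\<close>

locale cell_attachment =
  fixes Y :: "'a topology" and A :: "'a set" and n :: nat and \<phi> :: "(nat \<Rightarrow> real) \<Rightarrow> 'a"
  assumes Hausdorff: "Hausdorff_space Y"
    and closed_base: "closedin Y A"
    and cont_char: "continuous_map (disc n) Y \<phi>"
    and char_sphere: "\<phi> ` disc_sphere n \<subseteq> A"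
    and char_interior_disjoint: "A \<inter> \<phi> ` disc_interior n = {}"
    and space_eq: "topspace Y = A \<union> \<phi> ` disc_interior n"
    and homeo_char: "homeomorphic_map (subtopology (disc n) (disc_interior n))
          (subtopology Y (\<phi> ` disc_interior n)) \<phi>"
begin

lemma inj_char: "inj_on \<phi> (disc_interior n)"
  using homeomorphic_imp_injective_map [OF homeo_char] disc_interior_subset
  by (simp add: Int_absorb1)

lemma char_in_base_iff: "x \<in> topspace (disc n) \<Longrightarrow> \<phi> x \<in> A \<longleftrightarrow> x \<in> disc_sphere n"
  using char_sphere char_interior_disjoint disc_sphere_Un_interior [of n] by blast

text \<open>The thickened base: \<open>A\<close> together with the outer shell of the cell. It is
  open, as the image of the core is compact in a Hausdorff space.\<close>

definition outer :: "'a set" where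
  "outer = topspace Y - \<phi> ` disc_core n"

lemma base_subset_outer: "A \<subseteq> outer"
  using char_interior_disjoint disc_core_subset_interior space_eq by (fastforce simp: outer_def)

lemma char_in_outer_iff: 
  assumes "x \<in> topspace (disc n)"
  shows "\<phi> x \<in> outer \<longleftrightarrow> x \<notin> disc_core n"
proof
  assume "\<phi> x \<in> outer" then show "x \<notin> disc_core n" by (auto simp: outer_def)
next
  assume x: "x \<notin> disc_core n"
  show "\<phi> x \<in> outer"
  proof (cases "x \<in> disc_sphere n")
    case True
    then show ?thesis using base_subset_outer char_sphere by blast
  next
    case False
    then have "x \<in> disc_interior n" using assms disc_sphere_Un_interior by blast
    then show ?thesis
      using x inj_char disc_core_subset_interior [of n] space_eq
      by (auto simp: outer_def dest: inj_onD)
  qed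
qed

text \<open>This is \<open>disc_push\<close> carried along the characteristic map and frozen on
  \<open>A\<close>. The inverse is taken on the open disc only, where \<open>\<phi>\<close> is
  injective.\<close>

definition push :: "real \<times> 'a \<Rightarrow> 'a" where
  "push = (\<lambda>(t, y). if y \<in> A then y else \<phi> (disc_push n (t, inv_into (disc_interior n) \<phi> y)))"

lemma push_base: "y \<in> A \<Longrightarrow> push (t, y) = y"
  by (simp add: push_def)

text \<open>The formula also holds on the sphere, where \<open>\<phi>\<close> need not be injective,
  since \<open>disc_push\<close> fixes the sphere pointwise.\<close>

lemma push_char:
  assumes "x \<in> topspace (disc n)"
  shows "push (t, \<phi> x) = \<phi> (disc_push n (t, x))"
proof (cases "x \<in> disc_sphere n")
  case True
  then show ?thesis using assms by (simp add: push_def char_in_base_iff disc_push_sphere)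
next
  case False
  then have "x \<in> disc_interior n" using assms disc_sphere_Un_interior by blast
  then show ?thesis
    using False assms inj_char by (simp add: push_def char_in_base_iff)
qed

lemma space_cases:
  assumes "y \<in> topspace Y"
  obtains "y \<in> A" | x where "x \<in> topspace (disc n)" "y = \<phi> x"
  using assms space_eq disc_interior_subset by blast

text \<open>The space is the union of two closed sets, \<open>A\<close> and the closed cell. On the
  closed cell, continuity descends along the characteristic map times the interval: a continuous
  surjection from a compact space onto a Hausdorff space is a quotient map.\<close>

lemma continuous_map_push: "continuous_map (prod_topology (top_of_set {0..1}) Y) Y push"
proof -
  let ?I = "top_of_set {0..1::real}" and ?E = "\<phi> ` topspace (disc n)"
  let ?Z = "prod_topology ?I Y"
  have im: "?E \<subseteq> topspace Y" using cont_char by (simp add: continuous_map_image_subset_topspace)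
  have cl: "closedin Y ?E"
    using compactin_imp_closedin [OF Hausdorff] image_compactin cont_char compact_space_disc
    by (metis compact_space_def)
  have 1: "continuous_map (subtopology ?Z ({0..1} \<times> A)) Y push"
  proof (rule continuous_map_eq)
    show "continuous_map (subtopology ?Z ({0..1} \<times> A)) Y snd"
      by (intro continuous_map_from_subtopology continuous_map_snd)
  qed (auto simp: push_base)
  have 2: "continuous_map (subtopology ?Z ({0..1} \<times> ?E)) Y push"
  proof (rule continuous_compose_quotient_map)
    let ?q = "\<lambda>(t, x). (t, \<phi> x)"
    have "continuous_map (prod_topology ?I (disc n)) ?Z ?q"
      using cont_char by (simp add: continuous_map_prod_top)
    then have c: "continuous_map (prod_topology ?I (disc n)) (subtopology ?Z ({0..1} \<times> ?E)) ?q"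
      by (auto simp: continuous_map_in_subtopology)
    show "quotient_map (prod_topology ?I (disc n)) (subtopology ?Z ({0..1} \<times> ?E)) ?q"
    proof (rule continuous_imp_quotient_map [OF c])
      show "compact_space (prod_topology ?I (disc n))"
        by (simp add: compact_space_prod_topology compact_space_disc compact_space_subtopology)
      show "Hausdorff_space (subtopology ?Z ({0..1} \<times> ?E))"
        by (simp add: Hausdorff_space_subtopology Hausdorff_space_prod_topology Hausdorff)
      show "?q ` topspace (prod_topology ?I (disc n)) = topspace (subtopology ?Z ({0..1} \<times> ?E))"
        using im by force
    qed
    have "continuous_map (prod_topology ?I (disc n)) Y (\<phi> \<circ> disc_push n)"
      using continuous_map_compose [OF continuous_map_disc_push cont_char] .
    then show "continuous_map (prod_topology ?I (disc n)) Y (push \<circ> ?q)"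
      by (rule continuous_map_eq) (auto simp: push_char)
  qed
  show ?thesis
  proof (rule pasting_lemma_closed [where I = "{A, ?E}" and T = "\<lambda>S. {0..1} \<times> S" and f = "\<lambda>_. push"])
    show "closedin ?Z ({0..1} \<times> S)" if "S \<in> {A, ?E}" for S
      using that cl closed_base by (auto simp: closedin_prod_Times_iff)
    show "\<exists>S. S \<in> {A, ?E} \<and> z \<in> {0..1} \<times> S \<and> push z = push z" if "z \<in> topspace ?Z" for z
      using that disc_interior_subset by (auto simp: space_eq)
  qed (use 1 2 in auto)
qed

lemma push_outer: "0 \<le> t \<Longrightarrow> t \<le> 1 \<Longrightarrow> y \<in> outer \<Longrightarrow> push (t, y) \<in> outer"
proof -
  assume t: "0 \<le> t" "t \<le> 1" and y: "y \<in> outer"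
  then have "y \<in> topspace Y" by (simp add: outer_def)
  then show ?thesis
  proof (cases rule: space_cases)
    case 1 then show ?thesis using y by (simp add: push_base)
  next
    case (2 x)
    then have "x \<notin> disc_core n" using y by (simp add: char_in_outer_iff)
    then have "disc_push n (t, x) \<notin> disc_core n"
      using 2 t square_sum_disc_push_bounds(1) [of t x n] by (auto simp: disc_core_def topspace_disc)
    then show ?thesis
      using 2 t by (simp add: push_char char_in_outer_iff disc_push_in_disc)
  qed
qed

lemma push_1_outer: "y \<in> outer \<Longrightarrow> push (1, y) \<in> A"
proof -
  assume y: "y \<in> outer"
  then have "y \<in> topspace Y" by (simp add: outer_def)
  then show ?thesis
  proof (cases rule: space_cases)
    case 1 then show ?thesis using y by (simp add: push_base)
  next
    case (2 x)
    then have "x \<notin> disc_core n" using y by (simp add: char_in_outer_iff)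
    then have "disc_push n (1, x) \<in> disc_sphere n"
      using 2 by (intro disc_push_1_sphere) (auto simp: disc_core_def)
    then show ?thesis
      using 2 char_sphere by (auto simp: push_char)
  qed
qed

lemma push_0: "y \<in> topspace Y \<Longrightarrow> push (0, y) = y"
  by (erule space_cases) (auto simp: push_base push_char disc_push_0)

text \<open>The time-1 map of \<open>push\<close> is a homotopy inverse of the inclusion of pairs:
  it sends \<open>outer\<close> into \<open>A\<close>, and the homotopy preserves both
  \<open>A\<close> and \<open>outer\<close> at every time.\<close>

lemma iso_base_outer:
  "hom_induced p Y A Y outer id \<in> iso (relative_homology_group p Y A) (relative_homology_group p Y outer)"
proof (rule homotopy_equivalence_relative_homology_group_isomorphism)
  have sub: "A \<subseteq> topspace Y" "outer \<subseteq> topspace Y" by (auto simp: space_eq outer_def)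
  have g: "continuous_map Y Y (\<lambda>y. push (1, y))"
    using continuous_map_compose [OF _ continuous_map_push, of Y "\<lambda>y. (1, y)"]
    by (simp add: o_def continuous_map_pairedI)
  show "continuous_map Y Y (\<lambda>y. push (1, y))" by (rule g)
  have hom: "homotopic_with (\<lambda>h. h \<in> S \<rightarrow> S) Y Y id (\<lambda>y. push (1, y))"
    if S: "S \<subseteq> topspace Y" "\<And>t y. 0 \<le> t \<Longrightarrow> t \<le> 1 \<Longrightarrow> y \<in> S \<Longrightarrow> push (t, y) \<in> S" for S
  proof -
    have "homotopic_with (\<lambda>h. h \<in> S \<rightarrow> S) Y Y id (\<lambda>y. push (1, y)) \<longleftrightarrow>
       (\<exists>h. continuous_map (prod_topology (top_of_set {0..1::real}) Y) Y h \<and>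
            (\<forall>x\<in>topspace Y. h (0,x) = id x) \<and> (\<forall>x\<in>topspace Y. h (1,x) = push (1, x)) \<and>
            (\<forall>t\<in>{0..1}. (\<lambda>x. h (t,x)) \<in> S \<rightarrow> S))"
    proof (rule homotopic_with)
      fix h k :: "'a \<Rightarrow> 'a"
      assume "\<And>x. x \<in> topspace Y \<Longrightarrow> h x = k x"
      then have "\<And>x. x \<in> S \<Longrightarrow> h x = k x" using S(1) by blast
      then show "h \<in> S \<rightarrow> S \<longleftrightarrow> k \<in> S \<rightarrow> S" by (simp add: Pi_iff)
    qed
    moreover have "(\<lambda>x. push (t, x)) \<in> S \<rightarrow> S" if "t \<in> {0..1}" for t
      using S(2) that by simp
    ultimately show ?thesis
      using continuous_map_push push_0 by (metis id_apply)
  qed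
  show "homotopic_with (\<lambda>h. h \<in> A \<rightarrow> A) Y Y ((\<lambda>y. push (1, y)) \<circ> id) id"
    using hom [OF sub(1)] by (auto simp: push_base intro: homotopic_with_symD)
  show "homotopic_with (\<lambda>h. h \<in> outer \<rightarrow> outer) Y Y (id \<circ> (\<lambda>y. push (1, y))) id"
    using hom [OF sub(2)] by (auto simp: push_outer intro: homotopic_with_symD)
qed (use base_subset_outer push_1_outer in auto)

lemma topspace_minus_base: "topspace Y - A = \<phi> ` disc_interior n"
  using space_eq char_interior_disjoint by auto

text \<open>Here the thickening pays off: \<open>A\<close> is closed and \<open>outer\<close> is
  open, so the closure of \<open>A\<close> lies in the interior of \<open>outer\<close>, which is
  what excision requires.\<close>

lemma iso_interior_outer:
  "hom_induced p (subtopology Y (\<phi> ` disc_interior n)) (outer - A) Y outer id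
     \<in> iso (relative_homology_group p (subtopology Y (\<phi> ` disc_interior n)) (outer - A))
           (relative_homology_group p Y outer)"
proof -
  have "closedin Y (\<phi> ` disc_core n)"
    using compactin_imp_closedin [OF Hausdorff] image_compactin [OF compactin_disc_core cont_char] by blast
  then have "openin Y outer" by (simp add: outer_def openin_diff)
  then have "Y closure_of A \<subseteq> Y interior_of outer"
    using closed_base base_subset_outer by (simp add: closure_of_closedin interior_of_openin)
  moreover have "outer \<subseteq> topspace Y" by (auto simp: outer_def)
  ultimately show ?thesis
    using homology_excision_axiom [of Y A outer "topspace Y" p] by (simp add: topspace_minus_base)
qed

lemma outer_minus_base: "outer - A = \<phi> ` (disc_interior n - disc_core n)"
proof -
  have "outer - A = (topspace Y - A) - \<phi> ` disc_core n" by (auto simp: outer_def)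
  also have "\<dots> = \<phi> ` disc_interior n - \<phi> ` disc_core n" by (simp add: topspace_minus_base)
  also have "\<dots> = \<phi> ` (disc_interior n - disc_core n)"
    using inj_char disc_core_subset_interior by (simp add: inj_on_image_set_diff)
  finally show ?thesis .
qed

end

lemma disc_attachment: "cell_attachment (disc n) (disc_sphere n) n id"
proof
  have "closedin (disc n) {x \<in> topspace (disc n). (\<Sum>i<n. (x i)\<^sup>2) \<in> {1}}"
    by (rule closedin_continuous_map_preimage [OF continuous_map_disc_square_sum]) auto
  then show "closedin (disc n) (disc_sphere n)" by (simp add: disc_sphere_def)
qed (auto simp: Hausdorff_space_disc disc_sphere_Un_interior disc_sphere_Int_interior)

context cell_attachment
begin

text \<open>
  Pushing outwards shows that enlarging the base by the outer shell of the cell does not change the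
  relative homology. After this enlargement the base can be excised, and the characteristic map is
  a homeomorphism on what is left. The disc is itself obtained from its sphere by attaching a cell,
  so both ends of the comparison are treated by the same lemmas.
\<close>
theorem iso_char:
  "hom_induced p (disc n) (disc_sphere n) Y A \<phi>
     \<in> iso (relative_homology_group p (disc n) (disc_sphere n)) (relative_homology_group p Y A)"
proof -
  interpret D: cell_attachment "disc n" "disc_sphere n" n id by (rule disc_attachment)
  let ?int = "disc_interior n" and ?core = "disc_core n"
  have Do: "D.outer = topspace (disc n) - ?core" by (simp add: D.outer_def)
  have Dm: "D.outer - disc_sphere n = ?int - ?core" by (simp add: D.outer_minus_base)
  have out: "\<phi> \<in> D.outer \<rightarrow> outer" using char_in_outer_iff Do by auto
  have sph: "\<phi> \<in> disc_sphere n \<rightarrow> A" using char_sphere by auto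
  let ?D = "subtopology (disc n) ?int" and ?E = "subtopology Y (\<phi> ` ?int)"
  have F3: "hom_induced p ?D (?int - ?core) ?E (outer - A) \<phi>
     \<in> iso (relative_homology_group p ?D (?int - ?core)) (relative_homology_group p ?E (outer - A))"
  proof (rule homeomorphic_map_relative_homology_iso [OF homeo_char])
    show "?int - ?core \<subseteq> topspace ?D" using disc_interior_subset by auto
  qed (simp add: outer_minus_base)
  have cint: "continuous_map ?D ?E \<phi>" using homeo_char homeomorphic_imp_continuous_map by blast
  have e1: "hom_induced p ?D (?int - ?core) (disc n) D.outer id
     \<in> iso (relative_homology_group p ?D (?int - ?core)) (relative_homology_group p (disc n) D.outer)"
    using D.iso_interior_outer [of p] Dm by simp
  have sq1: "hom_induced p (disc n) D.outer Y outer \<phi> \<circ> hom_induced p ?D (?int - ?core) (disc n) D.outer id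
    = hom_induced p ?E (outer - A) Y outer id \<circ> hom_induced p ?D (?int - ?core) ?E (outer - A) \<phi>"
  proof -
    have "hom_induced p (disc n) D.outer Y outer \<phi> \<circ> hom_induced p ?D (?int - ?core) (disc n) D.outer id
       = hom_induced p ?D (?int - ?core) Y outer (\<phi> \<circ> id)"
      by (rule hom_induced_compose [symmetric])
        (use out cont_char Dm in \<open>auto simp: continuous_map_from_subtopology\<close>)
    moreover have "hom_induced p ?E (outer - A) Y outer id \<circ> hom_induced p ?D (?int - ?core) ?E (outer - A) \<phi>
       = hom_induced p ?D (?int - ?core) Y outer (id \<circ> \<phi>)"
      by (rule hom_induced_compose [symmetric])
        (use cint outer_minus_base in \<open>auto simp: continuous_map_from_subtopology\<close>)
    ultimately show ?thesis by simp
  qed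
  \<comment> \<open>Three sides of the square \<open>sq1\<close> are isomorphisms: excision in the
    disc, excision in \<open>Y\<close>, and the homeomorphism of open cells. Hence so is the
    fourth.\<close>
  have F2: "hom_induced p (disc n) D.outer Y outer \<phi>
    \<in> iso (relative_homology_group p (disc n) D.outer) (relative_homology_group p Y outer)"
  proof (rule iso_cancel_right [OF e1 hom_induced_hom])
    show "hom_induced p (disc n) D.outer Y outer \<phi> \<circ> hom_induced p ?D (?int - ?core) (disc n) D.outer id
       \<in> iso (relative_homology_group p ?D (?int - ?core)) (relative_homology_group p Y outer)"
      unfolding sq1 by (rule iso_set_trans [OF F3 iso_interior_outer])
  qed
  have sq2: "hom_induced p Y A Y outer id \<circ> hom_induced p (disc n) (disc_sphere n) Y A \<phi>
     = hom_induced p (disc n) D.outer Y outer \<phi> \<circ> hom_induced p (disc n) (disc_sphere n) (disc n) D.outer id"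
  proof -
    have "hom_induced p Y A Y outer id \<circ> hom_induced p (disc n) (disc_sphere n) Y A \<phi>
       = hom_induced p (disc n) (disc_sphere n) Y outer (id \<circ> \<phi>)"
      by (rule hom_induced_compose [symmetric]) (use cont_char sph base_subset_outer in auto)
    moreover have "hom_induced p (disc n) D.outer Y outer \<phi> \<circ> hom_induced p (disc n) (disc_sphere n) (disc n) D.outer id
       = hom_induced p (disc n) (disc_sphere n) Y outer (\<phi> \<circ> id)"
      by (rule hom_induced_compose [symmetric]) (use cont_char out D.base_subset_outer in auto)
    ultimately show ?thesis by simp
  qed
  \<comment> \<open>In \<open>sq2\<close> the two vertical maps enlarge the base and are
    isomorphisms by pushing, so \<open>F2\<close> transfers to the original pairs.\<close>
  show ?thesis
  proof (rule iso_cancel_left [OF hom_induced_hom iso_base_outer])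
    show "hom_induced p Y A Y outer id \<circ> hom_induced p (disc n) (disc_sphere n) Y A \<phi>
       \<in> iso (relative_homology_group p (disc n) (disc_sphere n)) (relative_homology_group p Y outer)"
      unfolding sq2 by (rule iso_set_trans [OF D.iso_base_outer F2])
  qed
qed

end

section \<open>Integral bases of abelian groups\<close>

text \<open>An integral linear combination in multiplicative notation, in the shape that occurs
  inside \<open>cw_incidence\<close> and, with \<open>g\<close> the identity, inside
  \<open>abelian_rank\<close>.\<close>

definition int_comb :: "('g, 'm) monoid_scheme \<Rightarrow> ('i \<Rightarrow> 'g) \<Rightarrow> 'i set \<Rightarrow> ('i \<Rightarrow> int) \<Rightarrow> 'g" where
  "int_comb G g I c = finprod G (\<lambda>i. g i [^]\<^bsub>G\<^esub> c i) I"

text \<open>A basis is an indexed family, so that coefficients belong to cells. Values of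
  \<open>c\<close> off \<open>I\<close> are irrelevant, hence uniqueness is claimed on
  \<open>I\<close> only.\<close>

definition int_basis :: "('g, 'm) monoid_scheme \<Rightarrow> 'i set \<Rightarrow> ('i \<Rightarrow> 'g) \<Rightarrow> bool" where
  "int_basis G I g \<longleftrightarrow> g \<in> I \<rightarrow> carrier G \<and> carrier G \<subseteq> range (int_comb G g I) \<and>
     (\<forall>c. int_comb G g I c = \<one>\<^bsub>G\<^esub> \<longrightarrow> (\<forall>i\<in>I. c i = 0))"

context comm_group
begin

lemma int_comb_closed: "g \<in> I \<rightarrow> carrier G \<Longrightarrow> int_comb G g I c \<in> carrier G"
  unfolding int_comb_def by (rule finprod_closed) auto

lemma int_comb_add:
  assumes "g \<in> I \<rightarrow> carrier G"
  shows "int_comb G g I (\<lambda>i. c i + d i) = int_comb G g I c \<otimes> int_comb G g I d"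
proof -
  have "finprod G (\<lambda>i. g i [^] (c i + d i)) I = finprod G (\<lambda>i. g i [^] c i \<otimes> g i [^] d i) I"
    by (rule finprod_cong') (use assms in \<open>auto simp: int_pow_mult Pi_iff\<close>)
  also have "\<dots> = finprod G (\<lambda>i. g i [^] c i) I \<otimes> finprod G (\<lambda>i. g i [^] d i) I"
    by (rule finprod_multf) (use assms in auto)
  finally show ?thesis by (simp add: int_comb_def)
qed

lemma int_comb_zero: "int_comb G g I (\<lambda>i. 0) = \<one>"
  by (simp add: int_comb_def finprod_one_eqI)

lemma int_comb_uminus:
  assumes "g \<in> I \<rightarrow> carrier G"
  shows "int_comb G g I (\<lambda>i. - c i) = inv (int_comb G g I c)"
proof -
  have "int_comb G g I (\<lambda>i. - c i) \<otimes> int_comb G g I c = \<one>"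
    using int_comb_add [OF assms, of "\<lambda>i. - c i" c] by (simp add: int_comb_zero)
  then show ?thesis
    using int_comb_closed [OF assms] by (metis inv_equality)
qed

lemma int_comb_diff:
  assumes "g \<in> I \<rightarrow> carrier G"
  shows "int_comb G g I (\<lambda>i. c i - d i) = int_comb G g I c \<otimes> inv (int_comb G g I d)"
  using int_comb_add [OF assms, of c "\<lambda>i. - d i"] int_comb_uminus [OF assms, of d] by simp

lemma int_comb_cmult:
  assumes "g \<in> I \<rightarrow> carrier G"
  shows "int_comb G g I (\<lambda>i. k * c i) = int_comb G g I c [^] (k::int)"
proof (induction k rule: int_induct [where k = 0])
  case (step1 k)
  then show ?case
    using int_comb_add [OF assms, of "\<lambda>i. k * c i" c] int_comb_closed [OF assms]
    by (simp add: algebra_simps int_pow_mult m_comm)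
next
  case (step2 k)
  then show ?case
    using int_comb_diff [OF assms, of "\<lambda>i. k * c i" c] int_comb_closed [OF assms]
    by (simp add: algebra_simps int_pow_diff m_comm)
qed (simp add: int_comb_zero)

text \<open>Substituting combinations into a combination multiplies coefficient matrices; this turns
  the boundaries of single cells into the incidence matrix acting on chains.\<close>

lemma int_comb_sum:
  assumes "g \<in> I \<rightarrow> carrier G" "finite J"
  shows "int_comb G g I (\<lambda>i. \<Sum>j\<in>J. a j * c j i) = int_comb G (\<lambda>j. int_comb G g I (c j)) J a"
  using assms(2)
proof induction
  case empty
  then show ?case by (simp add: int_comb_zero) (simp add: int_comb_def)
next
  case (insert j J)
  then have "int_comb G (\<lambda>j. int_comb G g I (c j)) (insert j J) a
     = int_comb G g I (c j) [^] a j \<otimes> int_comb G (\<lambda>j. int_comb G g I (c j)) J a"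
    unfolding int_comb_def [of G "\<lambda>j. int_comb G g I (c j)"]
    by (intro finprod_insert) (auto simp: int_comb_closed assms)
  with insert show ?case
    using int_comb_add [OF assms(1), of "\<lambda>i. a j * c j i"]
    by (simp add: int_comb_cmult assms)
qed

lemma int_basis_inj:
  assumes b: "int_basis G I g" and eq: "int_comb G g I c = int_comb G g I d" and "i \<in> I"
  shows "c i = d i"
proof -
  have g: "g \<in> I \<rightarrow> carrier G" using b by (simp add: int_basis_def)
  have "int_comb G g I (\<lambda>i. c i - d i) = \<one>"
    using eq int_comb_closed [OF g] by (simp add: int_comb_diff [OF g])
  then have "c i - d i = 0" using b \<open>i \<in> I\<close> unfolding int_basis_def by blast
  then show ?thesis by simp
qed

end

lemma int_comb_cong: "(\<And>i. i \<in> I \<Longrightarrow> c i = d i) \<Longrightarrow> (\<And>i. i \<in> I \<Longrightarrow> g i = h i)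
   \<Longrightarrow> comm_group G \<Longrightarrow> h \<in> I \<rightarrow> carrier G \<Longrightarrow> int_comb G g I c = int_comb G h I d"
proof -
  assume a: "\<And>i. i \<in> I \<Longrightarrow> c i = d i" "\<And>i. i \<in> I \<Longrightarrow> g i = h i" "comm_group G" "h \<in> I \<rightarrow> carrier G"
  interpret comm_group G by fact
  show ?thesis unfolding int_comb_def
    by (rule finprod_cong') (use a in auto)
qed

lemma hom_int_comb:
  assumes "comm_group G" "comm_group H" and h: "h \<in> hom G H" and g: "g \<in> I \<rightarrow> carrier G"
  shows "h (int_comb G g I c) = int_comb H (\<lambda>i. h (g i)) I c"
proof -
  interpret G: comm_group G by fact
  interpret H: comm_group H by fact
  interpret h: group_hom G H h
    using h by (simp add: group_hom_def group_hom_axioms_def G.is_group H.is_group)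
  show ?thesis
  proof (cases "finite I")
    case True
    then show ?thesis using g
    proof induction
      case (insert i I)
      then have g: "g i \<in> carrier G" "g \<in> I \<rightarrow> carrier G" by auto
      have "int_comb G g (insert i I) c = g i [^]\<^bsub>G\<^esub> c i \<otimes>\<^bsub>G\<^esub> int_comb G g I c"
        unfolding int_comb_def by (rule G.finprod_insert) (use insert in auto)
      moreover have "int_comb H (\<lambda>i. h (g i)) (insert i I) c
          = h (g i) [^]\<^bsub>H\<^esub> c i \<otimes>\<^bsub>H\<^esub> int_comb H (\<lambda>i. h (g i)) I c"
        unfolding int_comb_def by (rule H.finprod_insert) (use insert in \<open>auto simp: Pi_iff\<close>)
      ultimately show ?case
        using insert.IH g by (simp add: G.int_comb_closed h.hom_int_pow)
    qed (simp add: int_comb_def)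
  qed (simp add: int_comb_def)
qed

text \<open>An exact sequence 0 -> A -> B -> C -> 0 with \<open>C\<close> infinite cyclic splits: a
  basis of \<open>A\<close>, pushed into \<open>B\<close>, becomes a basis after adding a lift
  \<open>g' i0\<close> of a generator of \<open>C\<close>.\<close>

lemma int_basis_insert:
  assumes groups: "comm_group A" "comm_group B" "comm_group C" and "finite I" "i0 \<notin> I"
    and h: "h \<in> hom A B" "inj_on h (carrier A)" and k: "k \<in> hom B C"
    and ker: "kernel B C k = h ` carrier A"
    and bas: "int_basis A I g" and g': "\<And>i. i \<in> I \<Longrightarrow> g' i = h (g i)" "g' i0 \<in> carrier B"
    and gen: "\<And>y. y \<in> carrier C \<Longrightarrow> \<exists>m::int. y = k (g' i0) [^]\<^bsub>C\<^esub> m"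
    and free: "\<And>m::int. k (g' i0) [^]\<^bsub>C\<^esub> m = \<one>\<^bsub>C\<^esub> \<Longrightarrow> m = 0"
  shows "int_basis B (insert i0 I) g'"
proof -
  interpret A: comm_group A by fact
  interpret B: comm_group B by fact
  interpret C: comm_group C by fact
  interpret h: group_hom A B h
    using h by (simp add: group_hom_def group_hom_axioms_def A.is_group B.is_group)
  interpret k: group_hom B C k
    using k by (simp add: group_hom_def group_hom_axioms_def C.is_group B.is_group)
  have gI: "g \<in> I \<rightarrow> carrier A" using bas by (simp add: int_basis_def)
  then have gB: "g' \<in> insert i0 I \<rightarrow> carrier B" using g' by (auto simp: Pi_iff)
  have comb: "int_comb B g' (insert i0 I) c = g' i0 [^]\<^bsub>B\<^esub> c i0 \<otimes>\<^bsub>B\<^esub> h (int_comb A g I c)" for c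
  proof -
    have "int_comb B g' (insert i0 I) c = g' i0 [^]\<^bsub>B\<^esub> c i0 \<otimes>\<^bsub>B\<^esub> int_comb B g' I c"
      unfolding int_comb_def by (rule B.finprod_insert) (use gB assms in auto)
    also have "int_comb B g' I c = int_comb B (\<lambda>i. h (g i)) I c"
      by (rule int_comb_cong) (use g' gI groups in \<open>auto simp: Pi_iff\<close>)
    finally show ?thesis by (simp add: hom_int_comb [OF groups(1,2) h(1) gI])
  qed
  have ker': "k (h a) = \<one>\<^bsub>C\<^esub>" if "a \<in> carrier A" for a
    using that ker by (auto simp: kernel_def)
  show ?thesis
    unfolding int_basis_def
  proof (intro conjI subsetI allI impI ballI)
    fix x assume x: "x \<in> carrier B"
    then obtain m :: int where m: "k x = k (g' i0) [^]\<^bsub>C\<^esub> m" using gen by fastforce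
    \<comment> \<open>Dividing \<open>x\<close> by the power of \<open>g' i0\<close> with the same
      image in \<open>C\<close> leaves an element of the kernel, that is, of the image of
      \<open>A\<close>.\<close>
    define y where "y = inv\<^bsub>B\<^esub> (g' i0 [^]\<^bsub>B\<^esub> m) \<otimes>\<^bsub>B\<^esub> x"
    have y: "y \<in> carrier B" using x g' by (simp add: y_def)
    have "k y = \<one>\<^bsub>C\<^esub>" using x m g' by (simp add: y_def k.hom_int_pow)
    then obtain a where a: "a \<in> carrier A" "y = h a" using ker y by (auto simp: kernel_def)
    then obtain c where c: "a = int_comb A g I c" using bas by (auto simp: int_basis_def)
    have "int_comb A g I (c(i0 := m)) = int_comb A g I c"
      by (rule int_comb_cong) (use gI groups \<open>i0 \<notin> I\<close> in auto)
    then have "int_comb B g' (insert i0 I) (c(i0 := m)) = g' i0 [^]\<^bsub>B\<^esub> m \<otimes>\<^bsub>B\<^esub> y"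
      using a c by (simp add: comb)
    also have "\<dots> = x" using x g' by (simp add: y_def flip: B.m_assoc)
    finally show "x \<in> range (int_comb B g' (insert i0 I))" by (metis rangeI)
  next
    fix c i assume 1: "int_comb B g' (insert i0 I) c = \<one>\<^bsub>B\<^esub>" and i: "i \<in> insert i0 I"
    have cl: "int_comb A g I c \<in> carrier A" by (rule A.int_comb_closed [OF gI])
    have "k (g' i0) [^]\<^bsub>C\<^esub> c i0 = k (int_comb B g' (insert i0 I) c)"
      using g' cl by (simp add: comb ker' k.hom_int_pow)
    then have "k (g' i0) [^]\<^bsub>C\<^esub> c i0 = \<one>\<^bsub>C\<^esub>" by (simp add: 1)
    then have c0: "c i0 = 0" by (rule free)
    then have "h (int_comb A g I c) = \<one>\<^bsub>B\<^esub>" using 1 cl by (simp add: comb)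
    then have "int_comb A g I c = \<one>\<^bsub>A\<^esub>" using cl h(2) by (metis A.one_closed h.hom_one inj_onD)
    then show "c i = 0" using i c0 bas by (auto simp: int_basis_def)
  qed (use gB in auto)
qed

text \<open>A generator of finite order would make the group finite, whereas it is in bijection with
  the integers.\<close>

lemma infinite_cyclic_generator:
  assumes "group G" "G \<cong> integer_group" and a: "a \<in> carrier G" and gen: "generate G {a} = carrier G"
  shows "y \<in> carrier G \<Longrightarrow> \<exists>m::int. y = a [^]\<^bsub>G\<^esub> m"
    and "a [^]\<^bsub>G\<^esub> (m::int) = \<one>\<^bsub>G\<^esub> \<Longrightarrow> m = 0"
proof -
  interpret group G by fact
  show "y \<in> carrier G \<Longrightarrow> \<exists>m::int. y = a [^]\<^bsub>G\<^esub> m"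
    using gen generate_pow [OF a] by auto
  obtain f where "f \<in> iso G integer_group" using assms(2) by (auto simp: is_iso_def)
  then have "bij_betw f (carrier G) (UNIV :: int set)" by (simp add: iso_def)
  then have "infinite (carrier G)" using bij_betw_finite infinite_UNIV_int by blast
  moreover have "carrier (subgroup_generated G {a}) = carrier G"
    using a gen by (simp add: carrier_subgroup_generated)
  ultimately show "a [^]\<^bsub>G\<^esub> m = \<one>\<^bsub>G\<^esub> \<Longrightarrow> m = 0"
    using finite_cyclic_subgroup_int [OF a] by auto
qed

section \<open>Homology of the skeleta\<close>

text \<open>In this lemma and the next two, \<open>ker\<close> is exactness at \<open>G\<close> of K
  -> G -> H; they extract the usual consequences when an outer term is zero.\<close>

lemma trivial_group_exact:
  assumes "group G" and ker: "kernel G H f = g ` carrier K" and K: "trivial_group K" and H: "trivial_group H"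
    and f: "f \<in> hom G H" and g: "g \<in> hom K G"
  shows "trivial_group G"
proof -
  interpret group G by fact
  have "carrier G \<subseteq> kernel G H f"
    using f H by (auto simp: kernel_def trivial_group_def hom_def)
  moreover have "g (one K) = one G"
    using hom_one [OF g] K assms(1) by (simp add: trivial_group_def)
  ultimately have "carrier G \<subseteq> {one G}"
    using ker K by (simp add: trivial_group_def)
  then show ?thesis by (auto simp: trivial_group_def is_group)
qed

lemma inj_on_exact:
  assumes "group G" "group H" and f: "f \<in> hom G H" and ker: "kernel G H f = g ` carrier K"
    and K: "trivial_group K" and g: "g \<in> hom K G"
  shows "inj_on f (carrier G)"
proof -
  have "g (one K) = one G"
    using hom_one [OF g] K assms(1) by (simp add: trivial_group_def)
  then have "kernel G H f = {one G}"
    using ker K by (simp add: trivial_group_def)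
  interpret group_hom G H f
    using assms by (simp add: group_hom_def group_hom_axioms_def)
  show ?thesis using \<open>kernel G H f = {one G}\<close> by (simp add: inj_iff_trivial_ker)
qed

lemma surj_exact:
  assumes f: "f \<in> hom G H" and ker: "kernel G H f = g ` carrier K" and H: "trivial_group H"
  shows "g ` carrier K = carrier G"
  using assms by (auto simp: kernel_def trivial_group_def hom_def)

text \<open>The exact sequence of a triple in the form of kernel equations, one for each of its
  three types of term. Taking \<open>T = {}\<close> yields the exact sequence of a pair.\<close>

lemma kernel_triple_1:
  assumes "T \<subseteq> S"
  shows "kernel (relative_homology_group p X S) (relative_homology_group (p - 1) (subtopology X S) T) (hom_relboundary p X S T)
     = hom_induced p X T X S id ` carrier (relative_homology_group p X T)"
  using homology_exactness_triple_1 [OF assms, of p X] by simp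

lemma kernel_triple_2:
  assumes "T \<subseteq> S"
  shows "kernel (relative_homology_group p (subtopology X S) T) (relative_homology_group p X T) (hom_induced p (subtopology X S) T X T id)
     = hom_relboundary (p + 1) X S T ` carrier (relative_homology_group (p + 1) X S)"
  using homology_exactness_triple_2 [OF assms, of "p + 1" X] by simp

lemma kernel_triple_3:
  assumes "T \<subseteq> S"
  shows "kernel (relative_homology_group p X T) (relative_homology_group p X S) (hom_induced p X T X S id)
     = hom_induced p (subtopology X S) T X T id ` carrier (relative_homology_group p (subtopology X S) T)"
  using homology_exactness_triple_3 [OF assms, of p X] by simp

lemma hom_relboundary_Suc:
  "hom_relboundary (p + 1) X S T
     \<in> hom (relative_homology_group (p + 1) X S) (relative_homology_group p (subtopology X S) T)"
  using group_homomorphism_hom_relboundary [of "p + 1" X S T] by simp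

section \<open>Relative homology of a disc modulo its sphere\<close>

lemma subtopology_disc_sphere_Suc: "subtopology (disc (Suc m)) (disc_sphere (Suc m)) = nsphere m"
proof -
  have "{x. (\<Sum>i<Suc m. (x i)\<^sup>2) \<le> 1} \<inter> disc_sphere (Suc m)
      = topspace (Euclidean_space (Suc m)) \<inter> {x. (\<Sum>i\<le>m. (x i)\<^sup>2) = (1::real)}"
    by (auto simp: disc_sphere_def topspace_disc topspace_Euclidean_space lessThan_Suc_atMost)
  then show ?thesis
    unfolding disc_def nsphere_def
    by (metis subtopology_restrict subtopology_subtopology)
qed

lemma disc_0: "topspace (disc 0) = {\<lambda>i. 0}" "disc_sphere 0 = {}"
  by (auto simp: disc_sphere_def topspace_disc)

text \<open>The disc is contractible, so the connecting map to the reduced homology of the sphere is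
  an isomorphism once the sphere is nonempty; the point (1,0,0,...) ensures this. In dimension 0 the
  sphere is empty, which is why that case is treated apart, as the homology of a point.\<close>

lemma relative_homology_disc_Suc:
  "relative_homology_group p (disc (Suc m)) (disc_sphere (Suc m)) \<cong> reduced_homology_group (p - 1) (nsphere m)"
proof -
  have "(\<lambda>i. if i = 0 then 1 else 0) \<in> topspace (disc (Suc m)) \<inter> disc_sphere (Suc m)"
    by (simp add: disc_sphere_def topspace_disc if_distrib [of "\<lambda>x. x\<^sup>2"] sum.lessThan_Suc_shift del: sum.lessThan_Suc)
  then show ?thesis
    using isomorphic_group_relative_homology_of_contractible [OF contractible_space_disc, of "Suc m" "disc_sphere (Suc m)" p]
    by (auto simp: subtopology_disc_sphere_Suc)
qed

lemma trivial_relative_homology_disc: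
  assumes "p \<noteq> int n"
  shows "trivial_group (relative_homology_group p (disc n) (disc_sphere n))"
proof (cases n)
  case 0
  then show ?thesis using assms homology_dimension_axiom [OF disc_0(1)] by (simp add: disc_0)
next
  case (Suc m)
  then have "trivial_group (reduced_homology_group (p - 1) (nsphere m))"
    using assms by (simp add: trivial_reduced_homology_group_nsphere)
  then show ?thesis
    using isomorphic_group_triviality [OF relative_homology_disc_Suc [of p m]] Suc by simp
qed

lemma relative_homology_disc_iso_integer:
  "relative_homology_group (int n) (disc n) (disc_sphere n) \<cong> integer_group"
proof (cases n)
  case 0
  then show ?thesis using homology_coefficients [OF disc_0(1)] by (simp add: disc_0)
next
  case (Suc m)
  then have "relative_homology_group (int n) (disc n) (disc_sphere n) \<cong> reduced_homology_group (int m) (nsphere m)"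
    using relative_homology_disc_Suc [of "int n" m] by simp
  then show ?thesis
    using reduced_homology_group_nsphere(1) iso_trans by blast
qed

section \<open>Skeleta of a finite CW complex\<close>

locale finite_cw =
  fixes M :: "('a, 'c) cw"
  assumes finite_cw_complex: "finite_cw_complex M"
begin

abbreviation "X \<equiv> cw_space M"
abbreviation "sk \<equiv> skeleton_below M"
abbreviation "ch \<equiv> cw_char M"

definition dcells :: "nat \<Rightarrow> 'c set" where
  "dcells d = {\<sigma> \<in> cw_cells M. cw_dim M \<sigma> = d}"

lemma Hausdorff_X: "Hausdorff_space X"
  and finite_cells: "finite (cw_cells M)"
  and Union_open_cells: "(\<Union>\<sigma>\<in>cw_cells M. open_cell M \<sigma>) = topspace X"
  and open_cells_disjoint: "\<lbrakk>\<sigma> \<in> cw_cells M; \<tau> \<in> cw_cells M; \<sigma> \<noteq> \<tau>\<rbrakk> \<Longrightarrow> open_cell M \<sigma> \<inter> open_cell M \<tau> = {}"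
  and continuous_char: "\<sigma> \<in> cw_cells M \<Longrightarrow> continuous_map (disc (cw_dim M \<sigma>)) X (ch \<sigma>)"
  and homeomorphic_char: "\<sigma> \<in> cw_cells M \<Longrightarrow> homeomorphic_map
          (subtopology (disc (cw_dim M \<sigma>)) (disc_interior (cw_dim M \<sigma>)))
          (subtopology X (open_cell M \<sigma>)) (ch \<sigma>)"
  and char_boundary: "\<sigma> \<in> cw_cells M \<Longrightarrow> ch \<sigma> ` disc_sphere (cw_dim M \<sigma>) \<subseteq> sk (cw_dim M \<sigma>)"
  and orient_carrier: "cw_orient M n \<in> carrier (relative_homology_group (int n) (disc n) (disc_sphere n))"
  and orient_generates: "generate (relative_homology_group (int n) (disc n) (disc_sphere n)) {cw_orient M n}
            = carrier (relative_homology_group (int n) (disc n) (disc_sphere n))"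
  using finite_cw_complex unfolding finite_cw_complex_def by simp_all

lemma finite_dcells: "finite (dcells d)"
  using finite_cells by (simp add: dcells_def)

lemma skeleton_subset: "sk d \<subseteq> topspace X"
  using Union_open_cells by (auto simp: skeleton_below_def)

lemma open_cell_subset: "\<sigma> \<in> cw_cells M \<Longrightarrow> open_cell M \<sigma> \<subseteq> topspace X"
  using Union_open_cells by auto

lemma skeleton_mono: "d \<le> e \<Longrightarrow> sk d \<subseteq> sk e"
  by (auto simp: skeleton_below_def)

lemma skeleton_0: "sk 0 = {}"
  by (auto simp: skeleton_below_def)

lemma skeleton_Suc: "sk (Suc d) = sk d \<union> (\<Union>\<sigma>\<in>dcells d. open_cell M \<sigma>)"
  by (auto simp: skeleton_below_def dcells_def less_Suc_eq)

lemma skeleton_top: obtains N where "\<And>d. d \<ge> N \<Longrightarrow> sk d = topspace X"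
proof
  \<comment> \<open>Without cells the maximum is unspecified, which is harmless: then the space and
    all skeleta are empty.\<close>
  fix d assume d: "d \<ge> Suc (Max (cw_dim M ` cw_cells M))"
  have "cw_dim M \<sigma> < d" if "\<sigma> \<in> cw_cells M" for \<sigma>
    using d that finite_cells by (meson Max_ge Suc_le_lessD finite_imageI image_eqI le_less_trans)
  then have "{\<sigma> \<in> cw_cells M. cw_dim M \<sigma> < d} = cw_cells M" by blast
  then show "sk d = topspace X"
    unfolding skeleton_below_def using Union_open_cells by simp
qed

lemma closed_cell_eq:
  "ch \<sigma> ` topspace (disc (cw_dim M \<sigma>)) = ch \<sigma> ` disc_sphere (cw_dim M \<sigma>) \<union> open_cell M \<sigma>"
  unfolding open_cell_def by (simp flip: disc_sphere_Un_interior image_Un)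

lemma closedin_closed_cell:
  assumes "\<sigma> \<in> cw_cells M"
  shows "closedin X (ch \<sigma> ` topspace (disc (cw_dim M \<sigma>)))"
  by (rule compactin_imp_closedin [OF Hausdorff_X image_compactin [OF _ continuous_char [OF assms]]])
    (use compact_space_disc in \<open>simp add: compact_space_def\<close>)

text \<open>Adding the boundaries of the cells changes nothing, as they already lie in
  \<open>sk d\<close>. So the set is a finite union of closed cells, each of them compact.\<close>

lemma closedin_skeleton_Un:
  assumes "F \<subseteq> dcells d"
  shows "closedin X (sk d \<union> (\<Union>\<sigma>\<in>F. open_cell M \<sigma>))"
proof -
  let ?C = "{\<sigma> \<in> cw_cells M. cw_dim M \<sigma> < d} \<union> F"
  have C: "?C \<subseteq> cw_cells M" using assms by (auto simp: dcells_def)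
  have "sk d \<union> (\<Union>\<sigma>\<in>F. open_cell M \<sigma>) = (\<Union>\<sigma>\<in>?C. ch \<sigma> ` topspace (disc (cw_dim M \<sigma>)))" (is "?L = ?R")
  proof
    show "?L \<subseteq> ?R" unfolding closed_cell_eq by (auto simp: skeleton_below_def)
    have "ch \<sigma> ` disc_sphere (cw_dim M \<sigma>) \<subseteq> sk d" if "\<sigma> \<in> ?C" for \<sigma>
    proof -
      have "cw_dim M \<sigma> \<le> d" using that assms by (auto simp: dcells_def)
      then show ?thesis using char_boundary [of \<sigma>] skeleton_mono C that by blast
    qed
    moreover have "open_cell M \<sigma> \<subseteq> ?L" if "\<sigma> \<in> ?C" for \<sigma>
      using that by (auto simp: skeleton_below_def)
    ultimately show "?R \<subseteq> ?L" unfolding closed_cell_eq by blast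
  qed
  moreover have "finite ?C" using C finite_cells finite_subset by blast
  ultimately show ?thesis
    using C by (auto intro!: closedin_Union closedin_closed_cell)
qed

lemma cell_attachment_skeleton:
  assumes F: "F \<subseteq> dcells d" and \<sigma>: "\<sigma> \<in> dcells d" "\<sigma> \<notin> F"
  defines "A \<equiv> sk d \<union> (\<Union>\<tau>\<in>F. open_cell M \<tau>)"
  shows "cell_attachment (subtopology X (A \<union> open_cell M \<sigma>)) A d (ch \<sigma>)"
proof -
  have s: "\<sigma> \<in> cw_cells M" "cw_dim M \<sigma> = d" using \<sigma> by (auto simp: dcells_def)
  have A: "A \<subseteq> topspace X" unfolding A_def by (rule closedin_subset [OF closedin_skeleton_Un [OF F]])
  have op: "ch \<sigma> ` disc_interior d = open_cell M \<sigma>" by (simp add: open_cell_def s)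
  have AU: "A \<union> open_cell M \<sigma> \<subseteq> topspace X" using A open_cell_subset s by blast
  show ?thesis
  proof
    show "Hausdorff_space (subtopology X (A \<union> open_cell M \<sigma>))"
      by (simp add: Hausdorff_space_subtopology Hausdorff_X)
    show "closedin (subtopology X (A \<union> open_cell M \<sigma>)) A"
      using closedin_skeleton_Un [OF F] by (auto simp: A_def closedin_subset_topspace intro: closedin_subset_topspace)
    show sph: "ch \<sigma> ` disc_sphere d \<subseteq> A" using char_boundary [of \<sigma>] s by (auto simp: A_def)
    show "continuous_map (disc d) (subtopology X (A \<union> open_cell M \<sigma>)) (ch \<sigma>)"
      using continuous_char [of \<sigma>] s sph op disc_sphere_Un_interior [of d]
      by (fastforce simp: continuous_map_in_subtopology)
    have "open_cell M \<tau> \<inter> open_cell M \<sigma> = {}" if "\<tau> \<in> F \<or> \<tau> \<in> cw_cells M \<and> cw_dim M \<tau> < d" for \<tau>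
      using that F \<sigma> s by (intro open_cells_disjoint) (auto simp: dcells_def)
    then show "A \<inter> ch \<sigma> ` disc_interior d = {}"
      unfolding op by (fastforce simp: A_def skeleton_below_def)
    show "topspace (subtopology X (A \<union> open_cell M \<sigma>)) = A \<union> ch \<sigma> ` disc_interior d"
      using AU by (auto simp: op)
    show "homeomorphic_map (subtopology (disc d) (disc_interior d))
        (subtopology (subtopology X (A \<union> open_cell M \<sigma>)) (ch \<sigma> ` disc_interior d)) (ch \<sigma>)"
      using homeomorphic_char [of \<sigma>] s by (simp add: op subtopology_subtopology Int_absorb1)
  qed
qed

text \<open>
  Attaching the \<open>d\<close>-cells one at a time, the exact sequence of a triple adds exactly one basis
  element per cell, since its third term is infinite cyclic in degree \<open>d\<close> and zero otherwise.
\<close>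
theorem relative_homology_skeleton:
  assumes "F \<subseteq> dcells d"
  defines "Y \<equiv> \<lambda>F. subtopology X (sk d \<union> (\<Union>\<tau>\<in>F. open_cell M \<tau>))"
  shows "(\<forall>p. p \<noteq> int d \<longrightarrow> trivial_group (relative_homology_group p (Y F) (sk d))) \<and>
     int_basis (relative_homology_group (int d) (Y F) (sk d)) F
       (\<lambda>\<sigma>. hom_induced (int d) (disc d) (disc_sphere d) (Y F) (sk d) (ch \<sigma>) (cw_orient M d))"
proof -
  have "finite F" using assms finite_dcells finite_subset by blast
  then show ?thesis using assms(1)
  proof induction
    case empty
    have "trivial_group (relative_homology_group p (Y {}) (sk d))" for p
      using trivial_relative_homology_group_topspace [of p "Y {}"] skeleton_subset [of d]
      by (simp add: Y_def Int_absorb1)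
    moreover have "int_comb (relative_homology_group p (Y {}) (sk d)) g {} c
        = one (relative_homology_group p (Y {}) (sk d))" for p g and c :: "'c \<Rightarrow> int"
      unfolding int_comb_def
      by (rule comm_monoid.finprod_empty [OF comm_group.axioms(1) [OF abelian_relative_homology_group]])
    ultimately show ?case
      by (fastforce simp: int_basis_def trivial_group_def)
  next
    case (insert \<sigma> F)
    then have F: "F \<subseteq> dcells d" and \<sigma>: "\<sigma> \<in> dcells d" "\<sigma> \<notin> F" by auto
    let ?A = "sk d \<union> (\<Union>\<tau>\<in>F. open_cell M \<tau>)" and ?Y = "Y (insert \<sigma> F)"
    have YY: "?Y = subtopology X (?A \<union> open_cell M \<sigma>)" by (simp add: Y_def Un_ac)
    interpret cell_attachment ?Y ?A d "ch \<sigma>"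
      unfolding YY by (rule cell_attachment_skeleton [OF F \<sigma>])
    have sub: "subtopology ?Y ?A = Y F"
      unfolding YY by (simp add: Y_def subtopology_subtopology Int_absorb1)
    have T: "sk d \<subseteq> ?A" by blast
    note k2 = kernel_triple_2 [OF T, of _ ?Y, unfolded sub]
    note k3 = kernel_triple_3 [OF T, of _ ?Y, unfolded sub]
    note rb = hom_relboundary_Suc [of _ ?Y ?A "sk d", unfolded sub]
    have iso: "hom_induced p (disc d) (disc_sphere d) ?Y ?A (ch \<sigma>)
      \<in> iso (relative_homology_group p (disc d) (disc_sphere d)) (relative_homology_group p ?Y ?A)" for p
      by (rule iso_char)
    have triv: "trivial_group (relative_homology_group p ?Y ?A)" if "p \<noteq> int d" for p
      using iso [of p] trivial_relative_homology_disc [OF that] isomorphic_group_triviality is_isoI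
      by (metis group_relative_homology_group)
    have IH: "p \<noteq> int d \<Longrightarrow> trivial_group (relative_homology_group p (Y F) (sk d))"
       "int_basis (relative_homology_group (int d) (Y F) (sk d)) F
       (\<lambda>\<sigma>. hom_induced (int d) (disc d) (disc_sphere d) (Y F) (sk d) (ch \<sigma>) (cw_orient M d))" for p
      using insert.IH F by auto
    have 1: "trivial_group (relative_homology_group p ?Y (sk d))" if "p \<noteq> int d" for p
      by (rule trivial_group_exact [OF group_relative_homology_group k3 IH(1) [OF that] triv [OF that]])
        (auto simp: hom_induced_hom)
    have 2: "int_basis (relative_homology_group (int d) ?Y (sk d)) (insert \<sigma> F)
       (\<lambda>\<sigma>. hom_induced (int d) (disc d) (disc_sphere d) ?Y (sk d) (ch \<sigma>) (cw_orient M d))"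
    proof (rule int_basis_insert [OF _ _ _ insert.hyps(1) \<sigma>(2) hom_induced_hom _ hom_induced_hom k3 IH(2)])
      \<comment> \<open>The kernel comes from the group of \<open>(?Y, ?A)\<close> in degree
        \<open>d + 1\<close>, which vanishes because the added cell has dimension
        \<open>d\<close>.\<close>
      show "inj_on (hom_induced (int d) (Y F) (sk d) ?Y (sk d) id) (carrier (relative_homology_group (int d) (Y F) (sk d)))"
        by (rule inj_on_exact [OF _ _ hom_induced_hom k2 triv rb]) auto
      have cmp: "hom_induced (int d) (disc d) (disc_sphere d) Z U (ch \<tau>) c
         = hom_induced (int d) Z' U' Z U id (hom_induced (int d) (disc d) (disc_sphere d) Z' U' (ch \<tau>) c)"
        if "continuous_map (disc d) Z' (ch \<tau>)" "continuous_map Z' Z id" "ch \<tau> ` disc_sphere d \<subseteq> U'" "U' \<subseteq> U"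
        for Z U Z' U' \<tau> c
        using hom_induced_compose' [of "disc d" Z' "ch \<tau>" "disc_sphere d" U' Z id U "int d" c] that
        by (simp add: image_subset_iff_funcset subset_iff Pi_iff)
      fix \<tau> assume "\<tau> \<in> F"
      then have \<tau>: "\<tau> \<in> cw_cells M" "cw_dim M \<tau> = d" using F by (auto simp: dcells_def)
      show "hom_induced (int d) (disc d) (disc_sphere d) ?Y (sk d) (ch \<tau>) (cw_orient M d) =
        hom_induced (int d) (Y F) (sk d) ?Y (sk d) id
         (hom_induced (int d) (disc d) (disc_sphere d) (Y F) (sk d) (ch \<tau>) (cw_orient M d))"
      proof (rule cmp)
        have "ch \<tau> ` topspace (disc d) \<subseteq> ?A"
          using closed_cell_eq [of \<tau>] char_boundary [of \<tau>] \<tau> \<open>\<tau> \<in> F\<close> by auto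
        then show "continuous_map (disc d) (Y F) (ch \<tau>)"
          using continuous_char [of \<tau>] \<tau> by (auto simp: Y_def continuous_map_in_subtopology)
        show "continuous_map (Y F) ?Y id"
          using sub by (metis continuous_map_from_subtopology continuous_map_id)
      qed (use char_boundary [of \<tau>] \<tau> in auto)
    next
      show "hom_induced (int d) (disc d) (disc_sphere d) ?Y (sk d) (ch \<sigma>) (cw_orient M d)
        \<in> carrier (relative_homology_group (int d) ?Y (sk d))"
        by (rule hom_induced_carrier)
    next
      let ?D = "relative_homology_group (int d) (disc d) (disc_sphere d)" and ?R = "relative_homology_group (int d) ?Y ?A"
      let ?f = "hom_induced (int d) (disc d) (disc_sphere d) ?Y ?A (ch \<sigma>)"
      have s: "\<sigma> \<in> cw_cells M" "cw_dim M \<sigma> = d" using \<sigma> by (auto simp: dcells_def)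
      \<comment> \<open>Modulo \<open>?A\<close>, the class of the new cell is the image of the
        orientation under the isomorphism of \<open>iso_char\<close>, hence a generator of an
        infinite cyclic group.\<close>
      have eq: "hom_induced (int d) ?Y (sk d) ?Y ?A id
         (hom_induced (int d) (disc d) (disc_sphere d) ?Y (sk d) (ch \<sigma>) (cw_orient M d)) = ?f (cw_orient M d)"
        using hom_induced_compose' [of "disc d" ?Y "ch \<sigma>" "disc_sphere d" "sk d" ?Y id ?A "int d"] 
          cont_char char_boundary [of \<sigma>] s by (simp add: image_subset_iff_funcset Pi_iff)
      interpret f: group_hom ?D ?R ?f
        by (simp add: group_hom_def group_hom_axioms_def hom_induced_hom)
      have bij: "bij_betw ?f (carrier ?D) (carrier ?R)" using iso [of "int d"] by (simp add: iso_def)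
      note cyc = infinite_cyclic_generator [OF _ relative_homology_disc_iso_integer orient_carrier orient_generates]
      show "\<exists>m::int. y = hom_induced (int d) ?Y (sk d) ?Y ?A id
         (hom_induced (int d) (disc d) (disc_sphere d) ?Y (sk d) (ch \<sigma>) (cw_orient M d)) [^]\<^bsub>?R\<^esub> m"
        if y: "y \<in> carrier ?R" for y
      proof -
        obtain x where x: "x \<in> carrier ?D" "y = ?f x" using bij y by (auto simp: bij_betw_def)
        then obtain m :: int where "x = cw_orient M d [^]\<^bsub>?D\<^esub> m" using cyc(1) by auto
        then show ?thesis unfolding eq using x(2) f.hom_int_pow [OF orient_carrier] by auto
      qed
      show "m = 0" if "hom_induced (int d) ?Y (sk d) ?Y ?A id
         (hom_induced (int d) (disc d) (disc_sphere d) ?Y (sk d) (ch \<sigma>) (cw_orient M d)) [^]\<^bsub>?R\<^esub> m = \<one>\<^bsub>?R\<^esub>"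
        for m :: int
      proof -
        have "?f (cw_orient M d [^]\<^bsub>?D\<^esub> m) = ?f \<one>\<^bsub>?D\<^esub>"
          using that f.hom_int_pow [OF orient_carrier, of m] unfolding eq f.hom_one by (simp only:)
        then have "cw_orient M d [^]\<^bsub>?D\<^esub> m = \<one>\<^bsub>?D\<^esub>"
          using bij orient_carrier
          by (meson bij_betw_def f.G.int_pow_closed f.G.one_closed inj_onD)
        then show ?thesis using cyc(2) by auto
      qed
    qed auto
    show ?case using 1 2 by blast
  qed
qed

end

section \<open>Cellular and singular homology\<close>

context finite_cw
begin

abbreviation "skt d \<equiv> subtopology X (sk d)"

lemma subtopology_skeleton: "d \<le> e \<Longrightarrow> subtopology (skt e) (sk d) = skt d"
  using skeleton_mono by (simp add: subtopology_subtopology Int_absorb1)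

lemma trivial_skeleton_pair:
  "p \<noteq> int n \<Longrightarrow> trivial_group (relative_homology_group p (skt (Suc n)) (sk n))"
  using relative_homology_skeleton [of "dcells n" n] by (simp add: skeleton_Suc)

lemma cellular_chain_group_eq: "cellular_chain_group M n = relative_homology_group (int n) (skt (Suc n)) (sk n)"
  by (simp add: cellular_chain_group_def)

lemma comm_group_cellular: "comm_group (cellular_chain_group M n)"
  by (simp add: cellular_chain_group_def)

lemma int_basis_cellular: "int_basis (cellular_chain_group M n) (dcells n) (cell_class M)"
proof -
  let ?G = "relative_homology_group (int n) (skt (Suc n)) (sk n)"
  let ?g = "\<lambda>\<sigma>. hom_induced (int n) (disc n) (disc_sphere n) (skt (Suc n)) (sk n) (ch \<sigma>) (cw_orient M n)"
  have b: "int_basis ?G (dcells n) ?g"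
    using relative_homology_skeleton [of "dcells n" n] by (simp add: skeleton_Suc)
  have eq: "cell_class M \<sigma> = ?g \<sigma>" if "\<sigma> \<in> dcells n" for \<sigma>
    using that by (simp add: cell_class_def dcells_def)
  have "int_comb ?G (cell_class M) (dcells n) c = int_comb ?G ?g (dcells n) c" for c
    by (rule int_comb_cong) (use eq b in \<open>auto simp: int_basis_def\<close>)
  then show ?thesis
    unfolding cellular_chain_group_eq using b eq by (simp add: int_basis_def Pi_iff)
qed

text \<open>Identifies integer coefficient functions on the \<open>n\<close>-cells with cellular
  chains; values elsewhere are ignored.\<close>

abbreviation chain_of :: "nat \<Rightarrow> ('c \<Rightarrow> int) \<Rightarrow> 'a chain set" where
  "chain_of n \<equiv> int_comb (cellular_chain_group M n) (cell_class M) (dcells n)"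

lemma cell_class_carrier: "cell_class M \<in> dcells n \<rightarrow> carrier (cellular_chain_group M n)"
  using int_basis_cellular by (simp add: int_basis_def)

lemma chain_of_carrier: "chain_of n c \<in> carrier (cellular_chain_group M n)"
  by (rule comm_group.int_comb_closed [OF comm_group_cellular cell_class_carrier])

lemma chain_of_surj: "x \<in> carrier (cellular_chain_group M n) \<Longrightarrow> \<exists>c. x = chain_of n c"
  using int_basis_cellular [of n] by (auto simp: int_basis_def)

lemma chain_of_eq_iff: "chain_of n c = chain_of n d \<longleftrightarrow> (\<forall>\<sigma>\<in>dcells n. c \<sigma> = d \<sigma>)"
proof
  show "chain_of n c = chain_of n d \<Longrightarrow> \<forall>\<sigma>\<in>dcells n. c \<sigma> = d \<sigma>"
    using comm_group.int_basis_inj [OF comm_group_cellular int_basis_cellular] by blast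
  show "\<forall>\<sigma>\<in>dcells n. c \<sigma> = d \<sigma> \<Longrightarrow> chain_of n c = chain_of n d"
    by (rule int_comb_cong) (use cell_class_carrier comm_group_cellular in auto)
qed

lemma chain_of_zero: "chain_of n (\<lambda>_. 0) = one (cellular_chain_group M n)"
  by (rule comm_group.int_comb_zero [OF comm_group_cellular])

lemma cellular_boundary_hom:
  "cellular_boundary M n \<in> hom (cellular_chain_group M (Suc n)) (cellular_chain_group M n)"
  using hom_relboundary_Suc [of "int n" "skt (Suc (Suc n))" "sk (Suc n)" "sk n"]
  by (simp add: cellular_boundary_def cellular_chain_group_eq subtopology_skeleton add_ac)

text \<open>The basis property supplies the witness that the choice operator in
  \<open>cw_incidence\<close> needs. The chosen predicate depends on \<open>\<sigma>\<close> only
  through its dimension, so one coefficient function serves all \<open>n\<close>-cells.\<close>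

lemma cellular_boundary_cell:
  assumes "\<tau> \<in> dcells (Suc n)"
  shows "cellular_boundary M n (cell_class M \<tau>) = chain_of n (cw_incidence M \<tau>)"
proof -
  let ?P = "\<lambda>c. cellular_boundary M n (cell_class M \<tau>) = chain_of n c"
  have "cell_class M \<tau> \<in> carrier (cellular_chain_group M (Suc n))"
    using cell_class_carrier assms by auto
  then have "cellular_boundary M n (cell_class M \<tau>) \<in> carrier (cellular_chain_group M n)"
    using cellular_boundary_hom by (auto simp: hom_def)
  then have "\<exists>c. ?P c" using chain_of_surj by blast
  then have P: "?P (Eps ?P)" by (rule someI_ex)
  have "cw_incidence M \<tau> \<sigma> = Eps ?P \<sigma>" if "\<sigma> \<in> dcells n" for \<sigma>
    using that assms by (simp add: cw_incidence_def int_comb_def dcells_def Let_def)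
  then have "chain_of n (cw_incidence M \<tau>) = chain_of n (Eps ?P)"
    unfolding chain_of_eq_iff by blast
  then show ?thesis using P by (rule trans [OF _ sym, rotated])
qed

text \<open>The cellular boundary in coordinates; \<open>n\<close> is the degree of the result, not
  of the argument.\<close>

definition int_bdry :: "nat \<Rightarrow> ('c \<Rightarrow> int) \<Rightarrow> 'c \<Rightarrow> int" where
  "int_bdry n c \<sigma> = (\<Sum>\<tau>\<in>dcells (Suc n). c \<tau> * cw_incidence M \<tau> \<sigma>)"

lemma cellular_boundary_chain_of: "cellular_boundary M n (chain_of (Suc n) c) = chain_of n (int_bdry n c)"
proof -
  have "cellular_boundary M n (chain_of (Suc n) c)
     = int_comb (cellular_chain_group M n) (\<lambda>\<tau>. cellular_boundary M n (cell_class M \<tau>)) (dcells (Suc n)) c"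
    by (rule hom_int_comb [OF comm_group_cellular comm_group_cellular cellular_boundary_hom cell_class_carrier])
  also have "\<dots> = int_comb (cellular_chain_group M n) (\<lambda>\<tau>. chain_of n (cw_incidence M \<tau>)) (dcells (Suc n)) c"
    by (rule int_comb_cong) (use cellular_boundary_cell comm_group_cellular chain_of_carrier in auto)
  also have "\<dots> = chain_of n (\<lambda>\<sigma>. \<Sum>\<tau>\<in>dcells (Suc n). c \<tau> * cw_incidence M \<tau> \<sigma>)"
    by (rule comm_group.int_comb_sum [OF comm_group_cellular cell_class_carrier finite_dcells, symmetric])
  finally show ?thesis by (simp add: int_bdry_def [abs_def])
qed

text \<open>\<open>skt n\<close> is the skeleton of dimension \<open>n - 1\<close>, so degree
  \<open>n\<close> is already above its dimension. In the step both neighbours in the exact sequence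
  of the pair vanish.\<close>

lemma trivial_homology_skeleton: "int n \<le> p \<Longrightarrow> trivial_group (homology_group p (skt n))"
proof (induction n)
  case 0
  then show ?case by (simp add: skeleton_0 trivial_homology_group_empty)
next
  case (Suc n)
  show ?case
  proof (rule trivial_group_exact [OF group_relative_homology_group])
    show "kernel (homology_group p (skt (Suc n))) (relative_homology_group p (skt (Suc n)) (sk n))
         (hom_induced p (skt (Suc n)) {} (skt (Suc n)) (sk n) id)
       = hom_induced p (skt n) {} (skt (Suc n)) {} id ` carrier (homology_group p (skt n))"
      using kernel_triple_3 [of "{}" "sk n" p "skt (Suc n)"] by (simp add: subtopology_skeleton)
  qed (use Suc trivial_skeleton_pair in \<open>auto simp: hom_induced_hom\<close>)
qed

text \<open>Relative to \<open>sk n\<close> only cells of dimension at least \<open>n\<close>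
  remain. The induction descends from a skeleton that exhausts the space.\<close>

lemma trivial_relative_homology_skeleton:
  assumes "p < int n"
  shows "trivial_group (relative_homology_group p X (sk n))"
proof -
  obtain N where N: "\<And>d. d \<ge> N \<Longrightarrow> sk d = topspace X" by (rule skeleton_top) blast
  show ?thesis using assms
  proof (induction "N - n" arbitrary: n)
    case 0
    then show ?case using N [of n] trivial_relative_homology_group_topspace by auto
  next
    case (Suc m)
    show ?case
    proof (rule trivial_group_exact [OF group_relative_homology_group])
      show "kernel (relative_homology_group p X (sk n)) (relative_homology_group p X (sk (Suc n)))
           (hom_induced p X (sk n) X (sk (Suc n)) id)
         = hom_induced p (skt (Suc n)) (sk n) X (sk n) id ` carrier (relative_homology_group p (skt (Suc n)) (sk n))"
        using kernel_triple_3 [of "sk n" "sk (Suc n)" p X] skeleton_mono [of n "Suc n"] by simp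
      show "trivial_group (relative_homology_group p X (sk (Suc n)))"
        using Suc.hyps Suc.prems by auto
    qed (use Suc.prems trivial_skeleton_pair in \<open>auto simp: hom_induced_hom\<close>)
  qed
qed

text \<open>The homology of the \<open>k\<close>-skeleton in degree \<open>k\<close> mediates
  between the two theories: \<open>to_chain\<close> embeds it as the cellular cycles, because the
  lower skeleton has no homology in degree \<open>k\<close>, and \<open>to_space\<close> maps it
  onto the homology of the space, because the space relative to the \<open>k\<close>-skeleton has
  none.\<close>

abbreviation "skel_homology k \<equiv> homology_group (int k) (skt (Suc k))"

definition to_chain :: "nat \<Rightarrow> 'a chain set \<Rightarrow> 'a chain set" where
  "to_chain k = hom_induced (int k) (skt (Suc k)) {} (skt (Suc k)) (sk k) id"

definition to_space :: "nat \<Rightarrow> 'a chain set \<Rightarrow> 'a chain set" where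
  "to_space k = hom_induced (int k) (skt (Suc k)) {} X {} id"

lemma to_chain_hom: "to_chain k \<in> hom (skel_homology k) (cellular_chain_group M k)"
  by (simp add: to_chain_def cellular_chain_group_eq hom_induced_hom)

lemma to_space_hom: "to_space k \<in> hom (skel_homology k) (homology_group (int k) X)"
  by (simp add: to_space_def hom_induced_hom)

lemma to_chain_inj: "inj_on (to_chain k) (carrier (skel_homology k))"
proof (rule inj_on_exact [OF _ _ to_chain_hom])
  show "kernel (skel_homology k) (cellular_chain_group M k) (to_chain k)
      = hom_induced (int k) (skt k) {} (skt (Suc k)) {} id ` carrier (homology_group (int k) (skt k))"
    using kernel_triple_3 [of "{}" "sk k" "int k" "skt (Suc k)"]
    by (simp add: subtopology_skeleton to_chain_def cellular_chain_group_eq)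
qed (auto simp: cellular_chain_group_eq hom_induced_hom trivial_homology_skeleton)

lemma to_chain_image_kernel:
  "to_chain k ` carrier (skel_homology k)
     = kernel (cellular_chain_group M k) (homology_group (int k - 1) (skt k)) (hom_boundary (int k) (skt (Suc k)) (sk k))"
  using kernel_triple_1 [of "{}" "sk k" "int k" "skt (Suc k)"]
  by (simp add: subtopology_skeleton to_chain_def cellular_chain_group_eq hom_relboundary_empty)

lemma cellular_boundary_eq:
  "cellular_boundary M k = to_chain k \<circ> hom_boundary (int (Suc k)) (skt (Suc (Suc k))) (sk (Suc k))"
  by (simp add: cellular_boundary_def hom_relboundary_def to_chain_def subtopology_skeleton)

lemma hom_boundary_skeleton:
  "hom_boundary (int (Suc k)) (skt (Suc (Suc k))) (sk (Suc k))
     \<in> hom (cellular_chain_group M (Suc k)) (skel_homology k)"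
  using hom_boundary_hom [of "int (Suc k)" "skt (Suc (Suc k))" "sk (Suc k)"]
  by (simp add: subtopology_skeleton cellular_chain_group_eq)

lemma to_chain_one: "to_chain k (one (skel_homology k)) = one (cellular_chain_group M k)"
  by (rule hom_one [OF to_chain_hom]) (simp_all add: cellular_chain_group_eq)

text \<open>Writing the degree as \<open>Suc m\<close> avoids truncated subtraction and makes every
  function a cycle in degree 0. Values off the \<open>k\<close>-cells are unrestricted.\<close>

definition int_cycles :: "nat \<Rightarrow> ('c \<Rightarrow> int) set" where
  "int_cycles k = {c. \<forall>m. k = Suc m \<longrightarrow> (\<forall>\<sigma>\<in>dcells m. int_bdry m c \<sigma> = 0)}"

text \<open>By exactness the image is the kernel of the connecting map into the homology of the next
  lower skeleton. For \<open>k = Suc m\<close> that group embeds into the cellular chains by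
  \<open>to_chain m\<close>, so vanishing is detected by the cellular boundary.\<close>

lemma chain_of_in_image_iff: "chain_of k c \<in> to_chain k ` carrier (skel_homology k) \<longleftrightarrow> c \<in> int_cycles k"
proof (cases k)
  case 0
  have "trivial_group (homology_group (int k - 1) (skt k))" using 0 by simp
  moreover have "hom_boundary (int k) (skt (Suc k)) (sk k) (chain_of k c) \<in> carrier (homology_group (int k - 1) (skt k))"
    using hom_boundary_carrier [of "int k" "skt (Suc k)" "sk k"] by (simp add: subtopology_skeleton)
  ultimately have "hom_boundary (int k) (skt (Suc k)) (sk k) (chain_of k c) = one (homology_group (int k - 1) (skt k))"
    by (simp add: trivial_group_def)
  then show ?thesis
    unfolding to_chain_image_kernel using 0 by (simp add: int_cycles_def kernel_def chain_of_carrier)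
next
  case (Suc m)
  let ?b = "hom_boundary (int (Suc m)) (skt (Suc (Suc m))) (sk (Suc m)) (chain_of (Suc m) c)"
  have b: "?b \<in> carrier (skel_homology m)"
    using hom_boundary_skeleton [of m] chain_of_carrier [of "Suc m" c] by (auto simp: hom_def)
  have "chain_of k c \<in> to_chain k ` carrier (skel_homology k) \<longleftrightarrow> ?b = one (skel_homology m)"
    unfolding to_chain_image_kernel using Suc chain_of_carrier by (simp add: kernel_def)
  also have "\<dots> \<longleftrightarrow> to_chain m ?b = to_chain m (one (skel_homology m))"
    using inj_on_eq_iff [OF to_chain_inj b monoid.one_closed [OF group.is_monoid [OF group_relative_homology_group]]]
    by (rule sym)
  also have "\<dots> \<longleftrightarrow> cellular_boundary M m (chain_of (Suc m) c) = chain_of m (\<lambda>_. 0)"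
    unfolding to_chain_one chain_of_zero cellular_boundary_eq by (simp only: comp_apply)
  also have "\<dots> \<longleftrightarrow> c \<in> int_cycles k"
    by (simp add: cellular_boundary_chain_of chain_of_eq_iff int_cycles_def Suc)
  finally show ?thesis .
qed

text \<open>The cellular boundary factors through \<open>to_chain k\<close>, whose image consists of
  cycles.\<close>

lemma int_bdry_cycle: "int_bdry k b \<in> int_cycles k"
proof -
  have "chain_of k (int_bdry k b) = to_chain k (hom_boundary (int (Suc k)) (skt (Suc (Suc k))) (sk (Suc k)) (chain_of (Suc k) b))"
    by (simp add: cellular_boundary_eq flip: cellular_boundary_chain_of)
  moreover have "hom_boundary (int (Suc k)) (skt (Suc (Suc k))) (sk (Suc k)) (chain_of (Suc k) b) \<in> carrier (skel_homology k)"
    using hom_boundary_skeleton [of k] chain_of_carrier [of "Suc k" b] by (auto simp: hom_def)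
  ultimately show ?thesis by (metis chain_of_in_image_iff imageI)
qed

text \<open>The previous lemma, applied to the chain that consists of \<open>\<tau>\<close>
  alone.\<close>

lemma cw_incidence_square:
  assumes "\<tau> \<in> dcells (Suc (Suc n))" "\<nu> \<in> dcells n"
  shows "(\<Sum>\<sigma>\<in>dcells (Suc n). cw_incidence M \<tau> \<sigma> * cw_incidence M \<sigma> \<nu>) = 0"
proof -
  have "int_bdry (Suc n) (\<lambda>\<rho>. if \<rho> = \<tau> then 1 else 0) \<sigma> = cw_incidence M \<tau> \<sigma>" for \<sigma>
    using assms by (simp add: int_bdry_def if_distrib [of "\<lambda>x. x * _"] finite_dcells cong: if_cong)
  then show ?thesis
    using int_bdry_cycle [of "Suc n" "\<lambda>\<rho>. if \<rho> = \<tau> then 1 else 0"] assms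
    by (simp add: int_cycles_def int_bdry_def [of n])
qed

lemma to_space_surj: "to_space k ` carrier (skel_homology k) = carrier (homology_group (int k) X)"
proof (rule surj_exact)
  show "kernel (homology_group (int k) X) (relative_homology_group (int k) X (sk (Suc k)))
        (hom_induced (int k) X {} X (sk (Suc k)) id) = to_space k ` carrier (skel_homology k)"
    using kernel_triple_3 [of "{}" "sk (Suc k)" "int k" X] by (simp add: to_space_def)
qed (auto simp: hom_induced_hom trivial_relative_homology_skeleton)

text \<open>Exactness gives the kernel as the image of the relative homology of the whole space
  modulo the \<open>k\<close>-skeleton. The \<open>(k+1)\<close>-skeleton modulo the
  \<open>k\<close>-skeleton maps onto that group, and naturality matches the two connecting
  maps.\<close>

lemma kernel_to_space:
  "kernel (skel_homology k) (homology_group (int k) X) (to_space k)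
    = hom_boundary (int (Suc k)) (skt (Suc (Suc k))) (sk (Suc k)) ` carrier (cellular_chain_group M (Suc k))"
proof -
  let ?q = "int (Suc k)" and ?e = "hom_induced (int (Suc k)) (skt (Suc (Suc k))) (sk (Suc k)) X (sk (Suc k)) id"
  let ?\<delta> = "hom_boundary (int (Suc k)) (skt (Suc (Suc k))) (sk (Suc k))"
  have e: "?e ` carrier (cellular_chain_group M (Suc k)) = carrier (relative_homology_group ?q X (sk (Suc k)))"
  proof (rule surj_exact)
    show "kernel (relative_homology_group ?q X (sk (Suc k))) (relative_homology_group ?q X (sk (Suc (Suc k))))
       (hom_induced ?q X (sk (Suc k)) X (sk (Suc (Suc k))) id) = ?e ` carrier (cellular_chain_group M (Suc k))"
      using kernel_triple_3 [of "sk (Suc k)" "sk (Suc (Suc k))" ?q X] skeleton_mono [of "Suc k" "Suc (Suc k)"]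
      by (simp add: cellular_chain_group_eq)
    show "trivial_group (relative_homology_group ?q X (sk (Suc (Suc k))))"
      by (rule trivial_relative_homology_skeleton) simp
  qed (auto simp: hom_induced_hom)
  have ker: "kernel (skel_homology k) (homology_group (int k) X) (to_space k)
     = hom_boundary ?q X (sk (Suc k)) ` carrier (relative_homology_group ?q X (sk (Suc k)))"
    using kernel_triple_2 [of "{}" "sk (Suc k)" "int k" X]
    by (simp add: to_space_def hom_relboundary_empty add_ac)
  have "hom_boundary ?q X (sk (Suc k)) (?e x) = ?\<delta> x" if "x \<in> carrier (cellular_chain_group M (Suc k))" for x
  proof -
    have "hom_boundary ?q X (sk (Suc k)) \<circ> ?e
      = hom_induced (int k) (skt (Suc k)) {} (skt (Suc k)) {} id \<circ> ?\<delta>"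
      using naturality_hom_induced [of "skt (Suc (Suc k))" X id "sk (Suc k)" "sk (Suc k)" ?q]
      by (simp add: subtopology_skeleton continuous_map_from_subtopology)
    then have "hom_boundary ?q X (sk (Suc k)) (?e x) = hom_induced (int k) (skt (Suc k)) {} (skt (Suc k)) {} id (?\<delta> x)"
      by (metis comp_apply)
    also have "\<dots> = ?\<delta> x"
      by (rule hom_induced_id) (use hom_boundary_skeleton [of k] that in \<open>auto simp: hom_def\<close>)
    finally show ?thesis .
  qed
  then show ?thesis unfolding ker e [symmetric] image_image by (rule image_cong [OF refl])
qed

text \<open>The lift along \<open>to_chain\<close> exists exactly for cycles and is then unique; for
  other functions the value is meaningless.\<close>

definition homology_class :: "nat \<Rightarrow> ('c \<Rightarrow> int) \<Rightarrow> 'a chain set" where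
  "homology_class k c = to_space k (inv_into (carrier (skel_homology k)) (to_chain k) (chain_of k c))"

lemma lift_cycle:
  assumes "c \<in> int_cycles k"
  obtains a where "a \<in> carrier (skel_homology k)" "to_chain k a = chain_of k c" "homology_class k c = to_space k a"
proof
  have im: "chain_of k c \<in> to_chain k ` carrier (skel_homology k)"
    using assms chain_of_in_image_iff by blast
  show "inv_into (carrier (skel_homology k)) (to_chain k) (chain_of k c) \<in> carrier (skel_homology k)"
    by (rule inv_into_into [OF im])
  show "to_chain k (inv_into (carrier (skel_homology k)) (to_chain k) (chain_of k c)) = chain_of k c"
    by (rule f_inv_into_f [OF im])
qed (rule homology_class_def)

lemma homology_class_eq:
  assumes "a \<in> carrier (skel_homology k)" "to_chain k a = chain_of k c"
  shows "homology_class k c = to_space k a"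
  unfolding homology_class_def assms(2) [symmetric] using inv_into_f_f [OF to_chain_inj assms(1)] by simp

lemma homology_class_carrier: "c \<in> int_cycles k \<Longrightarrow> homology_class k c \<in> carrier (homology_group (int k) X)"
  by (erule lift_cycle) (use to_space_hom in \<open>auto simp: hom_def\<close>)

lemma homology_class_surj:
  assumes "h \<in> carrier (homology_group (int k) X)"
  obtains c where "c \<in> int_cycles k" "h = homology_class k c"
proof -
  obtain a where a: "a \<in> carrier (skel_homology k)" "h = to_space k a"
    using assms to_space_surj by blast
  then have "to_chain k a \<in> carrier (cellular_chain_group M k)" using to_chain_hom by (auto simp: hom_def)
  then obtain c where "to_chain k a = chain_of k c" using chain_of_surj by blast
  moreover have "c \<in> int_cycles k"
    using a(1) calculation chain_of_in_image_iff [of k c] by (metis imageI)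
  ultimately show ?thesis using that a homology_class_eq by simp
qed

lemma homology_class_sum:
  assumes "finite J" and c: "\<And>j. j \<in> J \<Longrightarrow> c j \<in> int_cycles k"
  shows "int_comb (homology_group (int k) X) (\<lambda>j. homology_class k (c j)) J a
     = homology_class k (\<lambda>\<sigma>. \<Sum>j\<in>J. a j * c j \<sigma>)"
proof -
  have "\<exists>b. \<forall>j\<in>J. b j \<in> carrier (skel_homology k) \<and> to_chain k (b j) = chain_of k (c j) \<and>
      homology_class k (c j) = to_space k (b j)"
  proof (rule bchoice, rule ballI)
    fix j assume "j \<in> J"
    show "\<exists>a. a \<in> carrier (skel_homology k) \<and> to_chain k a = chain_of k (c j) \<and>
      homology_class k (c j) = to_space k a"
      by (rule lift_cycle [OF c [OF \<open>j \<in> J\<close>]]) blast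
  qed
  then obtain b where b: "\<And>j. j \<in> J \<Longrightarrow> b j \<in> carrier (skel_homology k)"
      "\<And>j. j \<in> J \<Longrightarrow> to_chain k (b j) = chain_of k (c j)"
      "\<And>j. j \<in> J \<Longrightarrow> homology_class k (c j) = to_space k (b j)" by blast
  have bJ: "b \<in> J \<rightarrow> carrier (skel_homology k)" using b by auto
  have ab: "comm_group (skel_homology k)" "comm_group (homology_group (int k) X)" by auto
  let ?B = "int_comb (skel_homology k) b J a"
  have B: "?B \<in> carrier (skel_homology k)" by (rule comm_group.int_comb_closed [OF ab(1) bJ])
  have "to_chain k ?B = int_comb (cellular_chain_group M k) (\<lambda>j. to_chain k (b j)) J a"
    by (rule hom_int_comb [OF ab(1) comm_group_cellular to_chain_hom bJ])
  also have "\<dots> = int_comb (cellular_chain_group M k) (\<lambda>j. chain_of k (c j)) J a"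
    by (rule int_comb_cong) (use b comm_group_cellular chain_of_carrier in auto)
  also have "\<dots> = chain_of k (\<lambda>\<sigma>. \<Sum>j\<in>J. a j * c j \<sigma>)"
    by (rule comm_group.int_comb_sum [OF comm_group_cellular cell_class_carrier assms(1), symmetric])
  finally have "homology_class k (\<lambda>\<sigma>. \<Sum>j\<in>J. a j * c j \<sigma>) = to_space k ?B"
    by (rule homology_class_eq [OF B])
  also have "\<dots> = int_comb (homology_group (int k) X) (\<lambda>j. to_space k (b j)) J a"
    by (rule hom_int_comb [OF ab to_space_hom bJ])
  also have "\<dots> = int_comb (homology_group (int k) X) (\<lambda>j. homology_class k (c j)) J a"
  proof (rule int_comb_cong)
    show "(\<lambda>j. homology_class k (c j)) \<in> J \<rightarrow> carrier (homology_group (int k) X)"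
      using c homology_class_carrier by blast
  qed (use b ab in auto)
  finally show ?thesis by (rule sym)
qed

text \<open>The lift must come from the connecting map; applying the injective
  \<open>to_chain\<close> turns this into an equation of cellular chains, tested on the
  \<open>k\<close>-cells.\<close>

lemma homology_class_eq_one_iff:
  assumes "c \<in> int_cycles k"
  shows "homology_class k c = one (homology_group (int k) X) \<longleftrightarrow> (\<exists>b. \<forall>\<sigma>\<in>dcells k. c \<sigma> = int_bdry k b \<sigma>)"
proof -
  let ?\<delta> = "hom_boundary (int (Suc k)) (skt (Suc (Suc k))) (sk (Suc k))"
  obtain a where a: "a \<in> carrier (skel_homology k)" "to_chain k a = chain_of k c" "homology_class k c = to_space k a"
    using lift_cycle [OF assms] .
  have \<delta>: "?\<delta> (chain_of (Suc k) b) \<in> carrier (skel_homology k)" for b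
    using hom_boundary_skeleton [of k] chain_of_carrier [of "Suc k" b] by (auto simp: hom_def)
  have "homology_class k c = one (homology_group (int k) X) \<longleftrightarrow> a \<in> ?\<delta> ` carrier (cellular_chain_group M (Suc k))"
    unfolding kernel_to_space [symmetric] using a by (simp add: kernel_def)
  also have "\<dots> \<longleftrightarrow> (\<exists>b. a = ?\<delta> (chain_of (Suc k) b))"
  proof
    show "a \<in> ?\<delta> ` carrier (cellular_chain_group M (Suc k)) \<Longrightarrow> \<exists>b. a = ?\<delta> (chain_of (Suc k) b)"
      using chain_of_surj [of _ "Suc k"] by (elim imageE) fastforce
    show "\<exists>b. a = ?\<delta> (chain_of (Suc k) b) \<Longrightarrow> a \<in> ?\<delta> ` carrier (cellular_chain_group M (Suc k))"
      using chain_of_carrier by (elim exE) (rule image_eqI)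
  qed
  also have "\<dots> \<longleftrightarrow> (\<exists>b. to_chain k a = to_chain k (?\<delta> (chain_of (Suc k) b)))"
    using inj_on_eq_iff [OF to_chain_inj a(1) \<delta>] by blast
  also have "\<dots> \<longleftrightarrow> (\<exists>b. chain_of k c = chain_of k (int_bdry k b))"
    unfolding a(2) cellular_boundary_chain_of [symmetric] cellular_boundary_eq comp_apply ..
  finally show ?thesis by (simp add: chain_of_eq_iff)
qed

end

section \<open>Dimensions of quotient spaces\<close>

definition indep_mod :: "'v::real_vector set \<Rightarrow> 'v set \<Rightarrow> bool" where
  "indep_mod S W \<longleftrightarrow> finite S \<and> (\<forall>c::'v \<Rightarrow> real. (\<Sum>s\<in>S. c s *\<^sub>R s) \<in> W \<longrightarrow> (\<forall>s\<in>S. c s = 0))"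

lemma indep_modD: "indep_mod S W \<Longrightarrow> (\<Sum>s\<in>S. c s *\<^sub>R s) \<in> W \<Longrightarrow> s \<in> S \<Longrightarrow> c s = 0"
  unfolding indep_mod_def by blast

text \<open>Together with the converse below, this trades independence in a quotient for
  independence next to a basis \<open>B\<close> of the subspace, where ordinary cardinality bounds
  apply.\<close>

lemma independent_Un_indep_mod:
  fixes S B :: "'v::real_vector set"
  assumes S: "indep_mod S (span B)" and B: "independent B" "finite B"
  shows "S \<inter> B = {}" "independent (S \<union> B)"
proof -
  have fin: "finite S" using S by (simp add: indep_mod_def)
  have "s \<notin> B" if "s \<in> S" for s
  proof
    assume "s \<in> B"
    have "(\<Sum>t\<in>S. (if t = s then 1 else 0) *\<^sub>R t) = (\<Sum>t\<in>S. if t = s then s else 0)"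
      by (rule sum.cong) auto
    also have "\<dots> = s" using that fin by simp
    finally have "(\<Sum>t\<in>S. (if t = s then 1 else 0) *\<^sub>R t) \<in> span B" using span_base [OF \<open>s \<in> B\<close>] by simp
    then show False using indep_modD [OF S, of "\<lambda>t. if t = s then 1 else 0" s] that by simp
  qed
  then show dis: "S \<inter> B = {}" by blast
  show "independent (S \<union> B)"
  proof (rule independent_if_scalars_zero)
    fix u v assume sum0: "(\<Sum>x\<in>S \<union> B. u x *\<^sub>R x) = 0" and v: "v \<in> S \<union> B"
    have split: "(\<Sum>x\<in>S. u x *\<^sub>R x) + (\<Sum>x\<in>B. u x *\<^sub>R x) = 0"
      using sum0 fin B dis by (simp add: sum.union_disjoint)
    then have "(\<Sum>x\<in>S. u x *\<^sub>R x) = - (\<Sum>x\<in>B. u x *\<^sub>R x)" by (simp add: eq_neg_iff_add_eq_0)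
    moreover have "- (\<Sum>x\<in>B. u x *\<^sub>R x) \<in> span B"
      by (intro span_neg span_sum span_scale span_base)
    ultimately have "(\<Sum>x\<in>S. u x *\<^sub>R x) \<in> span B" by simp
    then have uS: "\<forall>x\<in>S. u x = 0" using indep_modD [OF S, of u] by blast
    then have "(\<Sum>x\<in>B. u x *\<^sub>R x) = 0" using split by simp
    then have "\<forall>x\<in>B. u x = 0" using independentD [OF B(1,2) subset_refl, of u] by blast
    then show "u v = 0" using uS v by blast
  qed (use fin B in auto)
qed

lemma indep_mod_of_independent:
  fixes S B :: "'v::real_vector set"
  assumes "independent (S \<union> B)" "finite S" "finite B" "S \<inter> B = {}"
  shows "indep_mod S (span B)"
  unfolding indep_mod_def
proof (intro conjI allI impI ballI)
  fix c :: "'v \<Rightarrow> real" and s assume c: "(\<Sum>s\<in>S. c s *\<^sub>R s) \<in> span B" and s: "s \<in> S"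
  obtain d where d: "(\<Sum>s\<in>S. c s *\<^sub>R s) = (\<Sum>b\<in>B. d b *\<^sub>R b)"
    using c unfolding span_finite [OF assms(3)] by blast
  let ?u = "\<lambda>x. if x \<in> S then c x else - d x"
  have "(\<Sum>x\<in>S \<union> B. ?u x *\<^sub>R x) = (\<Sum>x\<in>S. ?u x *\<^sub>R x) + (\<Sum>x\<in>B. ?u x *\<^sub>R x)"
    using assms by (simp add: sum.union_disjoint)
  also have "(\<Sum>x\<in>S. ?u x *\<^sub>R x) = (\<Sum>s\<in>S. c s *\<^sub>R s)" by simp
  also have "(\<Sum>x\<in>B. ?u x *\<^sub>R x) = (\<Sum>b\<in>B. - (d b *\<^sub>R b))"
    by (rule sum.cong) (use assms in auto)
  finally have "(\<Sum>x\<in>S \<union> B. ?u x *\<^sub>R x) = 0" by (simp add: d sum_negf)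
  then have "?u s = 0"
    using independentD [OF assms(1) finite_UnI [OF assms(2,3)] subset_refl, of ?u s] s by blast
  then show "c s = 0" using s by simp
qed (rule assms)

text \<open>The ambient type of chains may be infinite-dimensional, so every dimension count carries
  a finite set \<open>C\<close> whose span contains the space.\<close>

lemma finite_basis:
  fixes V :: "'v::real_vector set"
  assumes "subspace V" "V \<subseteq> span C" "finite C"
  obtains B where "B \<subseteq> V" "finite B" "independent B" "span B = V" "card B = dim V"
proof -
  obtain B where B: "B \<subseteq> V" "independent B" "V \<subseteq> span B" "card B = dim V"
    by (rule basis_exists)
  moreover have "finite B" using independent_span_bound [OF assms(3) B(2)] B(1) assms(2) by auto
  moreover have "span B = V" using span_minimal [OF B(1) assms(1)] B(3) by blast
  ultimately show ?thesis using that by blast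
qed

lemma card_indep_mod_le:
  fixes V :: "'v::real_vector set"
  assumes V: "subspace V" "V \<subseteq> span C" "finite C" and W: "subspace W" "W \<subseteq> V"
    and S: "S \<subseteq> V" "indep_mod S W"
  shows "card S + dim W \<le> dim V"
proof -
  obtain B where B: "B \<subseteq> W" "finite B" "independent B" "span B = W" "card B = dim W"
    by (rule finite_basis [OF W(1) order_trans [OF W(2) V(2)] V(3)])
  obtain D where D: "D \<subseteq> V" "finite D" "independent D" "span D = V" "card D = dim V"
    by (rule finite_basis [OF V])
  have fin: "finite S" using S by (simp add: indep_mod_def)
  note ind = independent_Un_indep_mod [OF S(2) [folded B(4)] B(3,2)]
  have "S \<union> B \<subseteq> span D" using S B W D by auto
  then have "card (S \<union> B) \<le> card D" using independent_span_bound [OF D(2) ind(2)] by blast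
  then show ?thesis using ind(1) fin B D by (simp add: card_Un_disjoint)
qed

text \<open>The representatives can be drawn from any prescribed generating set \<open>T\<close>.
  This freedom is used later to represent real homology by integral cycles.\<close>

lemma indep_mod_extension:
  fixes V :: "'v::real_vector set"
  assumes V: "span T = V" "V \<subseteq> span C" "finite C" and W: "subspace W" "W \<subseteq> V"
  obtains S where "S \<subseteq> T" "indep_mod S W" "card S + dim W = dim V"
proof -
  obtain B where B: "B \<subseteq> W" "finite B" "independent B" "span B = W" "card B = dim W"
    by (rule finite_basis [OF W(1) order_trans [OF W(2) V(2)] V(3)])
  obtain D where D: "B \<subseteq> D" "D \<subseteq> B \<union> T" "independent D" "B \<union> T \<subseteq> span D"
    using maximal_independent_subset_extend [OF _ B(3), of "B \<union> T"] by auto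
  have "T \<subseteq> V" using V(1) span_superset by blast
  then have DV: "D \<subseteq> V" using D B W by blast
  then have fin: "finite D" using independent_span_bound [OF V(3) D(3)] V(2) by blast
  have "span T \<subseteq> span D" using D(4) by (intro span_minimal) auto
  then have "V \<subseteq> span D" using V(1) by simp
  then have dimV: "dim V = card D" using DV D(3) dim_unique by blast
  have "(D - B) \<union> B = D" "(D - B) \<inter> B = {}" using D(1) by auto
  then have "indep_mod (D - B) W"
    using indep_mod_of_independent [of "D - B" B] D(3) fin B by simp
  moreover have "card (D - B) + dim W = dim V"
    using D(1) fin B dimV card_Diff_subset [of B D] card_mono [OF fin D(1)] by simp
  moreover have "D - B \<subseteq> T" using D(2) by blast
  ultimately show ?thesis using that by blast
qed

text \<open>The supremum is a maximum: the first of the two preceding lemmas bounds the set, the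
  second attains the bound.\<close>

lemma quotient_dim_eq:
  fixes V :: "'v::real_vector set"
  assumes V: "subspace V" "V \<subseteq> span C" "finite C" and W: "subspace W" "W \<subseteq> V"
  shows "quotient_dim V W + dim W = dim V"
proof -
  let ?A = "{card S |S. finite S \<and> S \<subseteq> V \<and> (\<forall>c. (\<Sum>s\<in>S. c s *\<^sub>R s) \<in> W \<longrightarrow> (\<forall>s\<in>S. c s = 0))}"
  have "span V = V" using V(1) by simp
  then obtain S where S: "S \<subseteq> V" "indep_mod S W" "card S + dim W = dim V"
    by (rule indep_mod_extension [OF _ V(2,3) W])
  have "?A = {card S |S. S \<subseteq> V \<and> indep_mod S W}"
    unfolding indep_mod_def by (simp only: conj_ac)
  moreover have "Sup {card S |S. S \<subseteq> V \<and> indep_mod S W} = card S"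
  proof (rule cSup_eq_maximum)
    show "card S \<in> {card S |S. S \<subseteq> V \<and> indep_mod S W}" using S(1,2) by blast
    fix n assume "n \<in> {card S |S. S \<subseteq> V \<and> indep_mod S W}"
    then obtain S' where "n = card S'" "S' \<subseteq> V" "indep_mod S' W" by blast
    then show "n \<le> card S" using card_indep_mod_le [OF V W, of S'] S(3) by simp
  qed
  ultimately show ?thesis using S(3) unfolding quotient_dim_def by (simp only:)
qed

text \<open>Rank-nullity on a subspace: a maximal family that is independent modulo the kernel maps
  to a basis of the image.\<close>

lemma dim_image_kernel:
  fixes f :: "'v::real_vector \<Rightarrow> 'w::real_vector"
  assumes V: "subspace V" "V \<subseteq> span C" "finite C" and f: "linear f"
  shows "dim (f ` V) + dim {x \<in> V. f x = 0} = dim V"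
proof -
  let ?K = "{x \<in> V. f x = 0}"
  have K: "subspace ?K"
    using V(1) f by (auto simp: subspace_def linear_add linear_scale linear_0)
  have "span V = V" using V(1) by simp
  then obtain S where S: "S \<subseteq> V" "indep_mod S ?K" "card S + dim ?K = dim V"
    by (rule indep_mod_extension [OF _ V(2,3) K]) blast+
  obtain B where B: "B \<subseteq> ?K" "finite B" "independent B" "span B = ?K" "card B = dim ?K"
    by (rule finite_basis [OF K _ V(3)]) (use V(2) in blast)+
  have fin: "finite S" using S by (simp add: indep_mod_def)
  have key: "\<forall>s\<in>S. c s = 0" if "(\<Sum>s\<in>S. c s *\<^sub>R f s) = 0" for c :: "'v \<Rightarrow> real"
  proof -
    have "f (\<Sum>s\<in>S. c s *\<^sub>R s) = 0" using that f by (simp add: linear_sum linear_scale)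
    moreover have "(\<Sum>s\<in>S. c s *\<^sub>R s) \<in> V"
      using S V(1) by (intro subspace_sum subspace_scale) auto
    ultimately show ?thesis using S(2) by (simp add: indep_mod_def)
  qed
  have inj: "inj_on f S"
  proof (rule inj_onI, rule ccontr)
    fix s t assume st: "s \<in> S" "t \<in> S" "f s = f t" "s \<noteq> t"
    let ?c = "\<lambda>x. (if x = s then 1 else 0) - (if x = t then 1 else 0 :: real)"
    have "(\<Sum>x\<in>S. ?c x *\<^sub>R f x) = (\<Sum>x\<in>S. if x = s then f x else 0) - (\<Sum>x\<in>S. if x = t then f x else 0)"
      unfolding sum_subtractf [symmetric] by (rule sum.cong) (auto simp: scaleR_diff_left)
    also have "\<dots> = 0" using st fin by simp
    finally have "?c s = 0" using key [of ?c] st(1) by blast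
    then show False using st(4) by simp
  qed
  have "independent (f ` S)"
  proof (rule independent_if_scalars_zero)
    fix u y assume u: "(\<Sum>x\<in>f ` S. u x *\<^sub>R x) = 0" and y: "y \<in> f ` S"
    have "(\<Sum>s\<in>S. (u \<circ> f) s *\<^sub>R f s) = 0" using u inj by (simp add: sum.reindex)
    then show "u y = 0" using key [of "u \<circ> f"] y by auto
  qed (use fin in auto)
  moreover have "f ` S \<subseteq> f ` V" using S by blast
  moreover have "f ` V \<subseteq> span (f ` S)"
  proof -
    note ind = independent_Un_indep_mod [OF S(2) [folded B(4)] B(3,2)]
    have "S \<union> B \<subseteq> V" using S B by blast
    moreover have "card (S \<union> B) = dim V" using S B ind fin by (simp add: card_Un_disjoint)
    moreover obtain D where D: "D \<subseteq> V" "finite D" "independent D" "span D = V" "card D = dim V"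
      by (rule finite_basis [OF V])
    ultimately have "V \<subseteq> span (S \<union> B)"
    proof -
      obtain E where E: "S \<union> B \<subseteq> E" "E \<subseteq> V" "independent E" "V \<subseteq> span E"
        using maximal_independent_subset_extend [OF \<open>S \<union> B \<subseteq> V\<close> ind(2)] by blast
      have "E \<subseteq> span D" using E(2) D(4) by simp
      then have "finite E" using independent_span_bound [OF D(2) E(3)] by blast
      moreover have "card E = dim V" using dim_unique [OF E(2,4,3) refl] by simp
      ultimately have "S \<union> B = E" using card_subset_eq [OF _ E(1)] \<open>card (S \<union> B) = dim V\<close> by simp
      then show ?thesis using E(4) by simp
    qed
    then have "f ` V \<subseteq> f ` span (S \<union> B)" by blast
    also have "\<dots> = span (f ` (S \<union> B))" using f by (simp add: linear_span_image)
    also have "\<dots> \<subseteq> span (insert 0 (f ` S))"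
      using B by (intro span_mono) auto
    also have "\<dots> = span (f ` S)" by (simp add: span_insert_0)
    finally show ?thesis .
  qed
  ultimately have "dim (f ` V) = card (f ` S)" by (intro dim_unique) auto
  also have "\<dots> = card S" using inj by (simp add: card_image)
  finally show ?thesis using S by simp
qed

text \<open>Repetitions are excluded by the relation with coefficient 1 at \<open>s\<close> and -1
  at \<open>t\<close>, so the size of the family equals the size of its image.\<close>

lemma lin_indep_family:
  fixes v :: "'t \<Rightarrow> 'v::real_vector"
  assumes "finite T" and key: "\<And>c. (\<Sum>t\<in>T. c t *\<^sub>R v t) = 0 \<Longrightarrow> \<forall>t\<in>T. c t = 0"
  shows "inj_on v T" "independent (v ` T)"
proof -
  show inj: "inj_on v T"
  proof (rule inj_onI, rule ccontr)
    fix s t assume st: "s \<in> T" "t \<in> T" "v s = v t" "s \<noteq> t"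
    let ?c = "\<lambda>x. (if x = s then 1 else 0) - (if x = t then 1 else 0 :: real)"
    have "(\<Sum>x\<in>T. ?c x *\<^sub>R v x) = (\<Sum>x\<in>T. if x = s then v x else 0) - (\<Sum>x\<in>T. if x = t then v x else 0)"
      unfolding sum_subtractf [symmetric] by (rule sum.cong) (auto simp: scaleR_diff_left)
    also have "\<dots> = 0" using st assms(1) by simp
    finally have "?c s = 0" using key [of ?c] st(1) by blast
    then show False using st(4) by simp
  qed
  show "independent (v ` T)"
  proof (rule independent_if_scalars_zero)
    fix u y assume u: "(\<Sum>x\<in>v ` T. u x *\<^sub>R x) = 0" and y: "y \<in> v ` T"
    have "(\<Sum>s\<in>T. (u \<circ> v) s *\<^sub>R v s) = 0" using u inj by (simp add: sum.reindex)
    then show "u y = 0" using key [of "u \<circ> v"] y by auto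
  qed (use assms in auto)
qed

lemma lin_indep_familyD:
  fixes v :: "'t \<Rightarrow> 'v::real_vector"
  assumes "finite T" "inj_on v T" "independent (v ` T)" "(\<Sum>t\<in>T. c t *\<^sub>R v t) = 0" "t \<in> T"
  shows "c t = 0"
proof -
  let ?u = "\<lambda>y. c (inv_into T v y)"
  have "(\<Sum>y\<in>v ` T. ?u y *\<^sub>R y) = (\<Sum>t\<in>T. c t *\<^sub>R v t)"
    using assms(2) by (simp add: sum.reindex)
  then have "?u (v t) = 0"
    by (intro independentD [OF assms(3) _ subset_refl]) (use assms in auto)
  then show ?thesis using assms by simp
qed

section \<open>Ranks in Lefschetz complexes\<close>

lemma lookup_scaleR: "Poly_Mapping.lookup (r *\<^sub>R x) i = r *\<^sub>R Poly_Mapping.lookup x i"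
  for x :: "'a \<Rightarrow>\<^sub>0 'b::real_vector"
proof -
  have "finite {i. r *\<^sub>R Poly_Mapping.lookup x i \<noteq> 0}"
    by (rule finite_subset [OF _ finite_lookup [of x]]) auto
  then show ?thesis by (simp add: scaleR_poly_mapping_def Abs_poly_mapping_inverse)
qed

lemma lookup_single_scaled: "Poly_Mapping.lookup (r *\<^sub>R Poly_Mapping.single \<sigma> (1::real)) \<rho> = (if \<rho> = \<sigma> then r else 0)"
  by (simp add: lookup_scaleR lookup_single when_def)

lemma poly_mapping_expand:
  assumes "finite T" "Poly_Mapping.keys c \<subseteq> T"
  shows "c = (\<Sum>\<tau>\<in>T. Poly_Mapping.lookup c \<tau> *\<^sub>R Poly_Mapping.single \<tau> (1::real))"
proof (rule poly_mapping_eqI)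
  fix \<rho>
  have "(\<Sum>\<tau>\<in>T. if \<rho> = \<tau> then Poly_Mapping.lookup c \<tau> else 0) = Poly_Mapping.lookup c \<rho>"
    using assms by (auto simp: in_keys_iff)
  then show "Poly_Mapping.lookup c \<rho> = Poly_Mapping.lookup (\<Sum>\<tau>\<in>T. Poly_Mapping.lookup c \<tau> *\<^sub>R Poly_Mapping.single \<tau> 1) \<rho>"
    by (simp add: lookup_sum lookup_single_scaled)
qed

lemma bdry_eq_sum:
  assumes "finite T" "Poly_Mapping.keys c \<subseteq> T"
  shows "bdry K c = (\<Sum>\<tau>\<in>T. Poly_Mapping.lookup c \<tau> *\<^sub>R bdry_cell K \<tau>)"
  unfolding bdry_def by (rule sum.mono_neutral_left) (use assms in \<open>auto simp: in_keys_iff\<close>)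

lemma linear_bdry: "linear (bdry K)"
proof (rule linearI)
  fix c d :: "'a \<Rightarrow>\<^sub>0 real"
  let ?T = "Poly_Mapping.keys c \<union> Poly_Mapping.keys d"
  have "Poly_Mapping.keys (c + d) \<subseteq> ?T" by (rule Poly_Mapping.keys_add)
  then show "bdry K (c + d) = bdry K c + bdry K d"
    by (simp add: bdry_eq_sum [of ?T] lookup_add scaleR_add_left sum.distrib)
next
  fix r and c :: "'a \<Rightarrow>\<^sub>0 real"
  have "Poly_Mapping.keys (r *\<^sub>R c) \<subseteq> Poly_Mapping.keys c"
    by (auto simp: in_keys_iff lookup_scaleR)
  then show "bdry K (r *\<^sub>R c) = r *\<^sub>R bdry K c"
    by (simp add: bdry_eq_sum [of "Poly_Mapping.keys c"] lookup_scaleR scaleR_sum_right)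
qed

lemma chains_alt: "chains K k = {c. \<forall>\<tau>. \<tau> \<notin> k_cells K k \<longrightarrow> Poly_Mapping.lookup c \<tau> = 0}"
  by (auto simp: chains_def in_keys_iff)

lemma subspace_chains: "subspace (chains K k)"
  unfolding chains_alt subspace_def by (simp add: lookup_scaleR lookup_add)

lemma chains_eq_span:
  assumes "finite (k_cells K k)"
  shows "chains K k = span ((\<lambda>\<tau>. Poly_Mapping.single \<tau> 1) ` k_cells K k)" (is "_ = span ?S")
proof
  have "c \<in> span ?S" if "c \<in> chains K k" for c
  proof -
    have "c = (\<Sum>\<tau>\<in>k_cells K k. Poly_Mapping.lookup c \<tau> *\<^sub>R Poly_Mapping.single \<tau> 1)"
      by (rule poly_mapping_expand) (use assms that in \<open>auto simp: chains_def\<close>)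
    moreover have "\<dots> \<in> span ?S"
      by (intro span_sum span_scale span_base) auto
    ultimately show ?thesis by simp
  qed
  then show "chains K k \<subseteq> span ?S" by blast
  show "span ?S \<subseteq> chains K k"
    by (rule span_minimal [OF _ subspace_chains]) (auto simp: chains_def)
qed

lemma independent_singles:
  assumes "finite T"
  shows "independent ((\<lambda>\<tau>. Poly_Mapping.single \<tau> (1::real)) ` T)"
    "inj_on (\<lambda>\<tau>. Poly_Mapping.single \<tau> (1::real)) T"
proof -
  have key: "\<forall>t\<in>T. c t = 0" if "(\<Sum>\<tau>\<in>T. c \<tau> *\<^sub>R Poly_Mapping.single \<tau> (1::real)) = 0" for c
  proof
    fix t assume "t \<in> T"
    have "(\<Sum>\<tau>\<in>T. if t = \<tau> then c \<tau> else 0) = Poly_Mapping.lookup (\<Sum>\<tau>\<in>T. c \<tau> *\<^sub>R Poly_Mapping.single \<tau> (1::real)) t"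
      by (simp add: lookup_sum lookup_single_scaled)
    then show "c t = 0" using \<open>t \<in> T\<close> assms that by simp
  qed
  show "independent ((\<lambda>\<tau>. Poly_Mapping.single \<tau> (1::real)) ` T)"
    by (rule lin_indep_family(2) [OF assms key])
  show "inj_on (\<lambda>\<tau>. Poly_Mapping.single \<tau> (1::real)) T"
    by (rule lin_indep_family(1) [OF assms key])
qed

lemma dim_chains:
  assumes "finite (k_cells K k)"
  shows "dim (chains K k) = card (k_cells K k)"
proof -
  let ?f = "\<lambda>\<tau>. Poly_Mapping.single \<tau> (1::real)"
  have "dim (chains K k) = dim (?f ` k_cells K k)"
    unfolding chains_eq_span [OF assms] by (rule dim_span)
  also have "\<dots> = card (?f ` k_cells K k)"
    by (rule dim_eq_card_independent [OF independent_singles(1) [OF assms]])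
  also have "\<dots> = card (k_cells K k)"
    by (rule card_image [OF independent_singles(2) [OF assms]])
  finally show ?thesis .
qed

lemma bdry_single: "bdry K (Poly_Mapping.single \<tau> 1) = bdry_cell K \<tau>"
  by (simp add: bdry_def)

lemma boundaries_eq_span:
  assumes "finite (k_cells K (Suc k))"
  shows "boundaries K k = span (bdry_cell K ` k_cells K (Suc k))"
  unfolding boundaries_def chains_eq_span [OF assms] linear_span_image [OF linear_bdry, symmetric]
  by (simp add: image_image bdry_single)

lemma lefschetz_complexD:
  assumes "lefschetz_complex K"
  shows "finite (k_cells K k)"
    and "\<tau> \<in> cells K \<Longrightarrow> \<sigma> \<in> cells K \<Longrightarrow> incidence K \<tau> \<sigma> \<noteq> 0 \<Longrightarrow> cell_dim K \<tau> = Suc (cell_dim K \<sigma>)"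
    and "\<tau> \<in> cells K \<Longrightarrow> \<nu> \<in> cells K \<Longrightarrow>
        (\<Sum>\<sigma> | \<sigma> \<in> cells K \<and> incidence K \<tau> \<sigma> \<noteq> 0. incidence K \<tau> \<sigma> * incidence K \<sigma> \<nu>) = 0"
proof -
  show "finite (k_cells K k)" using assms unfolding lefschetz_complex_def by blast
  show "cell_dim K \<tau> = Suc (cell_dim K \<sigma>)"
    if "\<tau> \<in> cells K" "\<sigma> \<in> cells K" "incidence K \<tau> \<sigma> \<noteq> 0"
  proof -
    have "int (cell_dim K \<tau>) - int (cell_dim K \<sigma>) = 1"
      using assms that unfolding lefschetz_complex_def by blast
    then show ?thesis by linarith
  qed
  show "(\<Sum>\<sigma> | \<sigma> \<in> cells K \<and> incidence K \<tau> \<sigma> \<noteq> 0. incidence K \<tau> \<sigma> * incidence K \<sigma> \<nu>) = 0"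
    if "\<tau> \<in> cells K" "\<nu> \<in> cells K"
    using assms that unfolding lefschetz_complex_def by blast
qed

text \<open>Faces all have dimension one less, and each dimension contains finitely many cells. For
  a 0-cell the truncated difference is harmless, because there are no faces.\<close>

lemma finite_faces:
  assumes "lefschetz_complex K" "\<tau> \<in> cells K"
  shows "finite {\<sigma> \<in> cells K. incidence K \<tau> \<sigma> \<noteq> 0}"
  by (rule finite_subset [OF _ lefschetz_complexD(1) [OF assms(1), of "cell_dim K \<tau> - 1"]])
    (use lefschetz_complexD(2) [OF assms] in \<open>auto simp: k_cells_def\<close>)

lemma finite_cofaces:
  assumes "lefschetz_complex K" "\<sigma> \<in> cells K"
  shows "finite {\<tau> \<in> cells K. incidence K \<tau> \<sigma> \<noteq> 0}"
  by (rule finite_subset [OF _ lefschetz_complexD(1) [OF assms(1), of "Suc (cell_dim K \<sigma>)"]])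
    (use lefschetz_complexD(2) [OF assms(1) _ assms(2)] in \<open>auto simp: k_cells_def\<close>)

lemma lookup_bdry_cell:
  assumes "lefschetz_complex K" "\<tau> \<in> cells K"
  shows "Poly_Mapping.lookup (bdry_cell K \<tau>) \<rho> = (if \<rho> \<in> cells K then incidence K \<tau> \<rho> else 0)"
proof -
  have "Poly_Mapping.lookup (bdry_cell K \<tau>) \<rho> =
     (\<Sum>\<sigma> | \<sigma> \<in> cells K \<and> incidence K \<tau> \<sigma> \<noteq> 0. if \<rho> = \<sigma> then incidence K \<tau> \<sigma> else 0)"
    by (simp add: bdry_cell_def lookup_sum lookup_single_scaled)
  also have "\<dots> = (if \<rho> \<in> cells K then incidence K \<tau> \<rho> else 0)"
    using finite_faces [OF assms] by simp
  finally show ?thesis .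
qed

lemma bdry_cell_in_chains:
  assumes "lefschetz_complex K" "\<tau> \<in> k_cells K (Suc k)"
  shows "bdry_cell K \<tau> \<in> chains K k"
proof -
  have \<tau>: "\<tau> \<in> cells K" "cell_dim K \<tau> = Suc k" using assms(2) by (auto simp: k_cells_def)
  show ?thesis
    using lefschetz_complexD(2) [OF assms(1) \<tau>(1)] \<tau>
    by (auto simp: chains_def k_cells_def in_keys_iff lookup_bdry_cell [OF assms(1) \<tau>(1)] split: if_splits)
qed

lemma boundaries_subset_chains:
  assumes "lefschetz_complex K"
  shows "boundaries K k \<subseteq> chains K k"
  unfolding boundaries_eq_span [OF lefschetz_complexD(1) [OF assms]]
  by (rule span_minimal [OF _ subspace_chains]) (use bdry_cell_in_chains [OF assms] in blast)

lemma bdry_bdry_cell: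
  assumes K: "lefschetz_complex K" and \<tau>: "\<tau> \<in> cells K"
  shows "bdry K (bdry_cell K \<tau>) = 0"
proof -
  let ?F = "{\<sigma> \<in> cells K. incidence K \<tau> \<sigma> \<noteq> 0}"
  have "bdry K (bdry_cell K \<tau>) = (\<Sum>\<sigma>\<in>?F. Poly_Mapping.lookup (bdry_cell K \<tau>) \<sigma> *\<^sub>R bdry_cell K \<sigma>)"
    by (rule bdry_eq_sum [OF finite_faces [OF K \<tau>]])
      (auto simp: in_keys_iff lookup_bdry_cell [OF K \<tau>] split: if_splits)
  also have "\<dots> = (\<Sum>\<sigma>\<in>?F. incidence K \<tau> \<sigma> *\<^sub>R bdry_cell K \<sigma>)"
    by (rule sum.cong) (auto simp: lookup_bdry_cell [OF K \<tau>])
  also have "\<dots> = 0"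
  proof (rule poly_mapping_eqI)
    fix \<nu>
    have "Poly_Mapping.lookup (\<Sum>\<sigma>\<in>?F. incidence K \<tau> \<sigma> *\<^sub>R bdry_cell K \<sigma>) \<nu>
       = (\<Sum>\<sigma>\<in>?F. incidence K \<tau> \<sigma> * (if \<nu> \<in> cells K then incidence K \<sigma> \<nu> else 0))"
      unfolding lookup_sum by (rule sum.cong) (auto simp: lookup_scaleR lookup_bdry_cell [OF K])
    then show "Poly_Mapping.lookup (\<Sum>\<sigma>\<in>?F. incidence K \<tau> \<sigma> *\<^sub>R bdry_cell K \<sigma>) \<nu> = Poly_Mapping.lookup 0 \<nu>"
      using lefschetz_complexD(3) [OF K \<tau>, of \<nu>] by (cases "\<nu> \<in> cells K") auto
  qed
  finally show ?thesis .
qed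

lemma boundaries_subset_cycles:
  assumes "lefschetz_complex K"
  shows "boundaries K k \<subseteq> cycles K k"
proof -
  have "linear (bdry K)" by (rule linear_bdry)
  then have "subspace {c. bdry K c = 0}" by (rule linear_subspace_kernel)
  then have "boundaries K k \<subseteq> {c. bdry K c = 0}"
    unfolding boundaries_eq_span [OF lefschetz_complexD(1) [OF assms]]
    by (rule span_minimal [rotated]) (use bdry_bdry_cell [OF assms] in \<open>auto simp: k_cells_def\<close>)
  then show ?thesis using boundaries_subset_chains [OF assms, of k] by (auto simp: cycles_def)
qed

lemma subspace_cycles: "subspace (cycles K k)"
proof -
  have "cycles K k = chains K k \<inter> {c. bdry K c = 0}" by (auto simp: cycles_def)
  then show ?thesis
    using subspace_inter [OF subspace_chains linear_subspace_kernel [OF linear_bdry]] by simp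
qed

lemma subspace_boundaries: "subspace (boundaries K k)"
  unfolding boundaries_def by (rule linear_subspace_image [OF linear_bdry subspace_chains])

text \<open>The rank of boundaries one degree lower, with value 0 standing for degree -1.\<close>

definition rank_B_below :: "'c lefschetz \<Rightarrow> nat \<Rightarrow> nat" where
  "rank_B_below K k = (case k of 0 \<Rightarrow> 0 | Suc m \<Rightarrow> rank_B K m)"

lemma rank_H_cycles:
  assumes "lefschetz_complex K"
  shows "rank_H K k + rank_B K k = dim (cycles K k)"
  unfolding rank_H_def rank_B_def
proof (rule quotient_dim_eq)
  show "cycles K k \<subseteq> span ((\<lambda>\<tau>. Poly_Mapping.single \<tau> 1) ` k_cells K k)"
    unfolding chains_eq_span [OF lefschetz_complexD(1) [OF assms], symmetric] by (auto simp: cycles_def)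
  show "finite ((\<lambda>\<tau>. Poly_Mapping.single \<tau> (1::real)) ` k_cells K k)"
    using lefschetz_complexD(1) [OF assms] by blast
qed (rule subspace_cycles subspace_boundaries boundaries_subset_cycles [OF assms])+

lemma rank_H_eq:
  assumes "lefschetz_complex K"
  shows "rank_H K k + rank_B K k + rank_B_below K k = card (k_cells K k)"
proof -
  note fin = lefschetz_complexD(1) [OF assms]
  have "dim (bdry K ` chains K k) + dim (cycles K k) = dim (chains K k)"
    unfolding cycles_def
    by (rule dim_image_kernel [OF subspace_chains _ _ linear_bdry])
      (use chains_eq_span [OF fin, of k] fin in auto)
  moreover have "dim (bdry K ` chains K k) = rank_B_below K k"
  proof (cases k)
    case 0
    have "bdry_cell K \<tau> = 0" if "\<tau> \<in> k_cells K k" for \<tau>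
    proof -
      have \<tau>: "\<tau> \<in> cells K" "cell_dim K \<tau> = 0" using that 0 by (auto simp: k_cells_def)
      then show ?thesis
        using lefschetz_complexD(2) [OF assms \<tau>(1)]
        by (intro poly_mapping_eqI) (auto simp: lookup_bdry_cell [OF assms])
    qed
    then have "bdry K c = 0" if "c \<in> chains K k" for c
      using that bdry_eq_sum [OF fin [of k], of c K] by (auto simp: chains_def)
    then have "bdry K ` chains K k \<subseteq> {0}" by blast
    then have "dim (bdry K ` chains K k) = 0" by (intro dim_unique [of "{}"]) (auto simp: independent_empty)
    then show ?thesis by (simp add: rank_B_below_def 0)
  next
    case (Suc m)
    then show ?thesis by (simp add: rank_B_below_def rank_B_def boundaries_def)
  qed
  ultimately show ?thesis
    using rank_H_cycles [OF assms, of k] dim_chains [OF fin, of k] by simp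
qed

section \<open>Discrete Morse-Bott functions\<close>

lemma sum_lookup_bdry_cells:
  assumes "lefschetz_complex K" "T \<subseteq> cells K"
  shows "Poly_Mapping.lookup (\<Sum>\<tau>\<in>T. a \<tau> *\<^sub>R bdry_cell K \<tau>) \<rho>
     = (\<Sum>\<tau>\<in>T. a \<tau> * (if \<rho> \<in> cells K then incidence K \<tau> \<rho> else 0))"
  unfolding lookup_sum
  by (rule sum.cong [OF refl]) (use assms in \<open>simp add: lookup_scaleR lookup_bdry_cell subset_iff\<close>)

locale morse_bott =
  fixes K :: "'c lefschetz" and f :: "'c \<Rightarrow> real"
  assumes lefschetz: "lefschetz_complex K"
    and morse_bott: "discrete_morse_bott K f"
begin

abbreviation "w \<equiv> incidence K"
abbreviation "W \<equiv> weakly_critical_complex K f"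

lemma U_eq_0_iff:
  assumes "\<sigma> \<in> cells K"
  shows "U_snc K f \<sigma> = 0 \<longleftrightarrow> (\<forall>\<tau>\<in>cells K. w \<tau> \<sigma> \<noteq> 0 \<longrightarrow> f \<sigma> \<le> f \<tau>)"
proof -
  have "finite {\<tau> \<in> cells K. w \<tau> \<sigma> \<noteq> 0 \<and> f \<sigma> > f \<tau>}"
    by (rule finite_subset [OF _ finite_cofaces [OF lefschetz assms]]) blast
  then show ?thesis by (auto simp: U_snc_def not_less)
qed

lemma D_eq_0_iff:
  assumes "\<sigma> \<in> cells K"
  shows "D_snc K f \<sigma> = 0 \<longleftrightarrow> (\<forall>\<nu>\<in>cells K. w \<sigma> \<nu> \<noteq> 0 \<longrightarrow> f \<nu> \<le> f \<sigma>)"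
proof -
  have "finite {\<nu> \<in> cells K. w \<sigma> \<nu> \<noteq> 0 \<and> f \<sigma> < f \<nu>}"
    by (rule finite_subset [OF _ finite_faces [OF lefschetz assms]]) blast
  then show ?thesis by (auto simp: D_snc_def not_less)
qed

lemma U_unique:
  assumes "\<sigma> \<in> cells K" "\<tau> \<in> cells K" "\<tau>' \<in> cells K" "w \<tau> \<sigma> \<noteq> 0" "w \<tau>' \<sigma> \<noteq> 0" "f \<tau> < f \<sigma>" "f \<tau>' < f \<sigma>"
  shows "\<tau> = \<tau>'"
proof -
  have "finite {\<tau> \<in> cells K. w \<tau> \<sigma> \<noteq> 0 \<and> f \<sigma> > f \<tau>}"
    by (rule finite_subset [OF _ finite_cofaces [OF lefschetz assms(1)]]) blast
  moreover have "card {\<tau> \<in> cells K. w \<tau> \<sigma> \<noteq> 0 \<and> f \<sigma> > f \<tau>} \<le> Suc 0"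
    using morse_bott assms(1) by (simp add: discrete_morse_bott_def U_snc_def)
  ultimately have "\<forall>x\<in>{\<tau> \<in> cells K. w \<tau> \<sigma> \<noteq> 0 \<and> f \<sigma> > f \<tau>}. \<forall>y\<in>{\<tau> \<in> cells K. w \<tau> \<sigma> \<noteq> 0 \<and> f \<sigma> > f \<tau>}. x = y"
    using card_le_Suc0_iff_eq by blast
  then show ?thesis using assms by blast
qed

lemma D_unique:
  assumes "\<sigma> \<in> cells K" "\<nu> \<in> cells K" "\<nu>' \<in> cells K" "w \<sigma> \<nu> \<noteq> 0" "w \<sigma> \<nu>' \<noteq> 0" "f \<sigma> < f \<nu>" "f \<sigma> < f \<nu>'"
  shows "\<nu> = \<nu>'"
proof -
  have "finite {\<nu> \<in> cells K. w \<sigma> \<nu> \<noteq> 0 \<and> f \<sigma> < f \<nu>}"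
    by (rule finite_subset [OF _ finite_faces [OF lefschetz assms(1)]]) blast
  moreover have "card {\<nu> \<in> cells K. w \<sigma> \<nu> \<noteq> 0 \<and> f \<sigma> < f \<nu>} \<le> Suc 0"
    using morse_bott assms(1) by (simp add: discrete_morse_bott_def D_snc_def)
  ultimately have "\<forall>x\<in>{\<nu> \<in> cells K. w \<sigma> \<nu> \<noteq> 0 \<and> f \<sigma> < f \<nu>}. \<forall>y\<in>{\<nu> \<in> cells K. w \<sigma> \<nu> \<noteq> 0 \<and> f \<sigma> < f \<nu>}. x = y"
    using card_le_Suc0_iff_eq by blast
  then show ?thesis using assms by blast
qed

text \<open>The terms of \<open>\<partial>\<partial> = 0\<close> cannot cancel if only one of them is nonzero.\<close>
lemma other_intermediate:
  assumes "\<tau> \<in> cells K" "\<sigma> \<in> cells K" "\<nu> \<in> cells K" "w \<tau> \<sigma> \<noteq> 0" "w \<sigma> \<nu> \<noteq> 0"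
  obtains \<sigma>' where "\<sigma>' \<in> cells K" "\<sigma>' \<noteq> \<sigma>" "w \<tau> \<sigma>' \<noteq> 0" "w \<sigma>' \<nu> \<noteq> 0"
proof (rule ccontr)
  assume nt: "\<not> thesis"
  note found = that
  have no: "w \<tau> \<sigma>' * w \<sigma>' \<nu> = 0" if "\<sigma>' \<in> cells K" "\<sigma>' \<noteq> \<sigma>" for \<sigma>'
    using found [OF that] nt by auto
  let ?F = "{\<sigma> \<in> cells K. w \<tau> \<sigma> \<noteq> 0}"
  have "(\<Sum>\<rho>\<in>?F. w \<tau> \<rho> * w \<rho> \<nu>) = w \<tau> \<sigma> * w \<sigma> \<nu> + (\<Sum>\<rho>\<in>?F - {\<sigma>}. w \<tau> \<rho> * w \<rho> \<nu>)"
    by (rule sum.remove) (use finite_faces [OF lefschetz assms(1)] assms in auto)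
  also have "(\<Sum>\<rho>\<in>?F - {\<sigma>}. w \<tau> \<rho> * w \<rho> \<nu>) = 0"
    by (rule sum.neutral) (use no in blast)
  finally show False
    using lefschetz_complexD(3) [OF lefschetz assms(1,3)] assms(4,5) by simp
qed

text \<open>Suppose values strictly increase down \<open>\<tau>\<close>, \<open>\<sigma>\<close>,
  \<open>\<nu>\<close>. A second intermediate cell must have value at most \<open>f \<tau>\<close>,
  as \<open>\<tau>\<close> already has a larger face, and at least \<open>f \<nu>\<close>, as
  \<open>\<nu>\<close> already has a smaller coface. But \<open>f \<tau> < f \<nu>\<close>.\<close>

lemma U_D_exclusive:
  assumes \<sigma>: "\<sigma> \<in> cells K" and "U_snc K f \<sigma> \<noteq> 0"
  shows "D_snc K f \<sigma> = 0"
proof (rule ccontr)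
  assume "D_snc K f \<sigma> \<noteq> 0"
  then obtain \<nu> where \<nu>: "\<nu> \<in> cells K" "w \<sigma> \<nu> \<noteq> 0" "f \<sigma> < f \<nu>"
    using D_eq_0_iff [OF \<sigma>] by (auto simp: not_le)
  obtain \<tau> where \<tau>: "\<tau> \<in> cells K" "w \<tau> \<sigma> \<noteq> 0" "f \<tau> < f \<sigma>"
    using U_eq_0_iff [OF \<sigma>] assms(2) by (auto simp: not_le)
  obtain \<sigma>' where \<sigma>': "\<sigma>' \<in> cells K" "\<sigma>' \<noteq> \<sigma>" "w \<tau> \<sigma>' \<noteq> 0" "w \<sigma>' \<nu> \<noteq> 0"
    by (rule other_intermediate [OF \<tau>(1) \<sigma> \<nu>(1) \<tau>(2) \<nu>(2)])
  have "\<not> f \<tau> < f \<sigma>'" using D_unique [OF \<tau>(1) \<sigma> \<sigma>'(1) \<tau>(2) \<sigma>'(3) \<tau>(3)] \<sigma>'(2) by blast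
  moreover have "\<not> f \<sigma>' < f \<nu>" using U_unique [OF \<nu>(1) \<sigma> \<sigma>'(1) \<nu>(2) \<sigma>'(4) \<nu>(3)] \<sigma>'(2) by blast
  ultimately show False using \<tau>(3) \<nu>(3) by linarith
qed

section \<open>The weakly critical complex and the matching of the other cells\<close>

lemma cells_W: "cells W = {\<sigma> \<in> cells K. U_snc K f \<sigma> = 0 \<and> D_snc K f \<sigma> = 0}"
  and dim_W: "cell_dim W = cell_dim K"
  and incidence_W: "incidence W \<tau> \<sigma> = (if f \<tau> = f \<sigma> then w \<tau> \<sigma> else 0)"
  by (auto simp: weakly_critical_complex_def)

lemma cells_W_subset: "cells W \<subseteq> cells K"
  by (auto simp: cells_W)

lemma k_cells_W: "k_cells W k = {\<sigma> \<in> k_cells K k. U_snc K f \<sigma> = 0 \<and> D_snc K f \<sigma> = 0}"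
  by (auto simp: k_cells_def cells_W dim_W)

text \<open>No nonzero term of (L2) between cells of one level is lost on passing to
  \<open>W\<close>. The value of \<open>\<sigma>\<close> is squeezed between equal values. If a
  coface \<open>\<tau>'\<close> lay below \<open>\<sigma>\<close>, a second cell between
  \<open>\<tau>'\<close> and \<open>\<nu>\<close> would have value at least
  \<open>f \<nu> = f \<sigma>\<close> and be another larger face of \<open>\<tau>'\<close>; the case
  of a larger face of \<open>\<sigma>\<close> is dual.\<close>

lemma intermediate_critical:
  assumes \<tau>: "\<tau> \<in> cells W" and \<nu>: "\<nu> \<in> cells W" and eq: "f \<tau> = f \<nu>"
    and \<sigma>: "\<sigma> \<in> cells K" "w \<tau> \<sigma> \<noteq> 0" "w \<sigma> \<nu> \<noteq> 0"
  shows "\<sigma> \<in> cells W" "f \<sigma> = f \<tau>"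
proof -
  have K: "\<tau> \<in> cells K" "\<nu> \<in> cells K" using \<tau> \<nu> by (auto simp: cells_W)
  have "f \<sigma> \<le> f \<tau>" using D_eq_0_iff [OF K(1)] \<tau> \<sigma> by (auto simp: cells_W)
  moreover have "f \<nu> \<le> f \<sigma>" using U_eq_0_iff [OF K(2)] \<nu> \<sigma> by (auto simp: cells_W)
  ultimately show feq: "f \<sigma> = f \<tau>" using eq by simp
  have "U_snc K f \<sigma> = 0"
  proof (rule ccontr)
    assume "U_snc K f \<sigma> \<noteq> 0"
    then obtain \<tau>' where \<tau>': "\<tau>' \<in> cells K" "w \<tau>' \<sigma> \<noteq> 0" "f \<tau>' < f \<sigma>"
      using U_eq_0_iff [OF \<sigma>(1)] by (auto simp: not_le)
    obtain \<sigma>' where \<sigma>': "\<sigma>' \<in> cells K" "\<sigma>' \<noteq> \<sigma>" "w \<tau>' \<sigma>' \<noteq> 0" "w \<sigma>' \<nu> \<noteq> 0"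
      by (rule other_intermediate [OF \<tau>'(1) \<sigma>(1) K(2) \<tau>'(2) \<sigma>(3)])
    have "f \<nu> \<le> f \<sigma>'" using U_eq_0_iff [OF K(2)] \<nu> \<sigma>' by (auto simp: cells_W)
    then have "f \<tau>' < f \<sigma>'" using \<tau>'(3) feq eq by linarith
    then show False using D_unique [OF \<tau>'(1) \<sigma>(1) \<sigma>'(1) \<tau>'(2) \<sigma>'(3) \<tau>'(3)] \<sigma>'(2) by blast
  qed
  moreover have "D_snc K f \<sigma> = 0"
  proof (rule ccontr)
    assume "D_snc K f \<sigma> \<noteq> 0"
    then obtain \<nu>' where \<nu>': "\<nu>' \<in> cells K" "w \<sigma> \<nu>' \<noteq> 0" "f \<sigma> < f \<nu>'"
      using D_eq_0_iff [OF \<sigma>(1)] by (auto simp: not_le)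
    obtain \<sigma>' where \<sigma>': "\<sigma>' \<in> cells K" "\<sigma>' \<noteq> \<sigma>" "w \<tau> \<sigma>' \<noteq> 0" "w \<sigma>' \<nu>' \<noteq> 0"
      by (rule other_intermediate [OF K(1) \<sigma>(1) \<nu>'(1) \<sigma>(2) \<nu>'(2)])
    have "f \<sigma>' \<le> f \<tau>" using D_eq_0_iff [OF K(1)] \<tau> \<sigma>' by (auto simp: cells_W)
    then have "f \<sigma>' < f \<nu>'" using \<nu>'(3) feq eq by linarith
    then show False using U_unique [OF \<nu>'(1) \<sigma>(1) \<sigma>'(1) \<nu>'(2) \<sigma>'(4) \<nu>'(3)] \<sigma>'(2) by blast
  qed
  ultimately show "\<sigma> \<in> cells W" using \<sigma> by (simp add: cells_W)
qed

lemma lefschetz_W: "lefschetz_complex W"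
  unfolding lefschetz_complex_def
proof (intro conjI allI ballI impI)
  fix k show "finite (k_cells W k)"
    by (rule finite_subset [OF _ lefschetz_complexD(1) [OF lefschetz]]) (auto simp: k_cells_W)
next
  fix \<tau> \<sigma> assume "\<tau> \<in> cells W" "\<sigma> \<in> cells W" "incidence W \<tau> \<sigma> \<noteq> 0"
  then show "int (cell_dim W \<tau>) - int (cell_dim W \<sigma>) = 1"
    using lefschetz_complexD(2) [OF lefschetz, of \<tau> \<sigma>] subsetD [OF cells_W_subset]
    by (auto simp: dim_W incidence_W split: if_splits)
next
  fix \<tau> \<nu> assume \<tau>: "\<tau> \<in> cells W" and \<nu>: "\<nu> \<in> cells W"
  then have K: "\<tau> \<in> cells K" "\<nu> \<in> cells K" using cells_W_subset by auto
  show "(\<Sum>\<sigma> | \<sigma> \<in> cells W \<and> incidence W \<tau> \<sigma> \<noteq> 0. incidence W \<tau> \<sigma> * incidence W \<sigma> \<nu>) = 0"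
  proof (cases "f \<tau> = f \<nu>")
    case True
    have "(\<Sum>\<sigma> | \<sigma> \<in> cells W \<and> incidence W \<tau> \<sigma> \<noteq> 0. incidence W \<tau> \<sigma> * incidence W \<sigma> \<nu>)
       = (\<Sum>\<sigma> | \<sigma> \<in> cells K \<and> w \<tau> \<sigma> \<noteq> 0. w \<tau> \<sigma> * w \<sigma> \<nu>)"
    proof (rule sum.mono_neutral_cong_left)
      show "finite {\<sigma> \<in> cells K. w \<tau> \<sigma> \<noteq> 0}" by (rule finite_faces [OF lefschetz K(1)])
      show "{\<sigma> \<in> cells W. incidence W \<tau> \<sigma> \<noteq> 0} \<subseteq> {\<sigma> \<in> cells K. w \<tau> \<sigma> \<noteq> 0}"
        using cells_W_subset by (auto simp: incidence_W split: if_splits)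
      show "\<forall>\<sigma>\<in>{\<sigma> \<in> cells K. w \<tau> \<sigma> \<noteq> 0} - {\<sigma> \<in> cells W. incidence W \<tau> \<sigma> \<noteq> 0}. w \<tau> \<sigma> * w \<sigma> \<nu> = 0"
      proof (intro ballI, rule ccontr)
        fix \<sigma> assume \<sigma>: "\<sigma> \<in> {\<sigma> \<in> cells K. w \<tau> \<sigma> \<noteq> 0} - {\<sigma> \<in> cells W. incidence W \<tau> \<sigma> \<noteq> 0}"
          and nz: "w \<tau> \<sigma> * w \<sigma> \<nu> \<noteq> 0"
        have "\<sigma> \<in> cells K" "w \<tau> \<sigma> \<noteq> 0" "w \<sigma> \<nu> \<noteq> 0" using \<sigma> nz by auto
        from intermediate_critical [OF \<tau> \<nu> True this] \<sigma> show False by (auto simp: incidence_W)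
      qed
      fix \<sigma> assume "\<sigma> \<in> {\<sigma> \<in> cells W. incidence W \<tau> \<sigma> \<noteq> 0}"
      then show "incidence W \<tau> \<sigma> * incidence W \<sigma> \<nu> = w \<tau> \<sigma> * w \<sigma> \<nu>"
        using True by (auto simp: incidence_W split: if_splits)
    qed
    then show ?thesis using lefschetz_complexD(3) [OF lefschetz K] by simp
  next
    \<comment> \<open>A nonzero term would need \<open>f \<tau> = f \<sigma>\<close> and
      \<open>f \<sigma> = f \<nu>\<close>.\<close>
    case False
    then show ?thesis by (intro sum.neutral) (auto simp: incidence_W split: if_splits)
  qed
qed

lemma card_k_cells: "card (k_cells K k) = card (k_cells W k) + d_snc K f k + d_snc K f (Suc k)"
proof -
  let ?U = "{\<sigma> \<in> k_cells K k. U_snc K f \<sigma> \<noteq> 0}" and ?D = "{\<sigma> \<in> k_cells K k. D_snc K f \<sigma> = 1}"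
  let ?D' = "{\<tau> \<in> k_cells K (Suc k). D_snc K f \<tau> = 1}"
  \<comment> \<open>The pairs of the matching. \<open>D_unique\<close> makes the first projection
    injective, \<open>U_unique\<close> the second.\<close>
  let ?P = "{(\<tau>, \<sigma>). \<tau> \<in> k_cells K (Suc k) \<and> \<sigma> \<in> k_cells K k \<and> w \<tau> \<sigma> \<noteq> 0 \<and> f \<tau> < f \<sigma>}"
  note fin = lefschetz_complexD(1) [OF lefschetz]
  have D1: "D_snc K f \<sigma> = 1 \<longleftrightarrow> D_snc K f \<sigma> \<noteq> 0" if "\<sigma> \<in> cells K" for \<sigma>
    using morse_bott that by (auto simp: discrete_morse_bott_def le_Suc_eq)
  have cells: "\<sigma> \<in> k_cells K j \<Longrightarrow> \<sigma> \<in> cells K" for \<sigma> j by (simp add: k_cells_def)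
  have P: "(\<tau>, \<sigma>) \<in> ?P \<longleftrightarrow> \<tau> \<in> cells K \<and> \<sigma> \<in> cells K \<and> cell_dim K \<sigma> = k \<and> w \<tau> \<sigma> \<noteq> 0 \<and> f \<tau> < f \<sigma>" for \<tau> \<sigma>
    using lefschetz_complexD(2) [OF lefschetz, of \<tau> \<sigma>] by (auto simp: k_cells_def)
  have inj1: "inj_on fst ?P"
  proof (rule inj_onI)
    fix p q assume pq: "p \<in> ?P" "q \<in> ?P" "fst p = fst q"
    obtain \<tau> \<sigma> \<sigma>' where eq: "p = (\<tau>, \<sigma>)" "q = (\<tau>, \<sigma>')"
      using pq(3) by (cases p; cases q) simp
    show "p = q" using D_unique [of \<tau> \<sigma> \<sigma>'] pq(1,2) unfolding eq P by blast
  qed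
  have im1: "fst ` ?P = ?D'"
  proof
    show "fst ` ?P \<subseteq> ?D'"
    proof
      fix \<tau> assume "\<tau> \<in> fst ` ?P"
      then obtain p where "p \<in> ?P" "\<tau> = fst p" by blast
      then obtain \<sigma> where "(\<tau>, \<sigma>) \<in> ?P" by (cases p) auto
      then have \<tau>: "\<tau> \<in> cells K" "\<sigma> \<in> cells K" "w \<tau> \<sigma> \<noteq> 0" "\<not> f \<sigma> \<le> f \<tau>" "\<tau> \<in> k_cells K (Suc k)"
        by (auto simp: k_cells_def)
      then have "D_snc K f \<tau> \<noteq> 0" using D_eq_0_iff by blast
      then show "\<tau> \<in> ?D'" using D1 \<tau> by simp
    qed
    show "?D' \<subseteq> fst ` ?P"
    proof
      fix \<tau> assume \<tau>: "\<tau> \<in> ?D'"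
      then have \<tau>K: "\<tau> \<in> cells K" using cells by blast
      have "D_snc K f \<tau> \<noteq> 0" using \<tau> by simp
      then obtain \<sigma> where \<sigma>: "\<sigma> \<in> cells K" "w \<tau> \<sigma> \<noteq> 0" "f \<tau> < f \<sigma>"
        using D_eq_0_iff [OF \<tau>K] by (auto simp: not_le)
      then have "\<sigma> \<in> k_cells K k"
        using lefschetz_complexD(2) [OF lefschetz \<tau>K \<sigma>(1,2)] \<tau> by (simp add: k_cells_def)
      then have "(\<tau>, \<sigma>) \<in> ?P" using \<tau> \<sigma> by simp
      then show "\<tau> \<in> fst ` ?P" by (rule rev_image_eqI) simp
    qed
  qed
  have 1: "card ?P = card ?D'" using card_image [OF inj1] unfolding im1 by (rule sym)
  have inj2: "inj_on snd ?P"
  proof (rule inj_onI)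
    fix p q assume pq: "p \<in> ?P" "q \<in> ?P" "snd p = snd q"
    obtain \<tau> \<tau>' \<sigma> where eq: "p = (\<tau>, \<sigma>)" "q = (\<tau>', \<sigma>)"
      using pq(3) by (cases p; cases q) simp
    show "p = q" using U_unique [of \<sigma> \<tau> \<tau>'] pq(1,2) unfolding eq P by blast
  qed
  have im2: "snd ` ?P = ?U"
  proof
    show "snd ` ?P \<subseteq> ?U"
    proof
      fix \<sigma> assume "\<sigma> \<in> snd ` ?P"
      then obtain p where "p \<in> ?P" "\<sigma> = snd p" by blast
      then obtain \<tau> where "(\<tau>, \<sigma>) \<in> ?P" by (cases p) auto
      then have \<sigma>: "\<tau> \<in> cells K" "\<sigma> \<in> cells K" "w \<tau> \<sigma> \<noteq> 0" "\<not> f \<sigma> \<le> f \<tau>" "\<sigma> \<in> k_cells K k"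
        by (auto simp: k_cells_def)
      then have "U_snc K f \<sigma> \<noteq> 0" using U_eq_0_iff by blast
      then show "\<sigma> \<in> ?U" using \<sigma> by simp
    qed
    show "?U \<subseteq> snd ` ?P"
    proof
      fix \<sigma> assume \<sigma>: "\<sigma> \<in> ?U"
      then have \<sigma>K: "\<sigma> \<in> cells K" using cells by blast
      obtain \<tau> where \<tau>: "\<tau> \<in> cells K" "w \<tau> \<sigma> \<noteq> 0" "f \<tau> < f \<sigma>"
        using U_eq_0_iff [OF \<sigma>K] \<sigma> by (auto simp: not_le)
      then have "\<tau> \<in> k_cells K (Suc k)"
        using lefschetz_complexD(2) [OF lefschetz \<tau>(1) \<sigma>K \<tau>(2)] \<sigma> by (simp add: k_cells_def)
      then have "(\<tau>, \<sigma>) \<in> ?P" using \<tau> \<sigma> by simp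
      then show "\<sigma> \<in> snd ` ?P" by (rule rev_image_eqI) simp
    qed
  qed
  have 2: "card ?P = card ?U" using card_image [OF inj2] unfolding im2 by (rule sym)
  have split: "k_cells K k = k_cells W k \<union> (?D \<union> ?U)"
    using D1 cells by (auto simp: k_cells_W)
  have dis: "?D \<inter> ?U = {}" "k_cells W k \<inter> (?D \<union> ?U) = {}"
    using U_D_exclusive cells by (auto simp: k_cells_W)
  have finW: "finite (k_cells W k)" and finDU: "finite ?D" "finite ?U"
    using fin [of k] by (auto simp: k_cells_W)
  have "card (k_cells K k) = card (k_cells W k) + (card ?D + card ?U)"
    using card_Un_disjoint [OF finW _ dis(2)] card_Un_disjoint [OF finDU dis(1)] finDU split by simp
  then show ?thesis using 1 2 by (simp add: d_snc_def)
qed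

text \<open>
  Order the cells by their values: in a vanishing linear combination of boundaries, the paired
  cells of the largest occurring value drop out because no other boundary of that combination
  reaches their partners, and what remains at this value is a combination of boundaries in \<open>W\<close>.
\<close>
lemma rank_B_ge: "d_snc K f (Suc k) + rank_B W k \<le> rank_B K k"
proof -
  note fin = lefschetz_complexD(1) [OF lefschetz]
  note finW = lefschetz_complexD(1) [OF lefschetz_W]
  let ?D = "{\<tau> \<in> k_cells K (Suc k). D_snc K f \<tau> = 1}"
  \<comment> \<open>A basis of the boundaries of \<open>W\<close>, consisting of boundaries of
    single critical cells; \<open>S\<close> collects one such cell for each basis vector.\<close>
  obtain B where B: "B \<subseteq> bdry_cell W ` k_cells W (Suc k)" "independent B"
      "bdry_cell W ` k_cells W (Suc k) \<subseteq> span B" "card B = dim (bdry_cell W ` k_cells W (Suc k))"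
    by (rule basis_exists)
  obtain S where S: "S \<subseteq> k_cells W (Suc k)" "inj_on (bdry_cell W) S" "B = bdry_cell W ` S"
    using B(1) subset_image_inj by metis
  have finS: "finite S" using S(1) finW finite_subset by blast
  have cardS: "card S = rank_B W k"
    using S B(4) by (simp add: rank_B_def boundaries_eq_span [OF finW] card_image)
  have SK: "S \<subseteq> k_cells K (Suc k)" using S(1) by (auto simp: k_cells_W)
  have Scrit: "\<And>\<tau>. \<tau> \<in> S \<Longrightarrow> \<tau> \<in> cells W" using S(1) by (auto simp: k_cells_def)
  have dis: "?D \<inter> S = {}" using S(1) by (auto simp: k_cells_W)
  let ?T = "?D \<union> S"
  have finT: "finite ?T" using fin finS by simp
  have TK: "?T \<subseteq> k_cells K (Suc k)" using SK by blast
  then have Tc: "?T \<subseteq> cells K" by (auto simp: k_cells_def)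
  have key: "\<forall>t\<in>?T. a t = 0" if sum0: "(\<Sum>\<tau>\<in>?T. a \<tau> *\<^sub>R bdry_cell K \<tau>) = 0" for a
  proof (rule ccontr)
    assume "\<not> (\<forall>t\<in>?T. a t = 0)"
    then have ne: "{t \<in> ?T. a t \<noteq> 0} \<noteq> {}" by blast
    define r where "r = Max (f ` {t \<in> ?T. a t \<noteq> 0})"
    have finN: "finite {t \<in> ?T. a t \<noteq> 0}" using finT by simp
    have r_max: "f t \<le> r" if "t \<in> ?T" "a t \<noteq> 0" for t
      unfolding r_def using that finN by (intro Max_ge) auto
    have "r \<in> f ` {t \<in> ?T. a t \<noteq> 0}"
      unfolding r_def using ne finN by (intro Max_in) auto
    then obtain t0 where t0: "t0 \<in> ?T" "a t0 \<noteq> 0" "f t0 = r" by blast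
    have coord: "(\<Sum>\<tau>\<in>?T. a \<tau> * w \<tau> \<sigma>) = 0" if "\<sigma> \<in> cells K" for \<sigma>
    proof -
      have "(\<Sum>\<tau>\<in>?T. a \<tau> * w \<tau> \<sigma>) = Poly_Mapping.lookup (\<Sum>\<tau>\<in>?T. a \<tau> *\<^sub>R bdry_cell K \<tau>) \<sigma>"
        unfolding sum_lookup_bdry_cells [OF lefschetz Tc] using that by simp
      then show ?thesis by (simp only: sum0 lookup_zero)
    qed
    have paired: "a \<tau> = 0" if \<tau>: "\<tau> \<in> ?D" and fr: "f \<tau> = r" for \<tau>
    proof -
      have \<tau>K: "\<tau> \<in> cells K" and \<tau>T: "\<tau> \<in> ?T" using \<tau> by (auto simp: k_cells_def)
      have "D_snc K f \<tau> \<noteq> 0" using \<tau> by simp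
      then obtain \<sigma> where \<sigma>: "\<sigma> \<in> cells K" "w \<tau> \<sigma> \<noteq> 0" "f \<tau> < f \<sigma>"
        using D_eq_0_iff [OF \<tau>K] by (auto simp: not_le)
      have other: "a t * w t \<sigma> = 0" if t: "t \<in> ?T - {\<tau>}" for t
      proof (rule ccontr)
        assume nz: "a t * w t \<sigma> \<noteq> 0"
        have tK: "t \<in> cells K" using t Tc by blast
        have "f t \<le> r" using r_max t nz by auto
        then have "f t < f \<sigma>" using \<sigma>(3) fr by simp
        then have "t = \<tau>" using U_unique [OF \<sigma>(1) tK \<tau>K _ \<sigma>(2) _ \<sigma>(3)] nz by auto
        then show False using t by blast
      qed
      have "(\<Sum>t\<in>?T. a t * w t \<sigma>) = a \<tau> * w \<tau> \<sigma> + (\<Sum>t\<in>?T - {\<tau>}. a t * w t \<sigma>)"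
        by (rule sum.remove [OF finT \<tau>T])
      also have "(\<Sum>t\<in>?T - {\<tau>}. a t * w t \<sigma>) = 0"
        by (rule sum.neutral) (use other in blast)
      finally show ?thesis using coord [OF \<sigma>(1)] \<sigma>(2) by simp
    qed
    define b where "b = (\<lambda>\<tau>. if f \<tau> = r then a \<tau> else 0)"
    have "(\<Sum>\<tau>\<in>S. b \<tau> *\<^sub>R bdry_cell W \<tau>) = 0"
    proof (rule poly_mapping_eqI)
      fix \<sigma>
      have Sc: "S \<subseteq> cells W" using Scrit by blast
      have "(\<Sum>\<tau>\<in>S. b \<tau> * (if \<sigma> \<in> cells W then incidence W \<tau> \<sigma> else 0)) = 0"
      proof (cases "\<sigma> \<in> cells W \<and> f \<sigma> = r")
        case True
        then have \<sigma>: "\<sigma> \<in> cells W" "f \<sigma> = r" "\<sigma> \<in> cells K" using cells_W_subset by auto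
        \<comment> \<open>A term with nonzero contribution has \<open>f \<tau> \<le> r\<close> by
          maximality and \<open>f \<tau> \<ge> f \<sigma> = r\<close> since no coface of the
          critical cell \<open>\<sigma>\<close> is smaller. So only level \<open>r\<close> counts,
          and there paired cells have coefficient 0.\<close>
        have zero: "a \<tau> * w \<tau> \<sigma> = 0" if "\<tau> \<in> ?T" "f \<tau> \<noteq> r \<or> \<tau> \<in> ?D" for \<tau>
        proof (rule ccontr)
          assume nz: "a \<tau> * w \<tau> \<sigma> \<noteq> 0"
          have "f \<tau> \<le> r" using r_max that(1) nz by auto
          moreover have "f \<sigma> \<le> f \<tau>" using U_eq_0_iff [OF \<sigma>(3)] \<sigma>(1) that(1) Tc nz by (auto simp: cells_W)
          ultimately have "f \<tau> = r" using \<sigma>(2) by simp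
          then show False using that(2) paired nz by auto
        qed
        have "(\<Sum>\<tau>\<in>S. b \<tau> * (if \<sigma> \<in> cells W then incidence W \<tau> \<sigma> else 0)) = (\<Sum>\<tau>\<in>S. a \<tau> * w \<tau> \<sigma>)"
          by (rule sum.cong [OF refl]) (use \<sigma> zero in \<open>auto simp: b_def incidence_W\<close>)
        also have "\<dots> = (\<Sum>\<tau>\<in>?T. a \<tau> * w \<tau> \<sigma>)"
          by (rule sum.mono_neutral_left) (use finT zero in auto)
        also have "\<dots> = 0" by (rule coord [OF \<sigma>(3)])
        finally show ?thesis .
      next
        case False
        then show ?thesis by (intro sum.neutral) (auto simp: b_def incidence_W)
      qed
      then show "Poly_Mapping.lookup (\<Sum>\<tau>\<in>S. b \<tau> *\<^sub>R bdry_cell W \<tau>) \<sigma> = Poly_Mapping.lookup 0 \<sigma>"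
        unfolding sum_lookup_bdry_cells [OF lefschetz_W Sc] by simp
    qed
    then have "b t = 0" if "t \<in> S" for t
      by (rule lin_indep_familyD [OF finS S(2) B(2) [unfolded S(3)] _ that])
    moreover have "t0 \<in> S" using t0(1) paired [OF _ t0(3)] t0(2) by (elim UnE) auto
    ultimately have "b t0 = 0" .
    then show False using t0 by (simp add: b_def)
  qed
  note fam = lin_indep_family [OF finT key]
  have "bdry_cell K ` ?T \<subseteq> boundaries K k"
    unfolding boundaries_eq_span [OF fin] by (rule order_trans [OF image_mono [OF TK] span_superset])
  moreover obtain E where E: "E \<subseteq> boundaries K k" "finite E" "independent E"
      "span E = boundaries K k" "card E = dim (boundaries K k)"
    by (rule finite_basis [OF subspace_boundaries eq_refl [OF boundaries_eq_span [OF fin]] finite_imageI [OF fin]])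
  ultimately have "bdry_cell K ` ?T \<subseteq> span E" by (simp only:)
  then have "card (bdry_cell K ` ?T) \<le> rank_B K k"
    using independent_span_bound [OF E(2) fam(2)] E(5) by (simp add: rank_B_def)
  moreover have "card (bdry_cell K ` ?T) = d_snc K f (Suc k) + rank_B W k"
    using card_image [OF fam(1)] card_Un_disjoint [OF _ finS dis] fin cardS by (simp add: d_snc_def)
  ultimately show ?thesis by simp
qed

end

section \<open>Decomposition into weakly critical sets\<close>

text \<open>The sum of the subspaces is direct because each coordinate sees at most one of them. The
  left side is the dimension of a mere union, which by definition is that of its span.\<close>

lemma dim_disjoint_supports:
  fixes V :: "'r \<Rightarrow> ('c \<Rightarrow>\<^sub>0 real) set"
  assumes "finite R" and V: "\<And>r. r \<in> R \<Longrightarrow> subspace (V r)"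
    and fd: "\<And>r. r \<in> R \<Longrightarrow> V r \<subseteq> span (E r)" "\<And>r. r \<in> R \<Longrightarrow> finite (E r)"
    and D: "\<And>r v. r \<in> R \<Longrightarrow> v \<in> V r \<Longrightarrow> Poly_Mapping.keys v \<subseteq> D r"
    and disj: "\<And>r s. r \<in> R \<Longrightarrow> s \<in> R \<Longrightarrow> r \<noteq> s \<Longrightarrow> D r \<inter> D s = {}"
  shows "dim (\<Union>r\<in>R. V r) = (\<Sum>r\<in>R. dim (V r))"
proof -
  have "\<exists>B. \<forall>r\<in>R. B r \<subseteq> V r \<and> finite (B r) \<and> independent (B r) \<and> span (B r) = V r \<and> card (B r) = dim (V r)"
  proof (rule bchoice, rule ballI)
    fix r assume r: "r \<in> R"
    show "\<exists>B. B \<subseteq> V r \<and> finite B \<and> independent B \<and> span B = V r \<and> card B = dim (V r)"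
      by (rule finite_basis [OF V [OF r] fd(1) [OF r] fd(2) [OF r]]) blast
  qed
  then obtain B where B: "\<And>r. r \<in> R \<Longrightarrow> B r \<subseteq> V r" "\<And>r. r \<in> R \<Longrightarrow> finite (B r)"
      "\<And>r. r \<in> R \<Longrightarrow> independent (B r)" "\<And>r. r \<in> R \<Longrightarrow> span (B r) = V r"
      "\<And>r. r \<in> R \<Longrightarrow> card (B r) = dim (V r)" by blast
  let ?T = "SIGMA r:R. B r"
  have finT: "finite ?T" using assms(1) B(2) by blast
  have key: "\<forall>t\<in>?T. c t = 0" if sum0: "(\<Sum>t\<in>?T. c t *\<^sub>R snd t) = 0" for c
  proof (intro ballI)
    fix t assume "t \<in> ?T"
    then obtain r b where t: "t = (r, b)" "r \<in> R" "b \<in> B r" by blast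
    have "(\<Sum>b\<in>B r. c (r, b) *\<^sub>R b) = 0"
    proof (rule poly_mapping_eqI)
      fix \<sigma>
      have zero: "Poly_Mapping.lookup b \<sigma> = 0" if "s \<in> R" "b \<in> B s" "\<sigma> \<notin> D s" for s b
        using D [OF that(1)] B(1) [OF that(1)] that by (meson in_keys_iff subsetD)
      have "Poly_Mapping.lookup (\<Sum>b\<in>B r. c (r, b) *\<^sub>R b) \<sigma> = (\<Sum>b\<in>B r. c (r, b) * Poly_Mapping.lookup b \<sigma>)"
        by (simp add: lookup_sum lookup_scaleR)
      also have "\<dots> = 0"
      proof (cases "\<sigma> \<in> D r")
        case True
        have "(\<Sum>s\<in>R. \<Sum>b\<in>B s. c (s, b) * Poly_Mapping.lookup b \<sigma>) = Poly_Mapping.lookup (\<Sum>t\<in>?T. c t *\<^sub>R snd t) \<sigma>"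
          using assms(1) B(2) by (simp add: lookup_sum lookup_scaleR sum.Sigma case_prod_unfold)
        also have "\<dots> = 0" by (simp only: sum0 lookup_zero)
        finally have "(\<Sum>s\<in>R. \<Sum>b\<in>B s. c (s, b) * Poly_Mapping.lookup b \<sigma>) = 0" .
        moreover have "(\<Sum>s\<in>R. \<Sum>b\<in>B s. c (s, b) * Poly_Mapping.lookup b \<sigma>)
           = (\<Sum>b\<in>B r. c (r, b) * Poly_Mapping.lookup b \<sigma>) + (\<Sum>s\<in>R - {r}. \<Sum>b\<in>B s. c (s, b) * Poly_Mapping.lookup b \<sigma>)"
          by (rule sum.remove [OF assms(1) t(2)])
        moreover have "(\<Sum>s\<in>R - {r}. \<Sum>b\<in>B s. c (s, b) * Poly_Mapping.lookup b \<sigma>) = 0"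
        proof (intro sum.neutral ballI)
          fix s b assume s: "s \<in> R - {r}" "b \<in> B s"
          then have "\<sigma> \<notin> D s" using disj [of r s] t(2) True by blast
          then show "c (s, b) * Poly_Mapping.lookup b \<sigma> = 0" using zero [of s b] s by simp
        qed
        ultimately show ?thesis by simp
      next
        case False
        then show ?thesis by (intro sum.neutral ballI) (use zero t(2) in simp)
      qed
      finally show "Poly_Mapping.lookup (\<Sum>b\<in>B r. c (r, b) *\<^sub>R b) \<sigma> = Poly_Mapping.lookup 0 \<sigma>" by simp
    qed
    then have "c (r, b) = 0"
      by (rule independentD [OF B(3) [OF t(2)] B(2) [OF t(2)] subset_refl _ t(3)])
    then show "c t = 0" by (simp add: t)
  qed
  note fam = lin_indep_family [where v = snd, OF finT key]
  have im: "snd ` ?T = (\<Union>r\<in>R. B r)" by force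
  have "(\<Union>r\<in>R. V r) \<subseteq> span (\<Union>r\<in>R. B r)"
  proof (rule UN_least)
    fix r assume r: "r \<in> R"
    show "V r \<subseteq> span (\<Union>r\<in>R. B r)"
      unfolding B(4) [OF r, symmetric] by (rule span_mono) (use r in blast)
  qed
  moreover have "(\<Union>r\<in>R. B r) \<subseteq> (\<Union>r\<in>R. V r)" by (rule UN_mono [OF subset_refl B(1)])
  ultimately have "dim (\<Union>r\<in>R. V r) = card (snd ` ?T)"
    using fam(2) unfolding im by (intro dim_unique) auto
  also have "\<dots> = card ?T" by (rule card_image [OF fam(1)])
  also have "\<dots> = (\<Sum>r\<in>R. card (B r))" using assms(1) B(2) by simp
  also have "\<dots> = (\<Sum>r\<in>R. dim (V r))" by (rule sum.cong [OF refl B(5)])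
  finally show ?thesis .
qed

context morse_bott
begin

definition crit_sets :: "'c set set" where
  "crit_sets = {C. C \<noteq> {} \<and> (\<exists>r. C = {\<sigma> \<in> cells W. f \<sigma> = r})}"

text \<open>The incidence is that of \<open>K\<close>, as in the definition of the polynomial of a
  weakly critical set. On such a set it agrees with that of \<open>W\<close>, as \<open>f\<close> is
  constant there.\<close>

definition sub :: "'c set \<Rightarrow> 'c lefschetz" where
  "sub C = \<lparr>cells = C, cell_dim = cell_dim K, incidence = w\<rparr>"

lemma sub_simps [simp]: "cells (sub C) = C" "cell_dim (sub C) = cell_dim K" "incidence (sub C) = w"
  by (simp_all add: sub_def)

lemma crit_sets_image: "crit_sets = (\<lambda>r. {\<sigma> \<in> cells W. f \<sigma> = r}) ` f ` cells W"
  unfolding crit_sets_def by blast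

lemma crit_set_subset: "C \<in> crit_sets \<Longrightarrow> C \<subseteq> cells W"
  by (auto simp: crit_sets_def)

lemma crit_set_iff: "C \<in> crit_sets \<Longrightarrow> \<tau> \<in> C \<Longrightarrow> \<sigma> \<in> C \<longleftrightarrow> \<sigma> \<in> cells W \<and> f \<tau> = f \<sigma>"
  by (auto simp: crit_sets_def)

lemma crit_sets_disjoint: "C \<in> crit_sets \<Longrightarrow> C' \<in> crit_sets \<Longrightarrow> C \<noteq> C' \<Longrightarrow> C \<inter> C' = {}"
  by (auto simp: crit_sets_def)

lemma Union_crit_sets: "\<Union>crit_sets = cells W"
  by (auto simp: crit_sets_image)

text \<open>Incidence in \<open>W\<close> vanishes between different levels, so no face in
  \<open>W\<close> leaves the set containing \<open>\<tau>\<close>. This is the direct sum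
  decomposition at the level of cells.\<close>

lemma faces_sub:
  assumes "C \<in> crit_sets" "\<tau> \<in> C"
  shows "{\<sigma> \<in> C. w \<tau> \<sigma> \<noteq> 0} = {\<sigma> \<in> cells W. incidence W \<tau> \<sigma> \<noteq> 0}"
  using crit_set_iff [OF assms] by (auto simp: incidence_W)

lemma incidence_sub:
  assumes "C \<in> crit_sets" "\<tau> \<in> C" "\<sigma> \<in> C"
  shows "w \<tau> \<sigma> = incidence W \<tau> \<sigma>"
  using crit_set_iff [OF assms(1,2), of \<sigma>] assms(3) by (simp add: incidence_W)

lemma k_cells_sub: "C \<in> crit_sets \<Longrightarrow> k_cells (sub C) k = k_cells W k \<inter> C"
  using crit_set_subset by (auto simp: k_cells_def dim_W)

lemma lefschetz_sub:
  assumes C: "C \<in> crit_sets"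
  shows "lefschetz_complex (sub C)"
  unfolding lefschetz_complex_def
proof (intro conjI allI ballI impI)
  fix k show "finite (k_cells (sub C) k)"
    using lefschetz_complexD(1) [OF lefschetz_W] by (simp add: k_cells_sub [OF C])
next
  fix \<tau> \<sigma> assume "\<tau> \<in> cells (sub C)" "\<sigma> \<in> cells (sub C)" "incidence (sub C) \<tau> \<sigma> \<noteq> 0"
  then have "\<tau> \<in> cells K" "\<sigma> \<in> cells K" "w \<tau> \<sigma> \<noteq> 0"
    using crit_set_subset [OF C] cells_W_subset by auto
  then show "int (cell_dim (sub C) \<tau>) - int (cell_dim (sub C) \<sigma>) = 1"
    using lefschetz_complexD(2) [OF lefschetz] by simp
next
  fix \<tau> \<nu> assume "\<tau> \<in> cells (sub C)" "\<nu> \<in> cells (sub C)"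
  then have \<tau>: "\<tau> \<in> C" and \<nu>: "\<nu> \<in> C" by auto
  have "(\<Sum>\<sigma> | \<sigma> \<in> C \<and> w \<tau> \<sigma> \<noteq> 0. w \<tau> \<sigma> * w \<sigma> \<nu>)
     = (\<Sum>\<sigma> | \<sigma> \<in> cells W \<and> incidence W \<tau> \<sigma> \<noteq> 0. incidence W \<tau> \<sigma> * incidence W \<sigma> \<nu>)"
  proof (rule sum.cong [OF faces_sub [OF C \<tau>]])
    fix \<sigma> assume "\<sigma> \<in> {\<sigma> \<in> cells W. incidence W \<tau> \<sigma> \<noteq> 0}"
    then have "\<sigma> \<in> C" using faces_sub [OF C \<tau>] by blast
    then show "w \<tau> \<sigma> * w \<sigma> \<nu> = incidence W \<tau> \<sigma> * incidence W \<sigma> \<nu>"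
      using incidence_sub [OF C \<tau>] incidence_sub [OF C _ \<nu>] by simp
  qed
  also have "\<dots> = 0"
    by (rule lefschetz_complexD(3) [OF lefschetz_W]) (use \<tau> \<nu> crit_set_subset [OF C] in auto)
  finally show "(\<Sum>\<sigma> | \<sigma> \<in> cells (sub C) \<and> incidence (sub C) \<tau> \<sigma> \<noteq> 0. incidence (sub C) \<tau> \<sigma> * incidence (sub C) \<sigma> \<nu>) = 0"
    by simp
qed

lemma bdry_cell_sub:
  assumes C: "C \<in> crit_sets" and \<tau>: "\<tau> \<in> C"
  shows "bdry_cell (sub C) \<tau> = bdry_cell W \<tau>"
  unfolding bdry_cell_def sub_simps
proof (rule sum.cong [OF faces_sub [OF C \<tau>]])
  fix \<sigma> assume "\<sigma> \<in> {\<sigma> \<in> cells W. incidence W \<tau> \<sigma> \<noteq> 0}"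
  then have "\<sigma> \<in> C" using faces_sub [OF C \<tau>] by blast
  then show "w \<tau> \<sigma> *\<^sub>R Poly_Mapping.single \<sigma> 1 = incidence W \<tau> \<sigma> *\<^sub>R Poly_Mapping.single \<sigma> (1::real)"
    using incidence_sub [OF C \<tau>] by simp
qed

lemma k_cells_W_Union: "k_cells W k = (\<Union>C\<in>crit_sets. k_cells (sub C) k)"
  using Union_crit_sets by (auto simp: k_cells_sub) (auto simp: k_cells_def)

text \<open>Boundaries of \<open>W\<close> are spanned by those of the pieces, and a boundary in the
  piece \<open>C\<close> is supported in \<open>C\<close>.\<close>

lemma rank_B_W:
  assumes "finite crit_sets"
  shows "rank_B W k = (\<Sum>C\<in>crit_sets. rank_B (sub C) k)"
proof -
  note finW = lefschetz_complexD(1) [OF lefschetz_W]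
  have bs: "boundaries (sub C) k = span (bdry_cell W ` k_cells (sub C) (Suc k))" if C: "C \<in> crit_sets" for C
  proof -
    have "bdry_cell (sub C) ` k_cells (sub C) (Suc k) = bdry_cell W ` k_cells (sub C) (Suc k)"
      by (rule image_cong [OF refl bdry_cell_sub [OF C]]) (simp add: k_cells_def)
    then show ?thesis
      using boundaries_eq_span [OF lefschetz_complexD(1) [OF lefschetz_sub [OF C]]] by simp
  qed
  have "boundaries W k = span (\<Union>C\<in>crit_sets. bdry_cell W ` k_cells (sub C) (Suc k))"
    unfolding boundaries_eq_span [OF finW] k_cells_W_Union image_UN ..
  also have "\<dots> = span (\<Union>C\<in>crit_sets. boundaries (sub C) k)"
  proof (rule subset_antisym)
    show "span (\<Union>C\<in>crit_sets. bdry_cell W ` k_cells (sub C) (Suc k)) \<subseteq> span (\<Union>C\<in>crit_sets. boundaries (sub C) k)"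
      by (rule span_mono [OF UN_mono [OF subset_refl]]) (simp add: bs span_superset)
    show "span (\<Union>C\<in>crit_sets. boundaries (sub C) k) \<subseteq> span (\<Union>C\<in>crit_sets. bdry_cell W ` k_cells (sub C) (Suc k))"
    proof (rule span_minimal [OF UN_least subspace_span])
      fix C assume C: "C \<in> crit_sets"
      show "boundaries (sub C) k \<subseteq> span (\<Union>C\<in>crit_sets. bdry_cell W ` k_cells (sub C) (Suc k))"
        unfolding bs [OF C] by (rule span_mono) (use C in blast)
    qed
  qed
  finally have "rank_B W k = dim (\<Union>C\<in>crit_sets. boundaries (sub C) k)"
    unfolding rank_B_def by (simp only: dim_span)
  also have "\<dots> = (\<Sum>C\<in>crit_sets. dim (boundaries (sub C) k))"
  proof (rule dim_disjoint_supports [OF assms subspace_boundaries])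
    fix C assume C: "C \<in> crit_sets"
    show "boundaries (sub C) k \<subseteq> span (bdry_cell W ` k_cells (sub C) (Suc k))" by (simp only: bs [OF C] subset_refl)
    show "finite (bdry_cell W ` k_cells (sub C) (Suc k))"
      by (rule finite_imageI [OF lefschetz_complexD(1) [OF lefschetz_sub [OF C]]])
    fix v assume "v \<in> boundaries (sub C) k"
    then have "v \<in> chains (sub C) k" using boundaries_subset_chains [OF lefschetz_sub [OF C]] by blast
    then show "Poly_Mapping.keys v \<subseteq> C" by (auto simp: chains_def k_cells_def)
  qed (rule crit_sets_disjoint)
  finally show ?thesis by (simp only: rank_B_def)
qed

lemma rank_H_W:
  assumes "finite crit_sets"
  shows "rank_H W k = (\<Sum>C\<in>crit_sets. rank_H (sub C) k)"
proof -
  have "rank_B_below W k = (\<Sum>C\<in>crit_sets. rank_B_below (sub C) k)"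
    by (cases k) (simp_all add: rank_B_below_def rank_B_W [OF assms])
  moreover have "card (k_cells W k) = (\<Sum>C\<in>crit_sets. card (k_cells (sub C) k))"
    unfolding k_cells_W_Union
  proof (rule card_UN_disjoint [OF assms])
    show "\<forall>C\<in>crit_sets. finite (k_cells (sub C) k)"
      using lefschetz_complexD(1) [OF lefschetz_sub] by blast
    show "\<forall>C\<in>crit_sets. \<forall>C'\<in>crit_sets. C \<noteq> C' \<longrightarrow> k_cells (sub C) k \<inter> k_cells (sub C') k = {}"
      using crit_sets_disjoint by (auto simp: k_cells_def)
  qed
  moreover have "(\<Sum>C\<in>crit_sets. card (k_cells (sub C) k))
      = (\<Sum>C\<in>crit_sets. rank_H (sub C) k + rank_B (sub C) k + rank_B_below (sub C) k)"
    by (rule sum.cong [OF refl]) (simp add: rank_H_eq [OF lefschetz_sub])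
  ultimately show ?thesis
    using rank_H_eq [OF lefschetz_W, of k] rank_B_W [OF assms, of k] by (simp add: sum.distrib)
qed

theorem sum_poincare_sub:
  assumes "finite crit_sets"
  shows "(\<Sum>C\<in>crit_sets. poincare (sub C)) = poincare K + (1 + fps_X) * remainder_lefschetz K f"
proof (rule fps_ext)
  fix k
  let ?R = "fps_nth (remainder_lefschetz K f)"
  have "fps_nth (\<Sum>C\<in>crit_sets. poincare (sub C)) k = real (rank_H W k)"
    by (simp add: fps_sum_nth poincare_def rank_H_W [OF assms])
  also have "\<dots> = real (rank_H K k) + ?R k + (case k of 0 \<Rightarrow> 0 | Suc m \<Rightarrow> ?R m)"
  proof -
    \<comment> \<open>A 0-cell has no faces. In degree 0 this replaces the missing coefficient of
      index -1 of the remainder.\<close>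
    have d0: "d_snc K f 0 = 0"
    proof -
      have "D_snc K f \<sigma> = 0" if "\<sigma> \<in> k_cells K 0" for \<sigma>
        using that lefschetz_complexD(2) [OF lefschetz, of \<sigma>] D_eq_0_iff [of \<sigma>] by (fastforce simp: k_cells_def)
      then have "{\<sigma> \<in> k_cells K 0. D_snc K f \<sigma> = 1} = {}" by fastforce
      then show ?thesis by (simp only: d_snc_def card.empty)
    qed
    show ?thesis
      using rank_H_eq [OF lefschetz, of k] rank_H_eq [OF lefschetz_W, of k] card_k_cells [of k] d0
      by (cases k) (simp_all add: rank_B_below_def remainder_lefschetz_def)
  qed
  also have "\<dots> = fps_nth (poincare K + (1 + fps_X) * remainder_lefschetz K f) k"
    by (cases k) (simp_all add: poincare_def distrib_right)
  finally show "fps_nth (\<Sum>C\<in>crit_sets. poincare (sub C)) k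
      = fps_nth (poincare K + (1 + fps_X) * remainder_lefschetz K f) k" .
qed

lemma remainder_nonneg: "fps_nth (remainder_lefschetz K f) k \<in> \<nat>"
proof -
  have "fps_nth (remainder_lefschetz K f) k = real (rank_B K k - d_snc K f (Suc k) - rank_B W k)"
    using rank_B_ge [of k] by (simp add: remainder_lefschetz_def)
  then show ?thesis by simp
qed

end

section \<open>Betti numbers of a CW complex\<close>

lemma common_denominator:
  fixes r :: "'j \<Rightarrow> rat"
  assumes "finite J"
  shows "\<exists>d::int. d > 0 \<and> (\<forall>j\<in>J. \<exists>n::int. of_int d * r j = of_int n)"
  using assms
proof induction
  case empty
  show ?case by (rule exI [of _ 1]) simp
next
  case (insert j J)
  then obtain d :: int where d: "d > 0" "\<And>i. i \<in> J \<Longrightarrow> \<exists>n::int. of_int d * r i = of_int n" by blast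
  obtain a b :: int where ab: "r j = of_int a / of_int b" "b > 0"
    by (cases "r j") (auto simp: Fract_of_int_quotient)
  have "\<exists>n::int. of_int (d * b) * r i = of_int n" if i: "i \<in> insert j J" for i
  proof (cases "i = j")
    case True
    have "of_int (d * b) * r j = of_int (d * a)" using ab by simp
    then show ?thesis using True by blast
  next
    case False
    then obtain n :: int where "of_int d * r i = of_int n" using i d(2) by blast
    then have "of_int (d * b) * r i = of_int (b * n)" by (simp add: mult.commute mult.left_commute)
    then show ?thesis by blast
  qed
  then show ?case using d(1) ab(2) by (intro exI [of _ "d * b"]) simp
qed

text \<open>
  The unknowns are expanded in a basis of their span over the rationals; comparing coefficients,
  each coordinate vector solves the system, and clearing denominators makes it integral.
\<close>
lemma real_solution_from_int_solutions:
  fixes A :: "'i \<Rightarrow> 'j \<Rightarrow> int" and x :: "'j \<Rightarrow> real"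
  assumes "finite J" and sol: "\<forall>i\<in>I. (\<Sum>j\<in>J. x j * of_int (A i j)) = 0"
  shows "\<exists>(B :: real set) (q :: real \<Rightarrow> 'j \<Rightarrow> int) (r :: real \<Rightarrow> real). finite B \<and>
    (\<forall>b\<in>B. \<forall>i\<in>I. (\<Sum>j\<in>J. q b j * A i j) = 0) \<and> (\<forall>j\<in>J. x j = (\<Sum>b\<in>B. r b * of_int (q b j)))"
proof -
  \<comment> \<open>The real numbers as a vector space over the rationals.\<close>
  interpret Q: vector_space "\<lambda>q x. of_rat q * x :: real"
    by standard (auto simp: algebra_simps of_rat_add of_rat_mult)
  obtain B where B: "B \<subseteq> x ` J" "Q.independent B" "x ` J \<subseteq> Q.span B"
    by (rule Q.maximal_independent_subset)
  have fB: "finite B" using B(1) assms(1) finite_subset by blast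
  have "\<exists>u. \<forall>j\<in>J. x j = (\<Sum>b\<in>B. of_rat (u j b) * b)"
  proof (rule bchoice, rule ballI)
    fix j assume "j \<in> J"
    then have "x j \<in> Q.span B" using B(3) by blast
    then show "\<exists>u. x j = (\<Sum>b\<in>B. of_rat (u b) * b)" unfolding Q.span_finite [OF fB] by blast
  qed
  then obtain u where u: "\<And>j. j \<in> J \<Longrightarrow> x j = (\<Sum>b\<in>B. of_rat (u j b) * b)" by blast
  have usol: "(\<Sum>j\<in>J. u j b * of_int (A i j)) = 0" if i: "i \<in> I" and b: "b \<in> B" for i b
  proof -
    have "(\<Sum>b\<in>B. of_rat (\<Sum>j\<in>J. u j b * of_int (A i j)) * b)
       = (\<Sum>b\<in>B. \<Sum>j\<in>J. of_rat (u j b) * b * of_int (A i j))"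
      by (simp add: of_rat_sum of_rat_mult sum_distrib_right sum_distrib_left mult_ac)
    also have "\<dots> = (\<Sum>j\<in>J. \<Sum>b\<in>B. of_rat (u j b) * b * of_int (A i j))" by (rule sum.swap)
    also have "\<dots> = (\<Sum>j\<in>J. x j * of_int (A i j))"
      by (rule sum.cong [OF refl]) (simp add: u sum_distrib_right)
    also have "\<dots> = 0" by (rule bspec [OF sol i])
    finally have "(\<Sum>b\<in>B. of_rat (\<Sum>j\<in>J. u j b * of_int (A i j)) * b) = 0" .
    then show ?thesis
      by (rule Q.independentD [OF B(2) fB subset_refl _ b])
  qed
  have "\<exists>d. \<forall>b\<in>B. d b > (0::int) \<and> (\<forall>j\<in>J. \<exists>n::int. of_int (d b) * u j b = of_int n)"
    by (rule bchoice, rule ballI) (rule common_denominator [OF assms(1)])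
  then obtain d where d: "\<And>b. b \<in> B \<Longrightarrow> d b > (0::int)"
      "\<And>b j. b \<in> B \<Longrightarrow> j \<in> J \<Longrightarrow> \<exists>n::int. of_int (d b) * u j b = of_int n" by blast
  \<comment> \<open>By the choice of \<open>d\<close> the number is already an integer on the
    indices used; the floor only converts its type.\<close>
  define q where "q = (\<lambda>b j. \<lfloor>of_int (d b) * u j b\<rfloor>)"
  have q: "of_int (q b j) = of_int (d b) * u j b" if b: "b \<in> B" and j: "j \<in> J" for b j
  proof -
    obtain n :: int where "of_int (d b) * u j b = of_int n" using d(2) [OF b j] by blast
    then show ?thesis by (simp add: q_def)
  qed
  show ?thesis
  proof (intro exI conjI ballI)
    show "finite B" by (rule fB)
  next
    fix b i assume b: "b \<in> B" and i: "i \<in> I"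
    have "of_int (\<Sum>j\<in>J. q b j * A i j) = of_int (d b) * (\<Sum>j\<in>J. u j b * of_int (A i j))"
      by (simp add: q [OF b] sum_distrib_left mult_ac)
    then have "of_int (\<Sum>j\<in>J. q b j * A i j) = (0::rat)" by (simp add: usol [OF i b])
    then show "(\<Sum>j\<in>J. q b j * A i j) = 0" by (simp only: of_int_eq_0_iff)
  next
    fix j assume j: "j \<in> J"
    \<comment> \<open>The weight of an integral solution is its basis number \<open>b\<close>
      divided by the common denominator \<open>d b\<close>.\<close>
    have "of_rat (u j b) * b = b / of_int (d b) * of_int (q b j)" if b: "b \<in> B" for b
    proof -
      have "of_rat (of_int (q b j)) = (of_rat (of_int (d b) * u j b) :: real)" by (simp only: q [OF b j])
      then have "of_int (q b j) = of_int (d b) * (of_rat (u j b) :: real)" by (simp add: of_rat_mult)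
      then show ?thesis using d(1) [OF b] by simp
    qed
    then show "x j = (\<Sum>b\<in>B. b / of_int (d b) * of_int (q b j))"
      unfolding u [OF j] by (rule sum.cong [OF refl])
  qed
qed

lemma indep_mod_family:
  fixes v :: "'t \<Rightarrow> 'v::real_vector"
  assumes "finite T" "0 \<in> W" and key: "\<And>c. (\<Sum>t\<in>T. c t *\<^sub>R v t) \<in> W \<Longrightarrow> \<forall>t\<in>T. c t = 0"
  shows "inj_on v T" "indep_mod (v ` T) W"
proof -
  show inj: "inj_on v T"
  proof (rule lin_indep_family(1) [OF assms(1)])
    fix c assume "(\<Sum>t\<in>T. c t *\<^sub>R v t) = 0"
    then show "\<forall>t\<in>T. c t = 0" using key [of c] assms(2) by simp
  qed
  show "indep_mod (v ` T) W"
    unfolding indep_mod_def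
  proof (intro conjI allI impI)
    fix c :: "'v \<Rightarrow> real" assume "(\<Sum>s\<in>v ` T. c s *\<^sub>R s) \<in> W"
    then have "(\<Sum>t\<in>T. (c \<circ> v) t *\<^sub>R v t) \<in> W" using inj by (simp add: sum.reindex)
    then show "\<forall>s\<in>v ` T. c s = 0" using key [of "c \<circ> v"] by simp
  qed (use assms in simp)
qed

lemma (in comm_group) int_comb_delta:
  assumes "finite I" "i \<in> I" "g \<in> I \<rightarrow> carrier G"
  shows "int_comb G g I (\<lambda>j. if j = i then 1 else 0) = g i"
proof -
  let ?c = "\<lambda>j. if j = i then 1 else 0 :: int"
  have gi: "g i \<in> carrier G" using assms by blast
  have I: "I = insert i (I - {i})" using assms(2) by blast
  have "finprod G (\<lambda>j. g j [^] ?c j) (insert i (I - {i})) = g i [^] ?c i \<otimes> finprod G (\<lambda>j. g j [^] ?c j) (I - {i})"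
    by (rule finprod_insert) (use assms in \<open>auto simp: Pi_iff\<close>)
  also have "finprod G (\<lambda>j. g j [^] ?c j) (I - {i}) = \<one>"
    by (rule finprod_one_eqI) simp
  finally show ?thesis unfolding int_comb_def using I gi by simp
qed

definition int_indep :: "('g, 'm) monoid_scheme \<Rightarrow> 'g set \<Rightarrow> bool" where
  "int_indep G S \<longleftrightarrow> (\<forall>c. int_comb G (\<lambda>x. x) S c = \<one>\<^bsub>G\<^esub> \<longrightarrow> (\<forall>x\<in>S. c x = 0))"

lemma abelian_rank_alt:
  "abelian_rank G = Sup {card S |S. finite S \<and> S \<subseteq> carrier G \<and> int_indep G S}"
  by (simp only: abelian_rank_def int_indep_def int_comb_def)

text \<open>The family attains the upper bound, so the supremum is a maximum. It has no repetitions,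
  since \<open>h s = h t\<close> would give the relation with coefficients 1 and -1.\<close>

lemma abelian_rank_eq:
  fixes G :: "('g, 'm) monoid_scheme" and h :: "'t \<Rightarrow> 'g"
  assumes "comm_group G"
    and upper: "\<And>S. finite S \<Longrightarrow> S \<subseteq> carrier G \<Longrightarrow> int_indep G S \<Longrightarrow> card S \<le> card T"
    and T: "finite T" "h \<in> T \<rightarrow> carrier G"
    and ind: "\<And>c. int_comb G h T c = \<one>\<^bsub>G\<^esub> \<Longrightarrow> \<forall>t\<in>T. c t = 0"
  shows "abelian_rank G = card T"
proof -
  interpret comm_group G by fact
  have inj: "inj_on h T"
  proof (rule inj_onI, rule ccontr)
    fix s t assume st: "s \<in> T" "t \<in> T" "h s = h t" "s \<noteq> t"
    let ?c = "\<lambda>x. (if x = s then 1 else 0) - (if x = t then 1 else 0 :: int)"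
    have "h t \<in> carrier G" using T st by blast
    then have "int_comb G h T ?c = \<one>\<^bsub>G\<^esub>"
      using st T by (simp add: int_comb_diff [OF T(2)] int_comb_delta)
    then have "?c s = 0" using ind [of ?c] st(1) by blast
    then show False using st(4) by simp
  qed
  have "int_indep G (h ` T)"
    unfolding int_indep_def
  proof (intro allI impI)
    fix c assume 1: "int_comb G (\<lambda>x. x) (h ` T) c = \<one>\<^bsub>G\<^esub>"
    have "int_comb G (\<lambda>x. x) (h ` T) c = int_comb G h T (\<lambda>t. c (h t))"
      unfolding int_comb_def by (rule finprod_reindex [OF _ inj]) (use T in auto)
    then have "int_comb G h T (\<lambda>t. c (h t)) = \<one>\<^bsub>G\<^esub>" using 1 by simp
    from ind [OF this] show "\<forall>x\<in>h ` T. c x = 0" by blast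
  qed
  moreover have "finite (h ` T)" "h ` T \<subseteq> carrier G" "card (h ` T) = card T"
    using T card_image [OF inj] by auto
  ultimately show ?thesis
    unfolding abelian_rank_alt by (intro cSup_eq_maximum) (auto intro: upper, metis)
qed

context finite_cw
begin

section \<open>Integral and real chains of the associated Lefschetz complex\<close>

abbreviation "KM \<equiv> lefschetz_of_cw M"

lemma KM_simps [simp]: "cells KM = cw_cells M" "cell_dim KM = cw_dim M"
   "incidence KM \<tau> \<sigma> = real_of_int (cw_incidence M \<tau> \<sigma>)"
  by (simp_all add: lefschetz_of_cw_def)

lemma k_cells_KM: "k_cells KM k = dcells k"
  by (simp add: k_cells_def dcells_def)

lemma cw_incidence_dim: "cw_incidence M \<tau> \<sigma> \<noteq> 0 \<Longrightarrow> cw_dim M \<tau> = Suc (cw_dim M \<sigma>)"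
  by (simp add: cw_incidence_def Let_def split: if_splits)

lemma lefschetz_KM: "lefschetz_complex KM"
  unfolding lefschetz_complex_def
proof (intro conjI allI ballI impI)
  fix k show "finite (k_cells KM k)" by (simp add: k_cells_KM finite_dcells)
next
  fix \<tau> \<sigma> assume "incidence KM \<tau> \<sigma> \<noteq> 0"
  then show "int (cell_dim KM \<tau>) - int (cell_dim KM \<sigma>) = 1" using cw_incidence_dim [of \<tau> \<sigma>] by simp
next
  fix \<tau> \<nu> assume "\<tau> \<in> cells KM" "\<nu> \<in> cells KM"
  then have c: "\<tau> \<in> cw_cells M" "\<nu> \<in> cw_cells M" by auto
  let ?F = "{\<sigma>. \<sigma> \<in> cw_cells M \<and> cw_incidence M \<tau> \<sigma> \<noteq> 0}"
  have "(\<Sum>\<sigma>\<in>?F. cw_incidence M \<tau> \<sigma> * cw_incidence M \<sigma> \<nu>) = 0"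
  proof (cases "cw_dim M \<tau> = Suc (Suc (cw_dim M \<nu>))")
    case True
    let ?n = "cw_dim M \<nu>"
    have "?F \<subseteq> dcells (Suc ?n)" using cw_incidence_dim True by (auto simp: dcells_def)
    then have "(\<Sum>\<sigma>\<in>?F. cw_incidence M \<tau> \<sigma> * cw_incidence M \<sigma> \<nu>)
       = (\<Sum>\<sigma>\<in>dcells (Suc ?n). cw_incidence M \<tau> \<sigma> * cw_incidence M \<sigma> \<nu>)"
      by (intro sum.mono_neutral_left finite_dcells) (auto simp: dcells_def)
    also have "\<dots> = 0" by (rule cw_incidence_square) (use c True in \<open>auto simp: dcells_def\<close>)
    finally show ?thesis .
  next
    case False
    have "cw_incidence M \<sigma> \<nu> = 0" if "\<sigma> \<in> ?F" for \<sigma>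
    proof (rule ccontr)
      assume "cw_incidence M \<sigma> \<nu> \<noteq> 0"
      then show False using cw_incidence_dim [of \<tau> \<sigma>] cw_incidence_dim [of \<sigma> \<nu>] that False by simp
    qed
    then show ?thesis by (intro sum.neutral) simp
  qed
  then have "real_of_int (\<Sum>\<sigma>\<in>?F. cw_incidence M \<tau> \<sigma> * cw_incidence M \<sigma> \<nu>) = 0" by simp
  then show "(\<Sum>\<sigma> | \<sigma> \<in> cells KM \<and> incidence KM \<tau> \<sigma> \<noteq> 0. incidence KM \<tau> \<sigma> * incidence KM \<sigma> \<nu>) = 0"
    by simp
qed

definition real_chain :: "nat \<Rightarrow> ('c \<Rightarrow> int) \<Rightarrow> 'c \<Rightarrow>\<^sub>0 real" where
  "real_chain k c = (\<Sum>\<sigma>\<in>dcells k. real_of_int (c \<sigma>) *\<^sub>R Poly_Mapping.single \<sigma> 1)"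

lemma lookup_real_chain:
  "Poly_Mapping.lookup (real_chain k c) \<sigma> = (if \<sigma> \<in> dcells k then real_of_int (c \<sigma>) else 0)"
  by (simp add: real_chain_def lookup_sum lookup_single_scaled finite_dcells)

lemma real_chain_in_chains: "real_chain k c \<in> chains KM k"
  unfolding chains_alt k_cells_KM by (simp add: lookup_real_chain)

lemma lookup_bdry_KM:
  assumes "z \<in> chains KM k"
  shows "Poly_Mapping.lookup (bdry KM z) \<nu>
     = (if \<nu> \<in> cw_cells M then \<Sum>\<sigma>\<in>dcells k. Poly_Mapping.lookup z \<sigma> * real_of_int (cw_incidence M \<sigma> \<nu>) else 0)"
proof -
  have "bdry KM z = (\<Sum>\<sigma>\<in>dcells k. Poly_Mapping.lookup z \<sigma> *\<^sub>R bdry_cell KM \<sigma>)"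
    by (rule bdry_eq_sum [OF finite_dcells]) (use assms in \<open>simp add: chains_def k_cells_KM\<close>)
  also have "Poly_Mapping.lookup \<dots> \<nu> = (\<Sum>\<sigma>\<in>dcells k. Poly_Mapping.lookup z \<sigma> * (if \<nu> \<in> cells KM then incidence KM \<sigma> \<nu> else 0))"
    by (rule sum_lookup_bdry_cells [OF lefschetz_KM]) (auto simp: dcells_def)
  finally show ?thesis by simp
qed

lemma cycles_KM_iff:
  assumes "z \<in> chains KM k"
  shows "z \<in> cycles KM k \<longleftrightarrow>
    (\<forall>m. k = Suc m \<longrightarrow> (\<forall>\<nu>\<in>dcells m. (\<Sum>\<sigma>\<in>dcells k. Poly_Mapping.lookup z \<sigma> * real_of_int (cw_incidence M \<sigma> \<nu>)) = 0))"
    (is "_ \<longleftrightarrow> ?R")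
proof
  assume "z \<in> cycles KM k"
  then have "bdry KM z = 0" by (simp add: cycles_def)
  then have lookup0: "Poly_Mapping.lookup (bdry KM z) \<nu> = 0" for \<nu> by simp
  show ?R
  proof (intro allI impI ballI)
    fix m \<nu> assume "\<nu> \<in> dcells m"
    then have "\<nu> \<in> cw_cells M" by (simp add: dcells_def)
    then show "(\<Sum>\<sigma>\<in>dcells k. Poly_Mapping.lookup z \<sigma> * real_of_int (cw_incidence M \<sigma> \<nu>)) = 0"
      using lookup0 [of \<nu>] unfolding lookup_bdry_KM [OF assms] by simp
  qed
next
  assume R: ?R
  have "bdry KM z = 0"
  proof (rule poly_mapping_eqI)
    fix \<nu>
    have "(\<Sum>\<sigma>\<in>dcells k. Poly_Mapping.lookup z \<sigma> * real_of_int (cw_incidence M \<sigma> \<nu>)) = 0" if "\<nu> \<in> cw_cells M"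
    proof (cases "k = Suc (cw_dim M \<nu>)")
      case True
      then show ?thesis using R that by (simp add: dcells_def)
    next
      case False
      then have "cw_incidence M \<sigma> \<nu> = 0" if "\<sigma> \<in> dcells k" for \<sigma>
        using that cw_incidence_dim [of \<sigma> \<nu>] by (auto simp: dcells_def)
      then show ?thesis by (intro sum.neutral) simp
    qed
    then show "Poly_Mapping.lookup (bdry KM z) \<nu> = Poly_Mapping.lookup 0 \<nu>"
      unfolding lookup_bdry_KM [OF assms] by simp
  qed
  then show "z \<in> cycles KM k" using assms by (simp add: cycles_def)
qed

lemma real_chain_cycle:
  assumes "c \<in> int_cycles k"
  shows "real_chain k c \<in> cycles KM k"
  unfolding cycles_KM_iff [OF real_chain_in_chains]
proof (intro allI impI ballI)
  fix m \<nu> assume m: "k = Suc m" and \<nu>: "\<nu> \<in> dcells m"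
  have "(\<Sum>\<sigma>\<in>dcells k. Poly_Mapping.lookup (real_chain k c) \<sigma> * real_of_int (cw_incidence M \<sigma> \<nu>))
     = real_of_int (int_bdry m c \<nu>)"
    unfolding int_bdry_def m by (simp add: lookup_real_chain)
  then show "(\<Sum>\<sigma>\<in>dcells k. Poly_Mapping.lookup (real_chain k c) \<sigma> * real_of_int (cw_incidence M \<sigma> \<nu>)) = 0"
    using assms m \<nu> by (simp add: int_cycles_def)
qed

lemma real_chain_bdry: "real_chain k (int_bdry k b) = bdry KM (real_chain (Suc k) b)"
proof (rule poly_mapping_eqI)
  fix \<sigma>
  have "cw_incidence M \<tau> \<sigma> = 0" if "\<sigma> \<in> cw_cells M" "\<sigma> \<notin> dcells k" "\<tau> \<in> dcells (Suc k)" for \<tau>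
    using that cw_incidence_dim [of \<tau> \<sigma>] by (auto simp: dcells_def)
  then show "Poly_Mapping.lookup (real_chain k (int_bdry k b)) \<sigma> = Poly_Mapping.lookup (bdry KM (real_chain (Suc k) b)) \<sigma>"
    unfolding lookup_bdry_KM [OF real_chain_in_chains]
    by (auto simp: lookup_real_chain int_bdry_def dcells_def intro!: sum.neutral)
qed

text \<open>Being a cycle is a homogeneous linear system with integral coefficients, so every real
  cycle is a real combination of integral ones.\<close>

lemma cycles_KM_span: "span (real_chain k ` int_cycles k) = cycles KM k"
proof
  show "span (real_chain k ` int_cycles k) \<subseteq> cycles KM k"
    by (rule span_minimal [OF _ subspace_cycles]) (use real_chain_cycle in blast)
  show "cycles KM k \<subseteq> span (real_chain k ` int_cycles k)"
  proof
    fix z assume z: "z \<in> cycles KM k"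
    then have zc: "z \<in> chains KM k" by (simp add: cycles_def)
    let ?I = "{\<nu>. \<exists>m. k = Suc m \<and> \<nu> \<in> dcells m}"
    have sol: "\<forall>\<nu>\<in>?I. (\<Sum>\<sigma>\<in>dcells k. Poly_Mapping.lookup z \<sigma> * of_int (cw_incidence M \<sigma> \<nu>)) = 0"
      using z unfolding cycles_KM_iff [OF zc] by blast
    obtain B :: "real set" and q :: "real \<Rightarrow> 'c \<Rightarrow> int" and r :: "real \<Rightarrow> real"
      where B: "finite B" "\<forall>b\<in>B. \<forall>\<nu>\<in>?I. (\<Sum>\<sigma>\<in>dcells k. q b \<sigma> * cw_incidence M \<sigma> \<nu>) = 0"
        "\<forall>\<sigma>\<in>dcells k. Poly_Mapping.lookup z \<sigma> = (\<Sum>b\<in>B. r b * of_int (q b \<sigma>))"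
      using real_solution_from_int_solutions [where A = "\<lambda>\<nu> \<sigma>. cw_incidence M \<sigma> \<nu>", OF finite_dcells sol]
      by (elim exE conjE) (rule that)
    have "q b \<in> int_cycles k" if "b \<in> B" for b
      using bspec [OF B(2) that] by (auto simp: int_cycles_def int_bdry_def)
    then have "(\<Sum>b\<in>B. r b *\<^sub>R real_chain k (q b)) \<in> span (real_chain k ` int_cycles k)"
      by (intro span_sum span_scale span_base) blast
    moreover have "z = (\<Sum>b\<in>B. r b *\<^sub>R real_chain k (q b))"
    proof (rule poly_mapping_eqI)
      fix \<sigma>
      show "Poly_Mapping.lookup z \<sigma> = Poly_Mapping.lookup (\<Sum>b\<in>B. r b *\<^sub>R real_chain k (q b)) \<sigma>"
        using zc unfolding chains_alt k_cells_KM
        by (cases "\<sigma> \<in> dcells k") (simp_all add: lookup_sum lookup_scaleR lookup_real_chain B(3))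
    qed
    ultimately show "z \<in> span (real_chain k ` int_cycles k)" by simp
  qed
qed

text \<open>The upper bound for the Betti number. A real relation between integral cycles modulo
  real boundaries solves an integral system and hence splits into integral relations modulo integral
  boundaries; these are trivial by assumption.\<close>

lemma card_le_rank_H:
  assumes S: "finite S" "S \<subseteq> carrier (homology_group (int k) X)"
    and ind: "int_indep (homology_group (int k) X) S"
  shows "card S + dim (boundaries KM k) \<le> dim (cycles KM k)"
proof -
  have "\<exists>c. \<forall>h\<in>S. c h \<in> int_cycles k \<and> h = homology_class k (c h)"
  proof (rule bchoice, rule ballI)
    fix h assume "h \<in> S"
    then have "h \<in> carrier (homology_group (int k) X)" using S(2) by blast
    then show "\<exists>c. c \<in> int_cycles k \<and> h = homology_class k c" by (rule homology_class_surj) blast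
  qed
  then obtain c where c: "\<And>h. h \<in> S \<Longrightarrow> c h \<in> int_cycles k" "\<And>h. h \<in> S \<Longrightarrow> h = homology_class k (c h)" by blast
  have key: "\<forall>h\<in>S. a h = 0" if mem: "(\<Sum>h\<in>S. a h *\<^sub>R real_chain k (c h)) \<in> boundaries KM k" for a
  proof -
    obtain y where y: "y \<in> chains KM (Suc k)" "(\<Sum>h\<in>S. a h *\<^sub>R real_chain k (c h)) = bdry KM y"
      using mem by (auto simp: boundaries_def)
    \<comment> \<open>The unknowns are the coefficients \<open>a\<close> of the relation and, with
      negated sign, those of the bounding chain \<open>y\<close>. There is one equation for each
      \<open>k\<close>-cell.\<close>
    let ?J = "S <+> dcells (Suc k)"
    let ?x = "case_sum a (\<lambda>\<tau>. - Poly_Mapping.lookup y \<tau>)"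
    let ?A = "\<lambda>\<sigma>. case_sum (\<lambda>h. c h \<sigma>) (\<lambda>\<tau>. cw_incidence M \<tau> \<sigma>)"
    have fJ: "finite ?J" using S(1) finite_dcells by simp
    have sumJ: "(\<Sum>j\<in>?J. g j) = (\<Sum>h\<in>S. g (Inl h)) + (\<Sum>\<tau>\<in>dcells (Suc k). g (Inr \<tau>))"
      for g :: "'a chain set + 'c \<Rightarrow> 't::comm_monoid_add"
      using S(1) finite_dcells by (simp add: sum.Plus)
    have sol: "\<forall>\<sigma>\<in>dcells k. (\<Sum>j\<in>?J. ?x j * of_int (?A \<sigma> j)) = 0"
    proof
      fix \<sigma> assume \<sigma>: "\<sigma> \<in> dcells k"
      have "(\<Sum>h\<in>S. a h * of_int (c h \<sigma>)) = Poly_Mapping.lookup (\<Sum>h\<in>S. a h *\<^sub>R real_chain k (c h)) \<sigma>"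
        using \<sigma> by (simp add: lookup_sum lookup_scaleR lookup_real_chain)
      also have "\<dots> = (\<Sum>\<tau>\<in>dcells (Suc k). Poly_Mapping.lookup y \<tau> * of_int (cw_incidence M \<tau> \<sigma>))"
        unfolding y(2) lookup_bdry_KM [OF y(1)] using \<sigma> by (simp add: dcells_def)
      finally show "(\<Sum>j\<in>?J. ?x j * of_int (?A \<sigma> j)) = 0" by (simp add: sumJ sum_negf)
    qed
    obtain B :: "real set" and q :: "real \<Rightarrow> 'a chain set + 'c \<Rightarrow> int" and r :: "real \<Rightarrow> real"
      where B: "finite B" "\<forall>b\<in>B. \<forall>\<sigma>\<in>dcells k. (\<Sum>j\<in>?J. q b j * ?A \<sigma> j) = 0"
        "\<forall>j\<in>?J. ?x j = (\<Sum>b\<in>B. r b * of_int (q b j))"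
      using real_solution_from_int_solutions [where A = ?A, OF fJ sol]
      by (elim exE conjE) (rule that)
    \<comment> \<open>Each integral solution exhibits an integral combination of the cycles as a
      boundary, that is, a relation between the given homology classes.\<close>
    have q0: "q b (Inl h) = 0" if b: "b \<in> B" and h: "h \<in> S" for b h
    proof -
      let ?n = "\<lambda>h. q b (Inl h)" and ?m = "\<lambda>\<tau>. - q b (Inr \<tau>)"
      let ?z = "\<lambda>\<sigma>. \<Sum>h\<in>S. ?n h * c h \<sigma>"
      have eq: "\<forall>\<sigma>\<in>dcells k. ?z \<sigma> = int_bdry k ?m \<sigma>"
      proof
        fix \<sigma> assume "\<sigma> \<in> dcells k"
        from bspec [OF bspec [OF B(2) b] this] show "?z \<sigma> = int_bdry k ?m \<sigma>"
          by (simp add: sumJ int_bdry_def sum_negf)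
      qed
      have "chain_of k ?z \<in> to_chain k ` carrier (skel_homology k)"
        unfolding iffD2 [OF chain_of_eq_iff eq] by (rule iffD2 [OF chain_of_in_image_iff int_bdry_cycle])
      then have zc: "?z \<in> int_cycles k" by (rule iffD1 [OF chain_of_in_image_iff])
      have "int_comb (homology_group (int k) X) (\<lambda>h. h) S ?n
         = int_comb (homology_group (int k) X) (\<lambda>h. homology_class k (c h)) S ?n"
      proof (rule int_comb_cong [OF refl c(2) abelian_relative_homology_group])
        show "(\<lambda>h. homology_class k (c h)) \<in> S \<rightarrow> carrier (homology_group (int k) X)"
          by (intro Pi_I homology_class_carrier c(1))
      qed
      also have "\<dots> = homology_class k ?z" by (rule homology_class_sum [OF S(1) c(1)])
      also have "\<dots> = one (homology_group (int k) X)"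
        unfolding homology_class_eq_one_iff [OF zc] using eq by blast
      finally have "\<forall>h\<in>S. ?n h = 0" using ind unfolding int_indep_def by (elim allE) (erule mp)
      then show ?thesis using h by blast
    qed
    show ?thesis
    proof
      fix h assume h: "h \<in> S"
      have "?x (Inl h) = (\<Sum>b\<in>B. r b * of_int (q b (Inl h)))" by (rule bspec [OF B(3) InlI [OF h]])
      then show "a h = 0" using q0 [OF _ h] by simp
    qed
  qed
  have zero: "0 \<in> boundaries KM k" by (rule subspace_0 [OF subspace_boundaries])
  note fam = indep_mod_family [OF S(1) zero key]
  have "card ((\<lambda>h. real_chain k (c h)) ` S) + dim (boundaries KM k) \<le> dim (cycles KM k)"
  proof (rule card_indep_mod_le [OF subspace_cycles _ _ subspace_boundaries boundaries_subset_cycles [OF lefschetz_KM] _ fam(2)])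
    show "cycles KM k \<subseteq> span ((\<lambda>\<tau>. Poly_Mapping.single \<tau> 1) ` k_cells KM k)"
      unfolding chains_eq_span [OF lefschetz_complexD(1) [OF lefschetz_KM], symmetric] by (auto simp: cycles_def)
    show "finite ((\<lambda>\<tau>. Poly_Mapping.single \<tau> (1::real)) ` k_cells KM k)"
      by (rule finite_imageI [OF lefschetz_complexD(1) [OF lefschetz_KM]])
    show "(\<lambda>h. real_chain k (c h)) ` S \<subseteq> cycles KM k" using c(1) real_chain_cycle by blast
  qed
  then show ?thesis using card_image [OF fam(1)] by simp
qed

text \<open>Representatives of a basis of real homology are chosen among integral cycles. An
  integral relation between their classes is a real relation modulo boundaries, so the classes are
  independent, and the preceding bound shows that no larger independent set exists.\<close>

theorem betti_eq_rank_H: "betti X k = rank_H KM k"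
proof -
  let ?H = "homology_group (int k) X"
  have "cycles KM k \<subseteq> span ((\<lambda>\<tau>. Poly_Mapping.single \<tau> 1) ` k_cells KM k)"
    unfolding chains_eq_span [OF lefschetz_complexD(1) [OF lefschetz_KM], symmetric] by (auto simp: cycles_def)
  then obtain T where T: "T \<subseteq> real_chain k ` int_cycles k" "indep_mod T (boundaries KM k)"
      "card T + dim (boundaries KM k) = dim (cycles KM k)"
    by (rule indep_mod_extension [OF cycles_KM_span _ finite_imageI [OF lefschetz_complexD(1) [OF lefschetz_KM]]
        subspace_boundaries boundaries_subset_cycles [OF lefschetz_KM]])
  have rank: "card T = rank_H KM k"
    using rank_H_cycles [OF lefschetz_KM, of k] T(3) by (simp add: rank_B_def)
  have finT: "finite T" using T(2) by (simp add: indep_mod_def)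
  have "\<exists>c. \<forall>t\<in>T. c t \<in> int_cycles k \<and> t = real_chain k (c t)"
    by (rule bchoice) (use T(1) in blast)
  then obtain c where c: "\<And>t. t \<in> T \<Longrightarrow> c t \<in> int_cycles k" "\<And>t. t \<in> T \<Longrightarrow> t = real_chain k (c t)" by blast
  have "abelian_rank ?H = card T"
  proof (rule abelian_rank_eq [where h = "\<lambda>t. homology_class k (c t)", OF abelian_relative_homology_group _ finT])
    show "card S \<le> card T" if "finite S" "S \<subseteq> carrier ?H" "int_indep ?H S" for S
      using card_le_rank_H [OF that] T(3) by simp
    show "(\<lambda>t. homology_class k (c t)) \<in> T \<rightarrow> carrier ?H" using c(1) homology_class_carrier by blast
    fix n assume 1: "int_comb ?H (\<lambda>t. homology_class k (c t)) T n = one ?H"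
    let ?z = "\<lambda>\<sigma>. \<Sum>t\<in>T. n t * c t \<sigma>"
    have "homology_class k ?z = one ?H" using 1 homology_class_sum [OF finT c(1)] by simp
    moreover have "?z \<in> int_cycles k"
    proof -
      have "int_bdry m ?z \<nu> = (\<Sum>t\<in>T. n t * int_bdry m (c t) \<nu>)" for m \<nu>
        unfolding int_bdry_def sum_distrib_right sum_distrib_left
        by (subst sum.swap) (simp add: mult.assoc)
      then show ?thesis using c(1) by (auto simp: int_cycles_def)
    qed
    ultimately obtain b where b: "\<forall>\<sigma>\<in>dcells k. ?z \<sigma> = int_bdry k b \<sigma>"
      using homology_class_eq_one_iff by blast
    have "(\<Sum>t\<in>T. real_of_int (n t) *\<^sub>R t) = real_chain k (int_bdry k b)"
    proof (rule poly_mapping_eqI)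
      fix \<sigma>
      have "Poly_Mapping.lookup (\<Sum>t\<in>T. real_of_int (n t) *\<^sub>R t) \<sigma>
         = (\<Sum>t\<in>T. real_of_int (n t) * Poly_Mapping.lookup (real_chain k (c t)) \<sigma>)"
        unfolding lookup_sum lookup_scaleR by (rule sum.cong [OF refl]) (use c(2) in simp)
      also have "\<dots> = (if \<sigma> \<in> dcells k then real_of_int (?z \<sigma>) else 0)"
        by (simp add: lookup_real_chain)
      also have "\<dots> = Poly_Mapping.lookup (real_chain k (int_bdry k b)) \<sigma>"
        using b by (simp add: lookup_real_chain)
      finally show "Poly_Mapping.lookup (\<Sum>t\<in>T. real_of_int (n t) *\<^sub>R t) \<sigma>
         = Poly_Mapping.lookup (real_chain k (int_bdry k b)) \<sigma>" .
    qed
    then have "(\<Sum>t\<in>T. real_of_int (n t) *\<^sub>R t) \<in> boundaries KM k"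
      unfolding real_chain_bdry boundaries_def using real_chain_in_chains by (simp only: imageI)
    then show "\<forall>t\<in>T. n t = 0"
      using indep_modD [OF T(2), of "\<lambda>t. real_of_int (n t)"] by simp
  qed
  then show ?thesis using rank by (simp add: betti_def)
qed

end

section \<open>The remainder\<close>

lemma cw_U_snc_eq: "U_snc (lefschetz_of_cw M) f = cw_U_snc M f"
  and cw_D_snc_eq: "D_snc (lefschetz_of_cw M) f = cw_D_snc M f"
  by (simp_all add: fun_eq_iff U_snc_def D_snc_def cw_U_snc_def cw_D_snc_def lefschetz_of_cw_def)

theorem corollary5p19:
  fixes M :: "('a, 'c) cw" and f :: "'c \<Rightarrow> real"
  assumes "finite_cw_complex M"
    and "cw_discrete_morse_bott M f"
  shows "lefschetz_complex (lefschetz_of_cw M)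
    \<and> discrete_morse_bott (lefschetz_of_cw M) f
    \<and> remainder_cw M f = remainder_lefschetz (lefschetz_of_cw M) f
    \<and> (\<forall>k. fps_nth (remainder_cw M f) k \<in> \<nat>)"
proof -
  interpret finite_cw M by unfold_locales (rule assms)
  have mb: "discrete_morse_bott KM f"
    using assms(2) by (simp add: discrete_morse_bott_def cw_discrete_morse_bott_def cw_U_snc_eq cw_D_snc_eq)
  interpret mb: morse_bott KM f by unfold_locales (rule lefschetz_KM mb)+
  have cells_W: "cells (weakly_critical_complex KM f) = {\<sigma> \<in> cw_cells M. cw_U_snc M f \<sigma> + cw_D_snc M f \<sigma> = 0}"
    by (simp add: weakly_critical_complex_def cw_U_snc_eq cw_D_snc_eq)
  have "{\<sigma> \<in> cw_cells M. f \<sigma> = r \<and> cw_U_snc M f \<sigma> + cw_D_snc M f \<sigma> = 0}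
     = {\<sigma> \<in> cells (weakly_critical_complex KM f). f \<sigma> = r}" for r
    unfolding cells_W by blast
  then have crit: "weakly_critical_sets M f = mb.crit_sets"
    unfolding weakly_critical_sets_def mb.crit_sets_def by (simp only:)
  have fin: "finite mb.crit_sets"
    unfolding mb.crit_sets_image cells_W using finite_cells by simp
  have sub: "poincare_cells M C = poincare (mb.sub C)" for C
    unfolding poincare_cells_def mb.sub_def by (simp add: lefschetz_of_cw_def)
  have space: "poincare_space X = poincare KM"
    by (simp add: poincare_space_def poincare_def betti_eq_rank_H)
  have sum: "(\<Sum>C\<in>weakly_critical_sets M f. poincare_cells M C)
     = poincare_space X + (1 + fps_X) * remainder_lefschetz KM f"
    unfolding crit sub space by (rule mb.sum_poincare_sub [OF fin])
  \<comment> \<open>Real power series have no zero divisors, so a nonzero factor can be cancelled;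
    this gives the uniqueness demanded by the description operator.\<close>
  have "fps_nth (1 + fps_X :: real fps) 0 \<noteq> 0" by simp
  then have nz: "(1 + fps_X :: real fps) \<noteq> 0" by force
  have rem: "remainder_cw M f = remainder_lefschetz KM f"
    unfolding remainder_cw_def
  proof (rule the_equality, rule sum)
    fix R assume "(\<Sum>C\<in>weakly_critical_sets M f. poincare_cells M C) = poincare_space X + (1 + fps_X) * R"
    then have "(1 + fps_X) * R = (1 + fps_X) * remainder_lefschetz KM f"
      using sum by (simp only: add_left_cancel)
    then show "R = remainder_lefschetz KM f" by (rule iffD1 [OF mult_left_cancel [OF nz]])
  qed
  show ?thesis using lefschetz_KM mb rem mb.remainder_nonneg by simp
qed

end
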